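(* Let $X=Y_{\mathcal A,\mathcal B}$ be an affine quasinormal toric supervariety with supertorus $T_{N,c}$, presented as a closed subvariety of $\mathbb C^{r|s}$ by $\mathcal A=\{m_1,\dots,m_r\}$ and $\mathcal B=\{n_1,\dots,n_s\}$ with $n_j=\sum_{i=1}^rp_i^jm_i$, $p_i^j\in\mathbb N$. Let $\mathfrak p=(a_1,\dots,a_r\mid0,\dots,0)$ be a closed point of $X$, and let $\sigma$ be the cone with $\mathfrak p\in\operatorname{Orb}(\sigma)$. Write $a^{p^j}=\prod_{i=1}^ra_i^{p_i^j}$. Then $$\operatorname{Stab}_{T_{N,c}}(\mathfrak p)\cong\begin{cases}T_{N_\sigma,c}&\text{if }a^{p^j}=0\text{ for all }j=1,\dots,s,\\ T_{N_\sigma}&\text{otherwise,}\end{cases}$$ where, in the first case, $c$ lies in the subspace $(N_\sigma)_{\mathbb C}\subset N_{\mathbb C}$; and $$T_{N,c}\cdot\mathfrak p\cong\begin{cases}T_{N(\sigma)}&\text{if }a^{p^j}=0\text{ for all }j=1,\dots,s,\\ T_{N(\sigma),\bar c}&\text{otherwise,}\end{cases}$$ where $\bar c$ is the image of $c$ under $N_{\mathbb C}\to N(\sigma)_{\mathbb C}$.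
   Context: Ground field $\mathbb C$. For a lattice $N$ with $M=N^*$: $T_N=N\otimes\mathbb C^\times$, and for $c\in N_{\mathbb C}$, $T_{N,c}$ is the supertorus with coordinate Hopf superalgebra $\mathbb C[M,\xi]$ ($\xi$ odd, $\xi^2=0$), $\Delta x^m=x^m\otimes x^m(1+\langle m,c\rangle\xi\otimes\xi)$, $\Delta\xi=\xi\otimes1+1\otimes\xi$. A toric supervariety with supertorus $T$ is a supervariety containing $T$ as an open subscheme such that the action of $T$ on itself extends to the whole supervariety; it is quasinormal if its underlying ordinary variety $X_0$ is normal (so $X_0$ is a normal affine toric variety with torus $T_N$). Presentation: $\mathcal A=\{m_1,\dots,m_r\}$ is a finite subset of $M$ with $\mathbb Z\mathcal A=M$ generating the semigroup $S=\mathbb N\mathcal A$ with $\mathbb C[X_0]=\mathbb C[S]$, ordered so that $\langle m_i,c\rangle\neq0$ for $i\le q$ and $\langle m_i,c\rangle=0$ for $i>q$. $\mathcal B=\{n_1,\dots,n_s\}$ is a nonempty finite set with $n_j=m_j$ for $j=1,\dots,q$ (so $p^j_i=\delta_{ij}$ for $j\le q$) and $n_j=\sum_{i>q}p_i^jm_i\in\mathbb N\{m_{q+1},\dots,m_r\}$ for $j>q$. $Y_{\mathcal A,\mathcal B}\subseteq\mathbb C^{r|s}$ is the Zariski closure of the image of $T_{N,c}\to\mathbb C^{r|s}$, $(t\mid\xi)\mapsto(t^{m_1},\dots,t^{m_r}\mid t^{n_1}\xi,\dots,t^{n_s}\xi)$; its coordinate ring is $\mathbb C[x^{m_1},\dots,x^{m_r},x^{n_1}\xi,\dots,x^{n_s}\xi]\subseteq\mathbb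 C[M,\xi]$. $\operatorname{Orb}(\sigma)$ is the $T_N$-orbit of the normal toric variety $X_0$ corresponding to the cone $\sigma$ of its fan under the orbit-cone correspondence. $N_\sigma$ is the sublattice of $N$ spanned by $\sigma\cap N$, and $N(\sigma)=N/N_\sigma$. For an affine algebraic supergroup $G$ acting on a supervariety $X$ and a closed point $\mathfrak p\in|X|$, with $\mathfrak p_A$ denoting $\mathfrak p$ viewed as an $A$-point for a superalgebra $A$: $\operatorname{Stab}_G(\mathfrak p)$ is the group functor $A\mapsto\{g\in G(A)\mid g\cdot\mathfrak p_A=\mathfrak p_A\}$ (an affine algebraic supergroup), and the orbit functor $G\cdot\mathfrak p$ is $A\mapsto G(A)\cdot\mathfrak p_A\cong G(A)/\operatorname{Stab}_G(\mathfrak p)(A)$. *)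

theory Defs
  imports
    Complex_Main
    "HOL-Library.FuncSet"
    "HOL-Library.Function_Algebras"
    "HOL-Library.Poly_Mapping"
    "HOL-Algebra.Module"
    "HOL-Algebra.Coset"
    "HOL-Algebra.Generated_Rings"
    "HOL-Algebra.Free_Abelian_Groups"
    "HOL-Algebra.Algebraic_Closure_Type"
begin

section \<open>Lattices\<close>

definition Zlattice :: "('n, 'b) monoid_scheme \<Rightarrow> bool" where
  "Zlattice L \<longleftrightarrow> comm_group L \<and> (\<exists>d::nat. L \<cong> free_Abelian_group {..<d})"

text \<open>Elements of the dual lattice are extended by zero outside the carrier, so that the dual
  is an additive subgroup of the function type and its group algebra is a subring of
  \<^typ>\<open>('n \<Rightarrow> int) \<Rightarrow>\<^sub>0 complex\<close>. The pairing of \<open>m\<close> with \<open>n\<close> is \<open>m n\<close>.\<close>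

definition dual :: "('n, 'b) monoid_scheme \<Rightarrow> ('n \<Rightarrow> int) set" where
  "dual L = {m. m \<in> hom L integer_group \<and> (\<forall>x. x \<notin> carrier L \<longrightarrow> m x = 0)}"

text \<open>For a lattice \<open>L\<close>, the map sending \<open>n \<otimes> z\<close> to \<open>m \<mapsto> z \<langle>m, n\<rangle>\<close> identifies \<open>L \<otimes> K\<close> with the
  \<open>K\<close>-span of the evaluations at the points of \<open>L\<close>; so an element \<open>u\<close> of \<open>L \<otimes> K\<close> is represented
  by the function \<open>m \<mapsto> \<langle>m, u\<rangle>\<close> on the dual lattice (again extended by zero).\<close>

definition lat_incl :: "('n, 'b) monoid_scheme \<Rightarrow> 'n \<Rightarrow> ('n \<Rightarrow> int) \<Rightarrow> 'k::field_char_0" where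
  "lat_incl L n = (\<lambda>m. if m \<in> dual L then of_int (m n) else 0)"

definition lat_tensor :: "('n, 'b) monoid_scheme \<Rightarrow> (('n \<Rightarrow> int) \<Rightarrow> 'k::field_char_0) set" where
  "lat_tensor L =
     {\<lambda>m. \<Sum>n\<in>F. z n * lat_incl L n m | F z. finite F \<and> F \<subseteq> carrier L}"

text \<open>The \<open>K\<close>-linear map \<open>L \<otimes> K \<rightarrow> L' \<otimes> K\<close> induced by a homomorphism \<open>\<phi>: L \<rightarrow> L'\<close>,
  characterised by \<open>\<langle>m', \<phi> u\<rangle> = \<langle>m' \<circ> \<phi>, u\<rangle>\<close>.\<close>

definition lat_pushforward ::
  "('n, 'b) monoid_scheme \<Rightarrow> ('p, 'c) monoid_scheme \<Rightarrow> ('n \<Rightarrow> 'p)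
     \<Rightarrow> (('n \<Rightarrow> int) \<Rightarrow> 'k::field_char_0) \<Rightarrow> (('p \<Rightarrow> int) \<Rightarrow> 'k)" where
  "lat_pushforward L L' \<phi> u =
     (\<lambda>m'. if m' \<in> dual L' then u (\<lambda>x. if x \<in> carrier L then m' (\<phi> x) else 0) else 0)"


section \<open>Superalgebras over the complex numbers\<close>

abbreviation complex_ring :: "complex ring" where
  "complex_ring \<equiv> ring_of_type_algebra"

record 'a superalgebra = "(complex, 'a) module" +
  even_part :: "'a set"
  odd_part :: "'a set"

locale superalgebra = ring A + module complex_ring A for A :: "'a superalgebra" (structure) +
  assumes smult_mult_left:
      "\<lbrakk>x \<in> carrier A; y \<in> carrier A\<rbrakk> \<Longrightarrow> (z \<odot> x) \<otimes> y = z \<odot> (x \<otimes> y)"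
    and smult_mult_right:
      "\<lbrakk>x \<in> carrier A; y \<in> carrier A\<rbrakk> \<Longrightarrow> x \<otimes> (z \<odot> y) = z \<odot> (x \<otimes> y)"
    and even_submodule: "submodule (even_part A) complex_ring A"
    and odd_submodule: "submodule (odd_part A) complex_ring A"
    and direct: "even_part A \<inter> odd_part A = {\<zero>}"
    and decomposition: "x \<in> carrier A \<Longrightarrow> \<exists>e\<in>even_part A. \<exists>o'\<in>odd_part A. x = e \<oplus> o'"
    and one_even: "\<one> \<in> even_part A"
    and even_even: "\<lbrakk>x \<in> even_part A; y \<in> even_part A\<rbrakk> \<Longrightarrow> x \<otimes> y \<in> even_part A"
    and even_odd: "\<lbrakk>x \<in> even_part A; y \<in> odd_part A\<rbrakk> \<Longrightarrow> x \<otimes> y \<in> odd_part A"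
    and odd_odd: "\<lbrakk>x \<in> odd_part A; y \<in> odd_part A\<rbrakk> \<Longrightarrow> x \<otimes> y \<in> even_part A"
    and even_central: "\<lbrakk>x \<in> even_part A; y \<in> carrier A\<rbrakk> \<Longrightarrow> x \<otimes> y = y \<otimes> x"
    and odd_anticommute: "\<lbrakk>x \<in> odd_part A; y \<in> odd_part A\<rbrakk> \<Longrightarrow> x \<otimes> y = \<ominus> (y \<otimes> x)"

definition salg_hom :: "'a superalgebra \<Rightarrow> 'b superalgebra \<Rightarrow> ('a \<Rightarrow> 'b) set" where
  "salg_hom R A = {h. h \<in> ring_hom R A \<and> h \<in> extensional (carrier R) \<and>
     (\<forall>z. \<forall>x\<in>carrier R. h (z \<odot>\<^bsub>R\<^esub> x) = z \<odot>\<^bsub>A\<^esub> h x) \<and>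
     h ` even_part R \<subseteq> even_part A \<and> h ` odd_part R \<subseteq> odd_part A}"

definition complex_salg :: "complex superalgebra" where
  "complex_salg = \<lparr>carrier = UNIV, monoid.mult = (*), one = 1, ring.zero = 0, add = (+), module.smult = (*),
     even_part = UNIV, odd_part = {0}\<rparr>"

definition sub_superalgebra :: "'a superalgebra \<Rightarrow> 'a set \<Rightarrow> 'a superalgebra" where
  "sub_superalgebra R C =
     R\<lparr>carrier := C, even_part := even_part R \<inter> C, odd_part := odd_part R \<inter> C\<rparr>"


section \<open>Group functors of points\<close>

text \<open>Functors on superalgebras whose values consist of superalgebra homomorphisms out of a
  fixed algebra with carrier \<^term>\<open>coord_set F\<close>; a morphism \<open>\<phi>: A \<rightarrow> B\<close> acts by postcomposition,
  \<open>g \<mapsto> compose (coord_set F) \<phi> g\<close>. The superalgebras range over all those with carrier in an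
  arbitrary type \<open>'u\<close>, which serves as the universe.\<close>

record ('x, 'u) group_functor =
  coord_set :: "'x set"
  points :: "'u superalgebra \<Rightarrow> ('x \<Rightarrow> 'u) monoid"

definition group_functor_iso ::
  "('x, 'u) group_functor \<Rightarrow> ('y, 'u) group_functor \<Rightarrow> bool" where
  "group_functor_iso F G \<longleftrightarrow> (\<exists>\<eta>.
     (\<forall>A. superalgebra A \<longrightarrow> \<eta> A \<in> iso (points F A) (points G A)) \<and>
     (\<forall>A B \<phi> g. superalgebra A \<and> superalgebra B \<and> \<phi> \<in> salg_hom A B \<and>
        g \<in> carrier (points F A) \<longrightarrow>
        \<eta> B (compose (coord_set F) \<phi> g) = compose (coord_set G) \<phi> (\<eta> A g)))"


section \<open>Tori and supertori\<close>

text \<open>The pair \<open>(f, g)\<close> stands for \<open>f + g \<xi>\<close>.\<close>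

type_synonym 'm spoly = "('m \<Rightarrow>\<^sub>0 complex) \<times> ('m \<Rightarrow>\<^sub>0 complex)"

definition monomial :: "'m::comm_monoid_add \<Rightarrow> 'm spoly" where
  "monomial m = (Poly_Mapping.single m 1, 0)"

definition monomial_xi :: "'m::comm_monoid_add \<Rightarrow> 'm spoly" where
  "monomial_xi m = (0, Poly_Mapping.single m 1)"

definition supertorus_ring :: "('n, 'b) monoid_scheme \<Rightarrow> ('n \<Rightarrow> int) spoly superalgebra" where
  "supertorus_ring L = \<lparr>
     carrier = {(f, g). Poly_Mapping.keys f \<subseteq> dual L \<and> Poly_Mapping.keys g \<subseteq> dual L},
     monoid.mult = (\<lambda>(f, g) (f', g'). (f * f', f * g' + g * f')),
     one = (1, 0),
     ring.zero = (0, 0),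
     add = (\<lambda>(f, g) (f', g'). (f + f', g + g')),
     module.smult = (\<lambda>z (f, g). (Poly_Mapping.single 0 z * f, Poly_Mapping.single 0 z * g)),
     even_part = {(f, g). Poly_Mapping.keys f \<subseteq> dual L \<and> g = 0},
     odd_part = {(f, g). f = 0 \<and> Poly_Mapping.keys g \<subseteq> dual L}\<rparr>"

definition torus_ring :: "('n, 'b) monoid_scheme \<Rightarrow> ('n \<Rightarrow> int) spoly superalgebra" where
  "torus_ring L = sub_superalgebra (supertorus_ring L) (even_part (supertorus_ring L))"

text \<open>The product \<open>g \<cdot> h\<close> of \<open>A\<close>-points is \<open>(multiplication of A) \<circ> (g \<otimes> h) \<circ> \<Delta>\<close>. Expanding,
  \<open>\<Delta>(x\<^sup>m) = x\<^sup>m \<otimes> x\<^sup>m + \<langle>m, c\<rangle> x\<^sup>m\<xi> \<otimes> x\<^sup>m\<xi>\<close> and, since \<open>(\<xi> \<otimes> \<xi>)(\<xi> \<otimes> 1) = (\<xi> \<otimes> \<xi>)(1 \<otimes> \<xi>) = 0\<close>,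
  \<open>\<Delta>(x\<^sup>m\<xi>) = \<Delta>(x\<^sup>m) \<Delta>(\<xi>) = x\<^sup>m\<xi> \<otimes> x\<^sup>m + x\<^sup>m \<otimes> x\<^sup>m\<xi>\<close>. The term \<open>x\<^sup>m\<xi> \<otimes> x\<^sup>m\<xi>\<close> is left out when its
  coefficient vanishes, so that the formula also makes sense when \<open>h\<close> is only defined on the
  subalgebra \<open>\<complex>[X]\<close> (with carrier \<open>R\<close>): this is the coaction \<open>\<complex>[X] \<rightarrow> \<complex>[T] \<otimes> \<complex>[X]\<close> to which \<open>\<Delta>\<close>
  restricts, that is, the extension to \<open>X\<close> of the action of the supertorus on itself by left
  multiplication.\<close>

definition act ::
  "'m::comm_monoid_add spoly set \<Rightarrow> ('m \<Rightarrow> complex) \<Rightarrow> 'u superalgebra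
     \<Rightarrow> ('m spoly \<Rightarrow> 'u) \<Rightarrow> ('m spoly \<Rightarrow> 'u) \<Rightarrow> ('m spoly \<Rightarrow> 'u)" where
  "act R c A g h = (\<lambda>f\<in>R.
     (\<Oplus>\<^bsub>A\<^esub>m\<in>Poly_Mapping.keys (fst f). Poly_Mapping.lookup (fst f) m \<odot>\<^bsub>A\<^esub>
        (g (monomial m) \<otimes>\<^bsub>A\<^esub> h (monomial m) \<oplus>\<^bsub>A\<^esub>
         (if c m = 0 then \<zero>\<^bsub>A\<^esub>
          else c m \<odot>\<^bsub>A\<^esub> (g (monomial_xi m) \<otimes>\<^bsub>A\<^esub> h (monomial_xi m)))))
     \<oplus>\<^bsub>A\<^esub>
     (\<Oplus>\<^bsub>A\<^esub>m\<in>Poly_Mapping.keys (snd f). Poly_Mapping.lookup (snd f) m \<odot>\<^bsub>A\<^esub>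
        (g (monomial_xi m) \<otimes>\<^bsub>A\<^esub> h (monomial m) \<oplus>\<^bsub>A\<^esub>
         g (monomial m) \<otimes>\<^bsub>A\<^esub> h (monomial_xi m))))"

text \<open>The counit sends \<open>x\<^sup>m\<close> to \<open>1\<close> and \<open>\<xi>\<close> to \<open>0\<close>.\<close>

definition unit_point ::
  "'m::comm_monoid_add spoly set \<Rightarrow> 'u superalgebra \<Rightarrow> ('m spoly \<Rightarrow> 'u)" where
  "unit_point R A =
     (\<lambda>f\<in>R. (\<Sum>m\<in>Poly_Mapping.keys (fst f). Poly_Mapping.lookup (fst f) m) \<odot>\<^bsub>A\<^esub> \<one>\<^bsub>A\<^esub>)"

definition supertorus ::
  "('n, 'b) monoid_scheme \<Rightarrow> (('n \<Rightarrow> int) \<Rightarrow> complex)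
     \<Rightarrow> (('n \<Rightarrow> int) spoly, 'u) group_functor" where
  "supertorus L c = \<lparr>coord_set = carrier (supertorus_ring L),
     points = (\<lambda>A. \<lparr>carrier = salg_hom (supertorus_ring L) A,
       monoid.mult = act (carrier (supertorus_ring L)) c A,
       one = unit_point (carrier (supertorus_ring L)) A\<rparr>)\<rparr>"

text \<open>The ordinary torus has \<open>\<Delta>(x\<^sup>m) = x\<^sup>m \<otimes> x\<^sup>m\<close>, which is the above formula on \<open>\<complex>[M]\<close> with
  \<open>c = 0\<close>.\<close>

definition torus :: "('n, 'b) monoid_scheme \<Rightarrow> (('n \<Rightarrow> int) spoly, 'u) group_functor" where
  "torus L = \<lparr>coord_set = carrier (torus_ring L),
     points = (\<lambda>A. \<lparr>carrier = salg_hom (torus_ring L) A,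
       monoid.mult = act (carrier (torus_ring L)) (\<lambda>_. 0) A,
       one = unit_point (carrier (torus_ring L)) A\<rparr>)\<rparr>"


section \<open>The supervariety given by generators, stabilizers and orbits\<close>

definition nat_combinations :: "nat \<Rightarrow> (nat \<Rightarrow> 'n \<Rightarrow> int) \<Rightarrow> ('n \<Rightarrow> int) set" where
  "nat_combinations r m = {\<lambda>x. \<Sum>i=1..r. int (k i) * m i x | k. True}"

definition int_combinations :: "nat \<Rightarrow> (nat \<Rightarrow> 'n \<Rightarrow> int) \<Rightarrow> ('n \<Rightarrow> int) set" where
  "int_combinations r m = {\<lambda>x. \<Sum>i=1..r. k i * m i x | k. True}"

text \<open>The coordinate ring \<open>\<complex>[x\<^bsup>m\<^sub>1\<^esup>, \<dots>, x\<^bsup>m\<^sub>r\<^esup>, x\<^bsup>n\<^sub>1\<^esup>\<xi>, \<dots>, x\<^bsup>n\<^sub>s\<^esup>\<xi>]\<close> of \<open>Y\<close>.\<close>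

definition coord_ring ::
  "('n, 'b) monoid_scheme \<Rightarrow> nat \<Rightarrow> nat \<Rightarrow> (nat \<Rightarrow> 'n \<Rightarrow> int) \<Rightarrow> (nat \<Rightarrow> 'n \<Rightarrow> int)
     \<Rightarrow> ('n \<Rightarrow> int) spoly superalgebra" where
  "coord_ring N r s m n = sub_superalgebra (supertorus_ring N)
     (generate_ring (supertorus_ring N)
        (range (\<lambda>z. z \<odot>\<^bsub>supertorus_ring N\<^esub> \<one>\<^bsub>supertorus_ring N\<^esub>)
         \<union> (\<lambda>i. monomial (m i)) ` {1..r} \<union> (\<lambda>j. monomial_xi (n j)) ` {1..s}))"

text \<open>A closed point is a homomorphism \<open>p: \<complex>[X] \<rightarrow> \<complex>\<close>; viewed as an \<open>A\<close>-point it is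
  \<open>\<complex>[X] \<rightarrow> \<complex> \<rightarrow> A\<close>.\<close>

definition base_change_point ::
  "'x superalgebra \<Rightarrow> ('x \<Rightarrow> complex) \<Rightarrow> 'u superalgebra \<Rightarrow> ('x \<Rightarrow> 'u)" where
  "base_change_point R p A = (\<lambda>f\<in>carrier R. p f \<odot>\<^bsub>A\<^esub> \<one>\<^bsub>A\<^esub>)"

definition stabilizer ::
  "('n, 'b) monoid_scheme \<Rightarrow> (('n \<Rightarrow> int) \<Rightarrow> complex) \<Rightarrow> ('n \<Rightarrow> int) spoly superalgebra
     \<Rightarrow> (('n \<Rightarrow> int) spoly \<Rightarrow> complex) \<Rightarrow> (('n \<Rightarrow> int) spoly, 'u) group_functor" where
  "stabilizer N c R p = \<lparr>coord_set = coord_set (supertorus N c :: (_, 'u) group_functor),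
     points = (\<lambda>A. (points (supertorus N c) A)
       \<lparr>carrier := {g \<in> carrier (points (supertorus N c) A).
          act (carrier R) c A g (base_change_point R p A) = base_change_point R p A}\<rparr>)\<rparr>"

definition orbit ::
  "('n, 'b) monoid_scheme \<Rightarrow> (('n \<Rightarrow> int) \<Rightarrow> complex) \<Rightarrow> ('n \<Rightarrow> int) spoly superalgebra
     \<Rightarrow> (('n \<Rightarrow> int) spoly \<Rightarrow> complex) \<Rightarrow> 'u superalgebra \<Rightarrow> (('n \<Rightarrow> int) spoly \<Rightarrow> 'u) set" where
  "orbit N c R p A = (\<lambda>g. act (carrier R) c A g (base_change_point R p A))
     ` carrier (points (supertorus N c) A)"

text \<open>An isomorphism from the orbit functor \<open>A \<mapsto> T(A) \<cdot> p\<^sub>A \<cong> T(A) / Stab(A)\<close> to a group functor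
  \<open>G\<close>: natural bijections that are compatible with the group structure of \<open>T(A) / Stab(A)\<close>, that
  is, \<open>\<eta> (g h \<cdot> p\<^sub>A) = \<eta> (g \<cdot> p\<^sub>A) \<eta> (h \<cdot> p\<^sub>A)\<close>. As a functor to sets alone, a supertorus would not
  remember its parameter \<open>c\<close>.\<close>

definition orbit_iso ::
  "('n, 'b) monoid_scheme \<Rightarrow> (('n \<Rightarrow> int) \<Rightarrow> complex) \<Rightarrow> ('n \<Rightarrow> int) spoly superalgebra
     \<Rightarrow> (('n \<Rightarrow> int) spoly \<Rightarrow> complex) \<Rightarrow> ('y, 'u) group_functor \<Rightarrow> bool" where
  "orbit_iso N c R p G \<longleftrightarrow> (\<exists>\<eta>.
     (\<forall>A. superalgebra A \<longrightarrow> bij_betw (\<eta> A) (orbit N c R p A) (carrier (points G A))) \<and>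
     (\<forall>A B \<phi> y. superalgebra A \<and> superalgebra B \<and> \<phi> \<in> salg_hom A B \<and>
        y \<in> orbit N c R p A \<longrightarrow>
        \<eta> B (compose (carrier R) \<phi> y) = compose (coord_set G) \<phi> (\<eta> A y)) \<and>
     (\<forall>A g h. superalgebra A \<and> g \<in> carrier (points (supertorus N c) A) \<and>
        h \<in> carrier (points (supertorus N c) A) \<longrightarrow>
        \<eta> A (act (carrier R) c A (g \<otimes>\<^bsub>points (supertorus N c) A\<^esub> h) (base_change_point R p A)) =
        \<eta> A (act (carrier R) c A g (base_change_point R p A)) \<otimes>\<^bsub>points G A\<^esub>
        \<eta> A (act (carrier R) c A h (base_change_point R p A))))"


section \<open>Normality, the fan, and torus orbits\<close>

text \<open>The domain \<open>\<complex>[S]\<close> is integrally closed in its fraction field: if \<open>f / g\<close> is a root of a monic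
  polynomial of degree \<open>d\<close> over \<open>\<complex>[S]\<close> (denominators cleared), then \<open>f / g \<in> \<complex>[S]\<close>.\<close>

definition semigroup_ring :: "'m set \<Rightarrow> ('m::comm_monoid_add \<Rightarrow>\<^sub>0 complex) set" where
  "semigroup_ring S = {f. Poly_Mapping.keys f \<subseteq> S}"

definition normal_semigroup_ring :: "'m::comm_monoid_add set \<Rightarrow> bool" where
  "normal_semigroup_ring S \<longleftrightarrow>
     (\<forall>f\<in>semigroup_ring S. \<forall>g\<in>semigroup_ring S. g \<noteq> 0 \<longrightarrow>
        (\<exists>d. \<exists>b. (\<forall>i<d. b i \<in> semigroup_ring S) \<and>
           f ^ d + (\<Sum>i<d. b i * f ^ i * g ^ (d - i)) = 0) \<longrightarrow>
        (\<exists>h\<in>semigroup_ring S. f = g * h))"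

text \<open>The cone of the affine toric variety \<open>Spec \<complex>[S]\<close>, that is, the dual of the cone spanned by
  \<open>S\<close>; its fan consists of the faces of this cone. A face is cut out by a supporting element
  \<open>\<Sum>m\<in>F. w m \<cdot> m\<close> of \<open>M \<otimes> \<real>\<close>.\<close>

definition affine_cone ::
  "('n, 'b) monoid_scheme \<Rightarrow> ('n \<Rightarrow> int) set \<Rightarrow> (('n \<Rightarrow> int) \<Rightarrow> real) set" where
  "affine_cone N S = {u \<in> lat_tensor N. \<forall>m\<in>S. 0 \<le> u m}"

definition cone_faces ::
  "('n, 'b) monoid_scheme \<Rightarrow> (('n \<Rightarrow> int) \<Rightarrow> real) set \<Rightarrow> (('n \<Rightarrow> int) \<Rightarrow> real) set set" where
  "cone_faces N \<sigma> = {{u \<in> \<sigma>. (\<Sum>m\<in>F. w m * u m) = 0} | F w.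
     finite F \<and> F \<subseteq> dual N \<and> (\<forall>u\<in>\<sigma>. 0 \<le> (\<Sum>m\<in>F. w m * u m))}"

text \<open>Points of \<open>Spec \<complex>[S]\<close> are semigroup homomorphisms \<open>S \<rightarrow> \<complex>\<close>. The orbit of \<open>\<sigma>\<close> is the torus orbit of
  the distinguished point of \<open>\<sigma>\<close>, which is \<open>1\<close> on the elements of \<open>S\<close> orthogonal to \<open>\<sigma>\<close> and
  \<open>0\<close> on the others.\<close>

definition Orb ::
  "('n, 'b) monoid_scheme \<Rightarrow> ('n \<Rightarrow> int) set \<Rightarrow> (('n \<Rightarrow> int) \<Rightarrow> real) set
     \<Rightarrow> (('n \<Rightarrow> int) \<Rightarrow> complex) set" where
  "Orb N S \<sigma> = {\<lambda>m\<in>S. t (monomial m) * (if \<forall>u\<in>\<sigma>. u m = 0 then 1 else 0) | t.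
     t \<in> carrier (points (torus N) complex_salg)}"

definition cone_sublattice :: "'n monoid \<Rightarrow> (('n \<Rightarrow> int) \<Rightarrow> real) set \<Rightarrow> 'n monoid" where
  "cone_sublattice N \<sigma> = subgroup_generated N {x \<in> carrier N. lat_incl N x \<in> \<sigma>}"

definition cone_quotient :: "'n monoid \<Rightarrow> (('n \<Rightarrow> int) \<Rightarrow> real) set \<Rightarrow> 'n set monoid" where
  "cone_quotient N \<sigma> = N Mod carrier (cone_sublattice N \<sigma>)"

end

theory Submission
  imports Defs "HOL-Analysis.Kronecker_Approximation_Theorem"
begin

text \<open>A point of the supertorus over \<open>A\<close> is a character \<open>t\<close> of the dual lattice \<open>M\<close> with values in the
  even units together with an odd element \<open>\<eta>\<close>, the image of \<open>\<xi>\<close>. It moves the closed point with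
  character \<open>\<chi>\<close> of \<open>S\<close> to the point \<open>x\<^sup>l \<mapsto> \<chi>(l) t(l)\<close>, \<open>x\<^sup>l\<xi> \<mapsto> \<chi>(l) t(l) \<eta>\<close>: the term with coefficient
  \<open>\<langle>l, c\<rangle>\<close> disappears because \<open>\<xi>\<close> vanishes at a closed point. As \<open>\<chi>\<close> is supported on \<open>S \<inter> \<sigma>\<^sup>\<bottom>\<close>, and by
  normality \<open>S \<inter> \<sigma>\<^sup>\<bottom>\<close> spans \<open>M \<inter> \<sigma>\<^sup>\<bottom>\<close> over the integers, the moved point determines exactly \<open>t\<close> on
  \<open>M \<inter> \<sigma>\<^sup>\<bottom>\<close>, and in addition \<open>\<eta>\<close> precisely when \<open>\<chi>\<close> does not vanish at some \<open>n\<^sub>j\<close>. Restricting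
  characters along \<open>N\<^sub>\<sigma> \<subseteq> N \<rightarrow> N(\<sigma>)\<close>, a split exact sequence, identifies stabilizer and orbit.
  If \<open>\<chi>\<close> vanishes at every \<open>n\<^sub>j\<close>, it does so at the \<open>m\<^sub>j\<close> with \<open>j \<le> q\<close>, hence \<open>c\<close> annihilates
  \<open>M \<inter> \<sigma>\<^sup>\<bottom>\<close> and lies in \<open>(N\<^sub>\<sigma>)\<^sub>\<complex>\<close>.\<close>

section \<open>Dual lattices\<close>

text \<open>The orbit functor is the plain image of the group of \<open>A\<close>-points, so every
  \<open>A\<close>-point of the quotient torus has to lift to an \<open>A\<close>-point of the
  supertorus. For this reason explicit splittings of the lattice sequence are constructed. Normality
  excludes a finite defect: for the exponents (a,b) with a > 0 and b \<ge> 0 together with the (0,b)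
  with b even, the exponents on the face a = 0 span a subgroup of index 2 in the orthogonal lattice,
  and a character with value -1 at (0,1) then fixes points of that face without belonging to the
  torus of its sublattice. A further obstacle is that \<sigma> is a set of real functionals while
  its sublattice is discrete. Both are described by the finite set \<open>J\<close> of generators
  orthogonal to \<sigma>, and a lattice point that is positive on all other generators passes from
  one to the other. The undeformed product appears in two ways: in the stabilizer because \<xi> maps
  to 0, in the orbit because \<open>c\<close> vanishes on the orthogonal exponents.\<close>

lemma dualI:
  assumes "\<And>x y. x \<in> carrier L \<Longrightarrow> y \<in> carrier L \<Longrightarrow> m (x \<otimes>\<^bsub>L\<^esub> y) = m x + m y"
    and "\<And>x. x \<notin> carrier L \<Longrightarrow> m x = 0"
  shows "m \<in> dual L"
  using assms by (auto simp: dual_def hom_def)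

lemma dual_mult: "m \<in> dual L \<Longrightarrow> x \<in> carrier L \<Longrightarrow> y \<in> carrier L \<Longrightarrow> m (x \<otimes>\<^bsub>L\<^esub> y) = m x + m y"
  by (auto simp: dual_def hom_def)

lemma dual_outside: "m \<in> dual L \<Longrightarrow> x \<notin> carrier L \<Longrightarrow> m x = 0"
  by (auto simp: dual_def)

lemma dual_eqI:
  assumes "m \<in> dual L" "l \<in> dual L" "\<And>x. x \<in> carrier L \<Longrightarrow> m x = l x"
  shows "m = l"
  using assms dual_outside by (metis ext)

lemma dual_zero: "0 \<in> dual L"
  by (rule dualI) auto

lemma dual_add: "m \<in> dual L \<Longrightarrow> l \<in> dual L \<Longrightarrow> m + l \<in> dual L"
  by (rule dualI) (auto simp: dual_mult dual_outside)

lemma dual_uminus: "m \<in> dual L \<Longrightarrow> - m \<in> dual L"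
  by (rule dualI) (auto simp: dual_mult dual_outside)

lemma dual_diff: "m \<in> dual L \<Longrightarrow> l \<in> dual L \<Longrightarrow> m - l \<in> dual L"
  by (rule dualI) (auto simp: dual_mult dual_outside)

lemma dual_scale: "m \<in> dual L \<Longrightarrow> (\<lambda>x. k * m x) \<in> dual L"
  by (rule dualI) (auto simp: dual_mult dual_outside algebra_simps)

lemma dual_combination:
  "(\<And>i. i \<in> I \<Longrightarrow> m i \<in> dual L) \<Longrightarrow> (\<lambda>x. \<Sum>i\<in>I. k i * m i x) \<in> dual L"
  by (rule dualI)
    (auto simp: dual_mult algebra_simps dual_outside[where L = L] simp flip: sum.distrib intro!: sum.cong sum.neutral)

section \<open>Functionals on an abelian group: double annihilators, retractions,
  approximation\<close>

context
  fixes N :: "('n, 'b) monoid_scheme" (structure)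
  assumes N: "comm_group N"
begin

interpretation comm_group N by (rule N)

lemma dual_group_hom: "m \<in> dual N \<Longrightarrow> group_hom N integer_group m"
  by (auto simp: dual_def intro!: group_hom.intro group_hom_axioms.intro is_group)

lemma dual_one: "m \<in> dual N \<Longrightarrow> m \<one> = 0"
  using group_hom.hom_one[OF dual_group_hom] by simp

lemma dual_inv: "m \<in> dual N \<Longrightarrow> x \<in> carrier N \<Longrightarrow> m (inv x) = - m x"
  using group_hom.hom_inv[OF dual_group_hom] by simp

lemma dual_int_pow: "m \<in> dual N \<Longrightarrow> x \<in> carrier N \<Longrightarrow> m (x [^] (k::int)) = k * m x"
  using group_hom.hom_int_pow[OF dual_group_hom, of m x k] by simp

lemma dual_finprod:
  "finite F \<Longrightarrow> m \<in> dual N \<Longrightarrow> g \<in> F \<rightarrow> carrier N \<Longrightarrow> m (finprod N g F) = (\<Sum>x\<in>F. m (g x))"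
  by (induction F rule: finite_induct) (auto simp: dual_one dual_mult Pi_iff intro!: finprod_closed)

text \<open>Gaussian elimination with denominators cleared. The induction proves a dichotomy: either
  a nonzero multiple of \<open>v\<close> is a combination of \<open>J\<close>, or some point killed
  by \<open>J\<close> is not killed by \<open>v\<close>. The last assumption excludes the second
  case.\<close>

lemma double_annihilator:
  assumes "finite J" "J \<subseteq> dual N" "v \<in> dual N"
    and "\<And>x. x \<in> carrier N \<Longrightarrow> \<forall>l\<in>J. l x = 0 \<Longrightarrow> v x = 0"
  obtains k :: int and e where "k \<noteq> 0" "\<And>x. k * v x = (\<Sum>l\<in>J. e l * l x)"
proof -
  have "(\<exists>k::int. k \<noteq> 0 \<and> (\<exists>e. \<forall>x. k * v x = (\<Sum>l\<in>J. e l * l x))) \<or>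
        (\<exists>x\<in>carrier N. (\<forall>l\<in>J. l x = 0) \<and> v x \<noteq> 0)"
    using assms(1-3)
  proof (induction J arbitrary: v rule: finite_induct)
    case empty
    show ?case
    proof (cases "v = 0")
      case True
      then show ?thesis by (auto intro!: exI[of _ 1])
    next
      case False
      then obtain x where "v x \<noteq> 0" by (auto simp: fun_eq_iff)
      then show ?thesis using dual_outside[OF empty(2)] by auto
    qed
  next
    case (insert w J)
    have w: "w \<in> dual N" and J: "J \<subseteq> dual N" using insert by auto
    consider k e where "k \<noteq> (0::int)" "\<And>x. k * w x = (\<Sum>l\<in>J. e l * l x)"
      | x0 where "x0 \<in> carrier N" "\<forall>l\<in>J. l x0 = 0" "w x0 \<noteq> 0"
      using insert.IH[OF J w] by blast
    then show ?case
    proof cases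
      case 1
      consider k' e' where "k' \<noteq> (0::int)" "\<And>x. k' * v x = (\<Sum>l\<in>J. e' l * l x)"
        | y where "y \<in> carrier N" "\<forall>l\<in>J. l y = 0" "v y \<noteq> 0"
        using insert.IH[OF J insert.prems(2)] by blast
      then show ?thesis
      proof cases
        case 1
        have "k' * v x = (\<Sum>l\<in>insert w J. (e'(w := 0)) l * l x)" for x
        proof -
          have "(\<Sum>l\<in>J. (e'(w := 0)) l * l x) = (\<Sum>l\<in>J. e' l * l x)"
            using insert.hyps by (intro sum.cong) auto
          then show ?thesis using insert.hyps 1(2)[of x] by simp
        qed
        with 1(1) show ?thesis by blast
      next
        case 2
        then have "w y = 0" using 1 by (metis (no_types, lifting) mult_eq_0_iff sum.neutral)
        with 2 show ?thesis by auto
      qed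
    next
      case 2
      \<comment> \<open>The point \<open>x0\<close> shows that \<open>w\<close> is independent of
        \<open>J\<close>. It is eliminated by passing to the combination of \<open>v\<close> and
        \<open>w\<close> that vanishes at \<open>x0\<close>.\<close>
      define v' where "v' = (\<lambda>x. w x0 * v x - v x0 * w x)"
      have "v' \<in> dual N"
        using dual_diff[OF dual_scale[OF insert.prems(2), of "w x0"] dual_scale[OF w, of "v x0"]]
        by (simp add: v'_def fun_diff_def)
      then consider k e where "k \<noteq> (0::int)" "\<And>x. k * v' x = (\<Sum>l\<in>J. e l * l x)"
        | y where "y \<in> carrier N" "\<forall>l\<in>J. l y = 0" "v' y \<noteq> 0"
        using insert.IH[OF J] by blast
      then show ?thesis
      proof cases
        case 1
        have "(k * w x0) * v x = (\<Sum>l\<in>insert w J. (e(w := k * v x0)) l * l x)" for x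
        proof -
          have "(\<Sum>l\<in>J. (e(w := k * v x0)) l * l x) = (\<Sum>l\<in>J. e l * l x)"
            using insert.hyps by (intro sum.cong) auto
          then show ?thesis using insert.hyps 1(2)[of x] by (simp add: v'_def algebra_simps)
        qed
        moreover have "k * w x0 \<noteq> 0" using 1 2 by simp
        ultimately show ?thesis by blast
      next
        case y: 2
        \<comment> \<open>A multiple of \<open>y\<close> corrected along \<open>x0\<close> so that
          \<open>w\<close> vanishes; then \<open>v z\<close> equals \<open>v' y\<close>.\<close>
        define z where "z = y [^] w x0 \<otimes> x0 [^] (- w y)"
        have z: "z \<in> carrier N" using y 2 by (simp add: z_def)
        have ev: "l z = w x0 * l y - w y * l x0" if "l \<in> dual N" for l
          using that y 2 by (simp add: z_def dual_mult dual_int_pow)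
        have "l z = 0" if "l \<in> J" for l
          using ev[OF subsetD[OF J that]] bspec[OF y(2) that] bspec[OF 2(2) that] by simp
        then have "\<forall>l\<in>insert w J. l z = 0" using ev[OF w] by simp
        moreover have "v z \<noteq> 0" using ev[OF insert.prems(2)] y by (simp add: v'_def algebra_simps)
        ultimately show ?thesis using z by blast
      qed
    qed
  qed
  with assms(4) that show thesis by blast
qed

text \<open>A homomorphism to \<open>\<int>\<close> splits off its kernel, so by induction every subgroup cut out by
  finitely many functionals is a direct summand.\<close>

lemma annihilator_retraction:
  assumes "finite J" "J \<subseteq> dual N"
  obtains r where "r \<in> hom N N" "\<And>x l. x \<in> carrier N \<Longrightarrow> l \<in> J \<Longrightarrow> l (r x) = 0"
    "\<And>x. x \<in> carrier N \<Longrightarrow> \<forall>l\<in>J. l x = 0 \<Longrightarrow> r x = x"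
proof -
  have "\<exists>r. r \<in> hom N N \<and> (\<forall>x\<in>carrier N. \<forall>l\<in>J. l (r x) = 0) \<and>
     (\<forall>x\<in>carrier N. (\<forall>l\<in>J. l x = 0) \<longrightarrow> r x = x)"
    using assms
  proof (induction J rule: finite_induct)
    case empty
    show ?case by (rule exI[of _ "\<lambda>x. x"]) (auto simp: hom_def)
  next
    case (insert w J)
    then obtain r where r: "r \<in> hom N N" "\<And>x l. x \<in> carrier N \<Longrightarrow> l \<in> J \<Longrightarrow> l (r x) = 0"
      "\<And>x. x \<in> carrier N \<Longrightarrow> \<forall>l\<in>J. l x = 0 \<Longrightarrow> r x = x"
      by auto
    have w: "w \<in> dual N" using insert by auto
    have J: "J \<subseteq> dual N" using insert by auto
    have rc: "r x \<in> carrier N" if "x \<in> carrier N" for x using r(1) that by (auto simp: hom_def)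
    have rm: "r (x \<otimes> y) = r x \<otimes> r y" if "x \<in> carrier N" "y \<in> carrier N" for x y
      using r(1) that by (auto simp: hom_def)
    show ?case
    proof (cases "\<forall>x\<in>carrier N. w (r x) = 0")
      case True
      with r show ?thesis by (intro exI[of _ r]) auto
    next
      case False
      then obtain x1 where x1: "x1 \<in> carrier N" "w (r x1) \<noteq> 0" by auto
      define y1 where "y1 = (if w (r x1) > 0 then x1 else inv x1)"
      have "r (inv x1) = inv (r x1)"
        using r(1) x1 by (metis group_hom.hom_inv group_hom.intro group_hom_axioms.intro is_group)
      then have y1: "y1 \<in> carrier N" "w (r y1) > 0"
        using x1 rc[OF x1(1)] w by (auto simp: y1_def dual_inv)
      \<comment> \<open>The values of \<open>w \<circ> r\<close> form a nonzero subgroup of \<int>,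
        generated by the least positive one, \<open>g\<close>: a remainder modulo \<open>g\<close>
        is again a value. A point \<open>x0\<close> in the image of \<open>r\<close> with value
        \<open>g\<close> splits \<open>w / g\<close> there, and removing the matching multiple of
        \<open>x0\<close> from \<open>r\<close> gives the new retraction.\<close>
      define P where "P n \<longleftrightarrow> n > 0 \<and> (\<exists>x\<in>carrier N. w (r x) = int n)" for n
      have "P (nat (w (r y1)))" using y1 unfolding P_def by (auto intro!: bexI[of _ y1])
      then have P0: "P (Least P)" by (rule LeastI)
      have least: "\<And>n. P n \<Longrightarrow> Least P \<le> n" by (rule Least_le)
      define g where "g = int (Least P)"
      from P0 obtain x2 where x2: "x2 \<in> carrier N" "w (r x2) = g" and g: "g > 0"
        by (auto simp: P_def g_def)
      define x0 where "x0 = r x2"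
      have x0: "x0 \<in> carrier N" "w x0 = g" "\<And>l. l \<in> J \<Longrightarrow> l x0 = 0" "r x0 = x0"
        using x2 rc r(2,3) by (auto simp: x0_def)
      have dvd: "g dvd w (r x)" if x: "x \<in> carrier N" for x
      proof -
        define y where "y = x \<otimes> x0 [^] (- (w (r x) div g))"
        have y: "y \<in> carrier N" using x x0 by (simp add: y_def)
        have "r (x0 [^] k) = x0 [^] k" for k :: int
          using x0 r(3) J dual_int_pow by (metis (no_types, lifting) int_pow_closed mult_zero_right subsetD)
        then have "w (r y) = w (r x) - (w (r x) div g) * g"
          using x x0 w rc by (simp add: y_def rm dual_mult dual_int_pow)
        then have e: "w (r y) = w (r x) mod g"
          by (simp add: minus_div_mult_eq_mod)
        have "w (r y) = 0"
        proof (rule ccontr)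
          assume "w (r y) \<noteq> 0"
          then have "w (r y) > 0" using e pos_mod_sign[OF g, of "w (r x)"] by simp
          then have "P (nat (w (r y)))" using y unfolding P_def by (auto intro!: bexI[of _ y])
          from least[OF this] have "g \<le> w (r y)" using \<open>w (r y) > 0\<close> by (simp add: g_def)
          then show False using e pos_mod_bound[OF g, of "w (r x)"] by simp
        qed
        then show ?thesis using e by (simp add: mod_eq_0_iff_dvd)
      qed
      define r' where "r' x = r x \<otimes> x0 [^] (- (w (r x) div g))" for x
      have r'c: "r' x \<in> carrier N" if "x \<in> carrier N" for x using that rc x0 by (simp add: r'_def)
      have "r' (x \<otimes> y) = r' x \<otimes> r' y" if xy: "x \<in> carrier N" "y \<in> carrier N" for x y
      proof -
        have "w (r (x \<otimes> y)) div g = w (r x) div g + w (r y) div g"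
          using dvd[OF xy(1)] xy rc w by (simp add: rm dual_mult div_plus_div_distrib_dvd_left)
        moreover have "x0 [^] (- (a + b)) = x0 [^] (- a) \<otimes> x0 [^] (- b)" for a b :: int
          using int_pow_mult[OF x0(1), of "- a" "- b"] by simp
        ultimately show ?thesis
          using xy rc x0(1) by (simp only: r'_def rm) (simp add: m_ac)
      qed
      then have "r' \<in> hom N N" using r'c by (auto simp: hom_def)
      moreover have "l (r' x) = 0" if "x \<in> carrier N" "l \<in> insert w J" for x l
      proof -
        have l: "l \<in> dual N" using that w J by auto
        have "l (r' x) = l (r x) - (w (r x) div g) * l x0"
          using that rc x0 l by (simp add: r'_def dual_mult dual_int_pow)
        moreover have "l = w \<or> l (r x) = 0 \<and> l x0 = 0" using that r(2)[of x l] x0(3)[of l] by auto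
        ultimately show ?thesis using x0(2) dvd[OF that(1)] by auto
      qed
      moreover have "r' x = x" if "x \<in> carrier N" "\<forall>l\<in>insert w J. l x = 0" for x
      proof -
        have "r x = x" using r(3) that by auto
        then show ?thesis using that x0 by (simp add: r'_def)
      qed
      ultimately show ?thesis by blast
    qed
  qed
  with that show thesis by blast
qed

text \<open>The coefficients of a real point are replaced by simultaneous Dirichlet approximations of a common
  multiple: a functional that vanishes at the real point then takes an integer value of absolute
  value less than \<open>1\<close>, so it still vanishes.\<close>

lemma lattice_point_approximation:
  fixes z :: "'n \<Rightarrow> real"
  assumes F: "finite F" "F \<subseteq> carrier N" and T: "finite T" "T \<subseteq> dual N"
  obtains x where "x \<in> carrier N"
    "\<And>m. m \<in> T \<Longrightarrow> (\<Sum>n\<in>F. z n * of_int (m n)) = 0 \<Longrightarrow> m x = 0"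
    "\<And>m. m \<in> T \<Longrightarrow> (\<Sum>n\<in>F. z n * of_int (m n)) > 0 \<Longrightarrow> m x > 0"
proof -
  define u where "u m = (\<Sum>n\<in>F. z n * of_int (m n))" for m :: "'n \<Rightarrow> int"
  \<comment> \<open>If all coefficients are approximated up to \<open>1 / k\<close>, the value at
    \<open>m\<close> is off by at most \<open>C m / k\<close>. The bound \<open>\<delta> m\<close>
    is at most 1, which forces an integer near 0 to vanish, and at most \<open>u m\<close> when that
    is positive, which keeps the value positive because \<open>q \<ge> 1\<close>.\<close>
  define C where "C m = (\<Sum>n\<in>F. \<bar>real_of_int (m n)\<bar>)" for m :: "'n \<Rightarrow> int"
  define \<delta> where "\<delta> m = (if u m > 0 then min 1 (u m) else 1)" for m
  have "\<forall>\<^sub>F k in sequentially. C m / real k < \<delta> m" for m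
    using order_tendstoD(2)[OF lim_const_over_n[of "C m"], of "\<delta> m"] by (auto simp: \<delta>_def)
  then have "\<forall>\<^sub>F k in sequentially. \<forall>m\<in>T. C m / real k < \<delta> m"
    using T by (simp add: eventually_ball_finite_distrib)
  then have "\<forall>\<^sub>F k in sequentially. k > 0 \<and> (\<forall>m\<in>T. C m / real k < \<delta> m)"
    by (intro eventually_conj eventually_gt_at_top)
  then obtain k :: nat where k: "k > 0" "\<And>m. m \<in> T \<Longrightarrow> C m / real k < \<delta> m"
    by (auto dest!: eventually_happens simp: eventually_sequentially)
  obtain h where h: "bij_betw h {0..<card F} F"
    using ex_bij_betw_nat_finite[OF F(1)] by blast
  obtain q p where q: "0 < q" and p: "\<And>i. i < card F \<Longrightarrow> \<bar>of_int q * z (h i) - of_int (p i)\<bar> < 1 / real k"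
    using Dirichlet_approx_simult[OF k(1), of "card F" "\<lambda>i. z (h i)"] by metis
  define p' where "p' n = p (inv_into {0..<card F} h n)" for n
  have p': "\<bar>of_int q * z n - of_int (p' n)\<bar> \<le> 1 / real k" if "n \<in> F" for n
  proof -
    have "inv_into {0..<card F} h n < card F" "h (inv_into {0..<card F} h n) = n"
      using h that by (auto simp: bij_betw_def inv_into_into f_inv_into_f) (metis atLeastLessThan_iff inv_into_into)
    then show ?thesis using p[of "inv_into {0..<card F} h n"] by (simp add: p'_def)
  qed
  define x where "x = finprod N (\<lambda>n. n [^] p' n) F"
  have x: "x \<in> carrier N" using F unfolding x_def by (intro finprod_closed) auto
  have close: "\<bar>of_int q * u m - of_int (m x)\<bar> < \<delta> m" if m: "m \<in> T" for m
  proof -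
    have mN: "m \<in> dual N" using m T by auto
    have "m x = (\<Sum>n\<in>F. m (n [^] p' n))"
      unfolding x_def using F mN by (intro dual_finprod) auto
    also have "\<dots> = (\<Sum>n\<in>F. p' n * m n)"
      using F mN by (intro sum.cong) (auto simp: dual_int_pow)
    finally have "of_int q * u m - of_int (m x) = (\<Sum>n\<in>F. (of_int q * z n - of_int (p' n)) * of_int (m n))"
      by (simp add: u_def sum_distrib_left sum_subtractf algebra_simps)
    also have "\<bar>\<dots>\<bar> \<le> (\<Sum>n\<in>F. \<bar>(of_int q * z n - of_int (p' n)) * of_int (m n)\<bar>)"
      by (rule sum_abs)
    also have "\<dots> \<le> (\<Sum>n\<in>F. 1 / real k * \<bar>of_int (m n)\<bar>)"
      using p' by (intro sum_mono) (auto simp: abs_mult intro!: mult_right_mono simp del: times_divide_eq_left)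
    also have "\<dots> = C m / real k" by (simp add: C_def sum_divide_distrib)
    finally show ?thesis using k(2)[OF m] by linarith
  qed
  have "m x = 0" if "m \<in> T" "u m = 0" for m
    using close[OF that(1)] that(2) by (auto simp: \<delta>_def)
  moreover have "m x > 0" if "m \<in> T" "u m > 0" for m
  proof -
    have "of_int q * u m \<ge> u m" using q that(2) by simp
    moreover have "\<delta> m \<le> u m" using that(2) by (simp add: \<delta>_def)
    ultimately have "real_of_int (m x) > 0"
      using close[OF that(1)] by linarith
    then show ?thesis by simp
  qed
  ultimately show thesis using that x by (auto simp: u_def)
qed

end

section \<open>Faces of the cone\<close>

lemma nat_combinationsI: "l = (\<lambda>x. \<Sum>i=1..r. int (k i) * m i x) \<Longrightarrow> l \<in> nat_combinations r m"
  by (auto simp: nat_combinations_def)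

lemma nat_combinations_gen: "i \<in> {1..r} \<Longrightarrow> m i \<in> nat_combinations r m"
  by (rule nat_combinationsI[where k = "\<lambda>i'. if i' = i then 1 else 0"])
    (auto simp: fun_eq_iff if_distrib[of int] if_distrib[of "\<lambda>t. t * _"] cong: if_cong)

lemma nat_combinations_zero: "0 \<in> nat_combinations r m"
  by (rule nat_combinationsI[where k = "\<lambda>_. 0"]) (auto simp: fun_eq_iff)

lemma nat_combinations_add:
  assumes "l \<in> nat_combinations r m" "l' \<in> nat_combinations r m"
  shows "l + l' \<in> nat_combinations r m"
proof -
  obtain k k' where "l = (\<lambda>x. \<Sum>i=1..r. int (k i) * m i x)" "l' = (\<lambda>x. \<Sum>i=1..r. int (k' i) * m i x)"
    using assms by (auto simp: nat_combinations_def)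
  then show ?thesis
    by (intro nat_combinationsI[where k = "\<lambda>i. k i + k' i"]) (auto simp: fun_eq_iff algebra_simps sum.distrib)
qed

lemma single_one_power:
  "Poly_Mapping.single m (1::complex) ^ k = Poly_Mapping.single (\<lambda>x. int k * m x) 1"
  by (induction k) (auto simp: mult_single algebra_simps plus_fun_def zero_fun_def simp flip: single_one)

text \<open>Normality is applied to \<open>x\<^bsup>l + s\<^esup> / x\<^sup>s\<close>, a root of the monic polynomial \<open>X\<^sup>k - x\<^bsup>k l\<^esup>\<close>.\<close>

lemma normal_semigroup_saturated:
  assumes normal: "normal_semigroup_ring S" and k: "k > 0"
    and l: "(\<lambda>x. int k * l x) \<in> S" and s: "s \<in> S" "l + s \<in> S"
  shows "l \<in> S"
proof -
  define f g where "f = Poly_Mapping.single (l + s) (1::complex)" and "g = Poly_Mapping.single s (1::complex)"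
  define b where "b i = (if i = 0 then - Poly_Mapping.single (\<lambda>x. int k * l x) (1::complex) else 0)" for i :: nat
  have "f \<in> semigroup_ring S" "g \<in> semigroup_ring S" "g \<noteq> 0"
    using s by (auto simp: f_def g_def semigroup_ring_def) (metis lookup_single_eq lookup_zero one_neq_zero)
  moreover have "b i \<in> semigroup_ring S" for i
    using l by (auto simp: b_def semigroup_ring_def)
  moreover have "f ^ k + (\<Sum>i<k. b i * f ^ i * g ^ (k - i)) = 0"
  proof -
    have "(\<Sum>i<k. b i * f ^ i * g ^ (k - i)) = (\<Sum>i\<in>{0}. b i * f ^ i * g ^ (k - i))"
      by (rule sum.mono_neutral_right) (use k in \<open>auto simp: b_def\<close>)
    also have "\<dots> = - (f ^ k)"
      by (simp add: b_def f_def g_def single_one_power mult_single plus_fun_def algebra_simps)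
    finally show ?thesis by simp
  qed
  ultimately obtain h where h: "h \<in> semigroup_ring S" "f = g * h"
    using normal unfolding normal_semigroup_ring_def by blast
  have "l + s \<in> Poly_Mapping.keys (g * h)" using h(2) by (simp flip: h(2) add: f_def)
  then obtain b where "b \<in> Poly_Mapping.keys h" "l + s = s + b"
    using subsetD[OF keys_mult] by (fastforce simp: g_def)
  then show ?thesis using h(1) by (auto simp: semigroup_ring_def add.commute)
qed

section \<open>Scalar extensions of a lattice as functions on its dual\<close>

lemma lat_incl_lat_tensor: "x \<in> carrier L \<Longrightarrow> lat_incl L x \<in> lat_tensor L"
  unfolding lat_tensor_def by (intro CollectI exI[of _ "{x}"] exI[of _ "\<lambda>_. 1"]) auto

lemma lat_tensor_rep:
  assumes "u \<in> lat_tensor L"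
  obtains F z where "finite F" "F \<subseteq> carrier L" "u = (\<lambda>m. \<Sum>n\<in>F. z n * lat_incl L n m)"
  using assms by (auto simp: lat_tensor_def)

lemma lat_tensor_lincomb:
  assumes "u \<in> lat_tensor L" "v \<in> lat_tensor L"
  shows "(\<lambda>m. a * u m + b * v m) \<in> lat_tensor L"
proof -
  obtain F z where F: "finite F" "F \<subseteq> carrier L" "u = (\<lambda>m. \<Sum>n\<in>F. z n * lat_incl L n m)"
    using assms(1) by (rule lat_tensor_rep)
  obtain G w where G: "finite G" "G \<subseteq> carrier L" "v = (\<lambda>m. \<Sum>n\<in>G. w n * lat_incl L n m)"
    using assms(2) by (rule lat_tensor_rep)
  define y where "y n = (if n \<in> F then a * z n else 0) + (if n \<in> G then b * w n else 0)" for n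
  have "a * u m + b * v m = (\<Sum>n\<in>F \<union> G. y n * lat_incl L n m)" for m
  proof -
    have "a * u m = (\<Sum>n\<in>F \<union> G. (if n \<in> F then a * z n else 0) * lat_incl L n m)"
      unfolding F(3) sum_distrib_left by (rule sum.mono_neutral_cong_left) (use F G in auto)
    moreover have "b * v m = (\<Sum>n\<in>F \<union> G. (if n \<in> G then b * w n else 0) * lat_incl L n m)"
      unfolding G(3) sum_distrib_left by (rule sum.mono_neutral_cong_left) (use F G in auto)
    ultimately show ?thesis by (simp add: y_def distrib_right sum.distrib)
  qed
  then show ?thesis unfolding lat_tensor_def using F(1,2) G(1,2)
    by (intro CollectI exI[of _ "F \<union> G"] exI[of _ y]) auto
qed

lemma lat_tensor_outside: "u \<in> lat_tensor L \<Longrightarrow> m \<notin> dual L \<Longrightarrow> u m = 0"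
  by (auto simp: lat_tensor_def lat_incl_def)

lemma lat_tensor_combination:
  assumes "u \<in> lat_tensor L" "\<And>i. i \<in> I \<Longrightarrow> m i \<in> dual L"
  shows "u (\<lambda>x. \<Sum>i\<in>I. k i * m i x) = (\<Sum>i\<in>I. of_int (k i) * u (m i))"
proof -
  obtain F z where F: "finite F" "F \<subseteq> carrier L" "u = (\<lambda>m. \<Sum>n\<in>F. z n * lat_incl L n m)"
    using assms(1) by (rule lat_tensor_rep)
  have "(\<lambda>x. \<Sum>i\<in>I. k i * m i x) \<in> dual L" using assms(2) by (rule dual_combination)
  then have "u (\<lambda>x. \<Sum>i\<in>I. k i * m i x) = (\<Sum>n\<in>F. \<Sum>i\<in>I. of_int (k i) * (z n * lat_incl L n (m i)))"
    using assms(2) by (simp add: F(3) lat_incl_def sum_distrib_left algebra_simps)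
  also have "\<dots> = (\<Sum>i\<in>I. of_int (k i) * u (m i))"
    by (subst sum.swap) (simp add: F(3) sum_distrib_left)
  finally show ?thesis .
qed

lemma lat_tensor_add:
  assumes "u \<in> lat_tensor L" "m \<in> dual L" "l \<in> dual L"
  shows "u (m + l) = u m + u l"
  using assms dual_add[of m L l]
  by (auto simp: lat_tensor_def lat_incl_def algebra_simps sum.distrib)

text \<open>For \<open>K\<close> the carrier of the sublattice of \<sigma> this is the group of
  exponents orthogonal to \<sigma>, the kernel of restricting functionals to that
  sublattice.\<close>

definition annihilator :: "('n, 'b) monoid_scheme \<Rightarrow> 'n set \<Rightarrow> ('n \<Rightarrow> int) set" where
  "annihilator N K = {m \<in> dual N. \<forall>x\<in>K. m x = 0}"

section \<open>A face of the cone and the generators orthogonal to it\<close>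

locale toric_face =
  fixes N :: "'n monoid" (structure) and r :: nat and m :: "nat \<Rightarrow> 'n \<Rightarrow> int" and \<sigma> :: "(('n \<Rightarrow> int) \<Rightarrow> real) set"
  assumes N: "comm_group N"
    and gens: "\<And>i. i \<in> {1..r} \<Longrightarrow> m i \<in> dual N"
    and int_gens: "int_combinations r m = dual N"
    and normal: "normal_semigroup_ring (nat_combinations r m)"
    and face: "\<sigma> \<in> cone_faces N (affine_cone N (nat_combinations r m))"
begin

sublocale comm_group N by (rule N)

abbreviation S where "S \<equiv> nat_combinations r m"
abbreviation K where "K \<equiv> carrier (cone_sublattice N \<sigma>)"

text \<open>The finite datum to which \<sigma> is reduced: the face, its sublattice and the
  orthogonal exponents are all described by this index set.\<close>

definition J where "J = {i \<in> {1..r}. \<forall>u\<in>\<sigma>. u (m i) = 0}"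

lemma face_cone: "\<sigma> \<subseteq> affine_cone N S"
  using face by (auto simp: cone_faces_def)

lemma face_tensor: "u \<in> \<sigma> \<Longrightarrow> u \<in> lat_tensor N"
  using face_cone by (auto simp: affine_cone_def)

lemma S_dual: "l \<in> S \<Longrightarrow> l \<in> dual N"
  using gens by (auto simp: nat_combinations_def intro!: dual_combination)

lemma affine_coneI:
  assumes "u \<in> lat_tensor N" "\<And>i. i \<in> {1..r} \<Longrightarrow> 0 \<le> u (m i)"
  shows "u \<in> affine_cone N S"
proof -
  have "u (\<lambda>x. \<Sum>i=1..r. int (k i) * m i x) = (\<Sum>i=1..r. real (k i) * u (m i))" for k
    using lat_tensor_combination[OF assms(1), of "{1..r}" m "\<lambda>i. int (k i)"] gens by simp
  moreover have "0 \<le> (\<Sum>i=1..r. real (k i) * u (m i))" for k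
    by (intro sum_nonneg mult_nonneg_nonneg assms(2)) auto
  ultimately show ?thesis using assms(1) by (auto simp: affine_cone_def nat_combinations_def)
qed

lemma affine_cone_gen: "u \<in> affine_cone N S \<Longrightarrow> i \<in> {1..r} \<Longrightarrow> 0 \<le> u (m i)"
  by (auto simp: affine_cone_def nat_combinations_gen)

text \<open>The weights defining a face enter only through a linear functional that is nonnegative
  on the cone. Linearity is stated for arbitrary functions, which spares membership conditions
  later.\<close>

lemma face_functional:
  obtains \<phi> where "\<sigma> = {u \<in> affine_cone N S. \<phi> u = 0}" "\<And>u. u \<in> affine_cone N S \<Longrightarrow> 0 \<le> \<phi> u"
    "\<And>a b u v. \<phi> (\<lambda>m. a * u m + b * v m) = a * \<phi> u + b * \<phi> v"
proof -
  obtain F w where "\<sigma> = {u \<in> affine_cone N S. (\<Sum>m\<in>F. w m * u m) = 0}"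
    "\<forall>u\<in>affine_cone N S. 0 \<le> (\<Sum>m\<in>F. w m * u m)"
    using face by (auto simp: cone_faces_def)
  then show thesis
    by (intro that[of "\<lambda>u. \<Sum>m\<in>F. w m * u m"]) (auto simp: algebra_simps sum.distrib sum_distrib_left)
qed

lemma face_add:
  assumes "u \<in> \<sigma>" "v \<in> \<sigma>" shows "(\<lambda>m. u m + v m) \<in> \<sigma>"
proof -
  obtain \<phi> where \<phi>: "\<sigma> = {u \<in> affine_cone N S. \<phi> u = 0}" "\<And>u. u \<in> affine_cone N S \<Longrightarrow> 0 \<le> \<phi> u"
    "\<And>a b u v. \<phi> (\<lambda>m. a * u m + b * v m) = a * \<phi> u + b * \<phi> v"
    by (rule face_functional) (rule that; assumption)
  have "(\<lambda>m. 1 * u m + 1 * v m) \<in> affine_cone N S"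
    using assms face_tensor by (intro affine_coneI lat_tensor_lincomb) (auto simp: \<phi>(1) affine_cone_gen)
  moreover have "\<phi> (\<lambda>m. 1 * u m + 1 * v m) = 0"
    using assms by (simp only: \<phi>(3)) (simp add: \<phi>(1))
  ultimately show ?thesis by (simp add: \<phi>(1))
qed

lemma zero_in_face: "(\<lambda>_. 0) \<in> \<sigma>"
proof -
  obtain \<phi> where \<phi>: "\<sigma> = {u \<in> affine_cone N S. \<phi> u = 0}" "\<And>u. u \<in> affine_cone N S \<Longrightarrow> 0 \<le> \<phi> u"
    "\<And>a b u v. \<phi> (\<lambda>m. a * u m + b * v m) = a * \<phi> u + b * \<phi> v"
    by (rule face_functional) (rule that; assumption)
  have "(\<lambda>_. 0) \<in> lat_tensor N"
    unfolding lat_tensor_def by (intro CollectI exI[of _ "{}"]) auto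
  then have "(\<lambda>_. 0) \<in> affine_cone N S" by (intro affine_coneI) auto
  moreover have "\<phi> (\<lambda>_. 0) = 0" using \<phi>(3)[of 0 "\<lambda>_. 0" 0 "\<lambda>_. 0"] by simp
  ultimately show ?thesis by (simp add: \<phi>(1))
qed

text \<open>For each generator outside \<open>J\<close> some point of the face is nonzero there,
  hence positive because the face lies in the cone. The sum of these finitely many points is
  positive at all of them.\<close>

lemma face_interior:
  obtains u where "u \<in> \<sigma>" "\<And>i. i \<in> {1..r} - J \<Longrightarrow> 0 < u (m i)"
proof -
  have "\<exists>u\<in>\<sigma>. \<forall>i\<in>I. 0 < u (m i)" if "finite I" "I \<subseteq> {1..r} - J" for I
    using that
  proof (induction I rule: finite_induct)
    case empty
    show ?case using zero_in_face by auto
  next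
    case (insert i I)
    then obtain u where u: "u \<in> \<sigma>" "\<forall>i\<in>I. 0 < u (m i)" by auto
    from insert have i: "i \<in> {1..r}" "i \<notin> J" by auto
    then obtain v where v: "v \<in> \<sigma>" "v (m i) \<noteq> 0" by (auto simp: J_def)
    have nn: "0 \<le> u (m i')" "0 \<le> v (m i')" if "i' \<in> {1..r}" for i'
      using that u v face_cone affine_cone_gen by auto
    have "0 < u (m i') + v (m i')" if "i' \<in> insert i I" for i'
      using that insert.prems u v nn[of i'] by (auto simp: less_le add_nonneg_eq_0_iff)
    then show ?case using face_add[OF u(1) v(1)] by (intro bexI) auto
  qed
  from this[of "{1..r} - J"] that show thesis by auto
qed

text \<open>If \<open>u\<close> lies in the relative interior of \<open>\<sigma>\<close> and \<open>v\<close> satisfies the equations on the right, then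
  \<open>t u - v\<close> lies in the cone for large \<open>t\<close>; this replaces an appeal to Farkas' lemma.\<close>

lemma face_eq: "\<sigma> = {u \<in> affine_cone N S. \<forall>i\<in>J. u (m i) = 0}"
proof
  show "\<sigma> \<subseteq> {u \<in> affine_cone N S. \<forall>i\<in>J. u (m i) = 0}"
    using face_cone by (auto simp: J_def)
next
  obtain \<phi> where \<phi>: "\<sigma> = {u \<in> affine_cone N S. \<phi> u = 0}" "\<And>u. u \<in> affine_cone N S \<Longrightarrow> 0 \<le> \<phi> u"
    "\<And>a b u v. \<phi> (\<lambda>m. a * u m + b * v m) = a * \<phi> u + b * \<phi> v"
    by (rule face_functional) (rule that; assumption)
  obtain u where u: "u \<in> \<sigma>" "\<And>i. i \<in> {1..r} - J \<Longrightarrow> 0 < u (m i)"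
    using face_interior by metis
  show "{u \<in> affine_cone N S. \<forall>i\<in>J. u (m i) = 0} \<subseteq> \<sigma>"
  proof
    fix v assume "v \<in> {u \<in> affine_cone N S. \<forall>i\<in>J. u (m i) = 0}"
    then have v: "v \<in> affine_cone N S" "\<And>i. i \<in> J \<Longrightarrow> v (m i) = 0" by auto
    define t where "t = (\<Sum>i\<in>{1..r} - J. v (m i) / u (m i))"
    have "(\<lambda>l. t * u l + (-1) * v l) \<in> affine_cone N S"
    proof (rule affine_coneI)
      show "(\<lambda>l. t * u l + (-1) * v l) \<in> lat_tensor N"
        using v(1) face_tensor[OF u(1)] by (intro lat_tensor_lincomb) (auto simp: affine_cone_def)
    next
      fix i assume i: "i \<in> {1..r}"
      show "0 \<le> t * u (m i) + (-1) * v (m i)"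
      proof (cases "i \<in> J")
        case True
        then have "u (m i) = 0" using u(1) by (auto simp: J_def)
        then show ?thesis using v(2)[OF True] by simp
      next
        case False
        have "v (m i) / u (m i) \<le> t"
          unfolding t_def
          by (rule member_le_sum) (use i False u(2) v(1) affine_cone_gen in \<open>auto intro!: divide_nonneg_pos\<close>)
        then show ?thesis using u(2)[of i] i False by (simp add: field_simps)
      qed
    qed
    then have "0 \<le> t * \<phi> u + (-1) * \<phi> v" using \<phi>(2) \<phi>(3) by metis
    moreover have "\<phi> u = 0" using u(1) \<phi>(1) by auto
    ultimately have "\<phi> v = 0" using \<phi>(2)[OF v(1)] by simp
    then show "v \<in> \<sigma>" using v(1) \<phi>(1) by simp
  qed
qed

lemma face_iff: "v \<in> \<sigma> \<longleftrightarrow> v \<in> affine_cone N S \<and> (\<forall>i\<in>J. v (m i) = 0)"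
  using face_eq by blast

lemma lat_incl_face_iff:
  assumes "x \<in> carrier N"
  shows "lat_incl N x \<in> \<sigma> \<longleftrightarrow> (\<forall>i\<in>{1..r}. 0 \<le> m i x) \<and> (\<forall>i\<in>J. m i x = 0)"
proof -
  have e: "lat_incl N x (m i) = real_of_int (m i x)" if "i \<in> {1..r}" for i
    using gens[OF that] by (simp add: lat_incl_def)
  have J: "J \<subseteq> {1..r}" by (auto simp: J_def)
  have "lat_incl N x \<in> affine_cone N S \<longleftrightarrow> (\<forall>i\<in>{1..r}. (0::real) \<le> lat_incl N x (m i))"
    using affine_coneI[OF lat_incl_lat_tensor[OF assms]] affine_cone_gen by blast
  also have "\<dots> \<longleftrightarrow> (\<forall>i\<in>{1..r}. 0 \<le> m i x)"
    by (rule ball_cong) (use e in auto)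
  finally have "lat_incl N x \<in> affine_cone N S \<longleftrightarrow> (\<forall>i\<in>{1..r}. 0 \<le> m i x)" .
  moreover have "(\<forall>i\<in>J. lat_incl N x (m i) = (0::real)) \<longleftrightarrow> (\<forall>i\<in>J. m i x = 0)"
    by (rule ball_cong) (use e J in auto)
  ultimately show ?thesis by (simp only: face_iff)
qed

text \<open>Approximation replaces the real interior point by a lattice point with the same pattern
  of zero and positive values on the generators. It is the link between the real cone and its
  sublattice.\<close>

lemma face_interior_lattice_point:
  obtains x where "x \<in> carrier N" "\<And>i. i \<in> J \<Longrightarrow> m i x = 0" "\<And>i. i \<in> {1..r} - J \<Longrightarrow> 0 < m i x"
proof -
  obtain u where u: "u \<in> \<sigma>" "\<And>i. i \<in> {1..r} - J \<Longrightarrow> 0 < u (m i)"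
    using face_interior by metis
  obtain F z where F: "finite F" "F \<subseteq> carrier N" "u = (\<lambda>m. \<Sum>n\<in>F. z n * lat_incl N n m)"
    using face_tensor[OF u(1)] by (rule lat_tensor_rep)
  obtain x where x: "x \<in> carrier N"
    "\<And>l. l \<in> m ` {1..r} \<Longrightarrow> (\<Sum>n\<in>F. z n * of_int (l n)) = 0 \<Longrightarrow> l x = 0"
    "\<And>l. l \<in> m ` {1..r} \<Longrightarrow> (\<Sum>n\<in>F. z n * of_int (l n)) > 0 \<Longrightarrow> l x > 0"
    using lattice_point_approximation[OF N F(1,2), of "m ` {1..r}" z] gens by blast
  have um: "u (m i) = (\<Sum>n\<in>F. z n * of_int (m i n))" if "i \<in> {1..r}" for i
    using gens[OF that] by (simp add: F(3) lat_incl_def)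
  show thesis
  proof (rule that[OF x(1)])
    show "m i x = 0" if "i \<in> J" for i
      using that x(2)[of "m i"] um[of i] u(1) by (auto simp: J_def)
    show "0 < m i x" if "i \<in> {1..r} - J" for i
      using that x(3)[of "m i"] um[of i] u(2)[of i] by auto
  qed
qed

text \<open>A lattice point killed by \<open>J\<close> is a difference of two lattice points of
  \<sigma>: adding a large multiple of an interior lattice point makes it nonnegative on the
  remaining generators. The lattice points of \<sigma> therefore generate the full common kernel of
  \<open>J\<close>, which is saturated.\<close>

lemma cone_sublattice_carrier: "K = {x \<in> carrier N. \<forall>i\<in>J. m i x = 0}"
proof -
  let ?T = "{x \<in> carrier N. lat_incl N x \<in> \<sigma>}"
  let ?K = "{x \<in> carrier N. \<forall>i\<in>J. m i x = 0}"
  have JN: "m i \<in> dual N" if "i \<in> J" for i using that gens by (auto simp: J_def)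
  have "subgroup ?K N"
    by (rule subgroup.intro) (use JN in \<open>auto simp: dual_mult dual_one[OF N] dual_inv[OF N]\<close>)
  moreover have "?T \<subseteq> ?K" using lat_incl_face_iff by auto
  ultimately have "K \<subseteq> ?K"
    unfolding cone_sublattice_def by (rule subgroup_generated_minimal)
  moreover have "?K \<subseteq> K"
  proof
    fix x assume x: "x \<in> ?K"
    obtain y where y: "y \<in> carrier N" "\<And>i. i \<in> J \<Longrightarrow> m i y = 0" "\<And>i. i \<in> {1..r} - J \<Longrightarrow> 0 < m i y"
      using face_interior_lattice_point by metis
    have nn: "0 \<le> m i y" if "i \<in> {1..r}" for i
      using y(2)[of i] y(3)[of i] that by (cases "i \<in> J") auto
    \<comment> \<open>Dominates every \<open>\<bar>m i x\<bar>\<close>, whereas \<open>m i y\<close>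
      is at least 1 outside \<open>J\<close>.\<close>
    define k where "k = (\<Sum>i\<in>{1..r}. \<bar>m i x\<bar>)"
    have k: "\<bar>m i x\<bar> \<le> k" if "i \<in> {1..r}" for i
      unfolding k_def using that by (intro member_le_sum) auto
    have y': "y [^] k \<in> carrier N" using y by simp
    have k0: "0 \<le> k" by (auto simp: k_def intro!: sum_nonneg)
    have "y [^] k \<in> ?T"
      using y nn JN gens y' k0 by (auto simp: lat_incl_face_iff dual_int_pow[OF N])
    moreover have "x \<otimes> y [^] k \<in> ?T"
    proof -
      have "0 \<le> m i x + k * m i y" if i: "i \<in> {1..r}" for i
      proof (cases "i \<in> J")
        case True
        then show ?thesis using x y(2) by auto
      next
        case False
        then have "k * 1 \<le> k * m i y" using y(3)[of i] i k0 by (intro mult_left_mono) auto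
        then show ?thesis using k[OF i] by linarith
      qed
      then show ?thesis
        using x y(1,2) y' JN gens by (auto simp: lat_incl_face_iff dual_mult dual_int_pow[OF N])
    qed
    ultimately have "y [^] k \<in> K" "x \<otimes> y [^] k \<in> K"
      unfolding cone_sublattice_def using subgroup_generated_subset_carrier_subset[of ?T] by auto
    moreover have "subgroup K N"
      unfolding cone_sublattice_def by (rule subgroup_subgroup_generated)
    ultimately have "x \<otimes> y [^] k \<otimes> inv (y [^] k) \<in> K"
      by (meson subgroup.m_closed subgroup.m_inv_closed)
    then show "x \<in> K" using x y' by (simp add: m_assoc)
  qed
  ultimately show ?thesis by auto
qed

lemma J_eq: "J = {i \<in> {1..r}. m i \<in> annihilator N K}"
proof -
  obtain y where y: "y \<in> carrier N" "\<And>i. i \<in> J \<Longrightarrow> m i y = 0" "\<And>i. i \<in> {1..r} - J \<Longrightarrow> 0 < m i y"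
    using face_interior_lattice_point by metis
  have "y \<in> K" using y by (auto simp: cone_sublattice_carrier)
  then have "i \<in> J" if "i \<in> {1..r}" "m i \<in> annihilator N K" for i
    using that y(3)[of i] by (auto simp: annihilator_def)
  moreover have "i \<in> {1..r}" "m i \<in> annihilator N K" if "i \<in> J" for i
    using that gens by (auto simp: J_def annihilator_def cone_sublattice_carrier)
  ultimately show ?thesis by blast
qed

text \<open>The face property of the semigroup. At an interior lattice point the combination becomes
  a sum of nonnegative terms, so its vanishing excludes every generator outside
  \<open>J\<close>.\<close>

lemma nat_combination_annihilates_iff:
  "(\<lambda>x. \<Sum>i=1..r. int (k i) * m i x) \<in> annihilator N K \<longleftrightarrow> (\<forall>i\<in>{1..r}. k i \<noteq> 0 \<longrightarrow> i \<in> J)"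
proof
  assume L: "(\<lambda>x. \<Sum>i=1..r. int (k i) * m i x) \<in> annihilator N K"
  obtain y where y: "y \<in> carrier N" "\<And>i. i \<in> J \<Longrightarrow> m i y = 0" "\<And>i. i \<in> {1..r} - J \<Longrightarrow> 0 < m i y"
    using face_interior_lattice_point by metis
  have nn: "0 \<le> m i y" if "i \<in> {1..r}" for i
    using y(2)[of i] y(3)[of i] that by (cases "i \<in> J") auto
  have "y \<in> K" using y by (auto simp: cone_sublattice_carrier)
  with L have "(\<Sum>i=1..r. int (k i) * m i y) = 0" by (auto simp: annihilator_def)
  then have "\<forall>i\<in>{1..r}. int (k i) * m i y = 0"
    by (subst (asm) sum_nonneg_eq_0_iff) (auto intro!: mult_nonneg_nonneg nn)
  then show "\<forall>i\<in>{1..r}. k i \<noteq> 0 \<longrightarrow> i \<in> J" using y(3) by force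
next
  assume R: "\<forall>i\<in>{1..r}. k i \<noteq> 0 \<longrightarrow> i \<in> J"
  have "(\<lambda>x. \<Sum>i=1..r. int (k i) * m i x) \<in> dual N" by (rule dual_combination) (use gens in auto)
  moreover have "(\<Sum>i=1..r. int (k i) * m i x) = 0" if "x \<in> K" for x
    by (rule sum.neutral) (use R that in \<open>auto simp: cone_sublattice_carrier\<close>)
  ultimately show "(\<lambda>x. \<Sum>i=1..r. int (k i) * m i x) \<in> annihilator N K" by (auto simp: annihilator_def)
qed

text \<open>Torus orbits are defined through the real face, the groups to be identified through its
  sublattice. Both orthogonality conditions say that only generators in \<open>J\<close> occur in
  \<open>l\<close>.\<close>

lemma orthogonal_iff_annihilates:
  assumes "l \<in> S"
  shows "(\<forall>u\<in>\<sigma>. u l = 0) \<longleftrightarrow> l \<in> annihilator N K"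
proof -
  obtain k where l: "l = (\<lambda>x. \<Sum>i=1..r. int (k i) * m i x)" using assms by (auto simp: nat_combinations_def)
  obtain u where u: "u \<in> \<sigma>" "\<And>i. i \<in> {1..r} - J \<Longrightarrow> 0 < u (m i)"
    using face_interior by metis
  have ev: "v l = (\<Sum>i=1..r. real (k i) * v (m i))" if "v \<in> \<sigma>" for v
    unfolding l using lat_tensor_combination[OF face_tensor[OF that], of "{1..r}" m "\<lambda>i. int (k i)"] gens by simp
  have "(\<forall>u\<in>\<sigma>. u l = 0) \<longleftrightarrow> (\<forall>i\<in>{1..r}. k i \<noteq> 0 \<longrightarrow> i \<in> J)"
  proof
    assume "\<forall>u\<in>\<sigma>. u l = 0"
    then have "(\<Sum>i=1..r. real (k i) * u (m i)) = 0" using u(1) ev by auto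
    then have "\<forall>i\<in>{1..r}. real (k i) * u (m i) = 0"
      by (subst (asm) sum_nonneg_eq_0_iff) (use u(1) face_cone affine_cone_gen in \<open>auto intro!: mult_nonneg_nonneg\<close>)
    then show "\<forall>i\<in>{1..r}. k i \<noteq> 0 \<longrightarrow> i \<in> J" using u(2) by force
  next
    assume R: "\<forall>i\<in>{1..r}. k i \<noteq> 0 \<longrightarrow> i \<in> J"
    show "\<forall>u\<in>\<sigma>. u l = 0"
    proof
      fix v assume v: "v \<in> \<sigma>"
      show "v l = 0" unfolding ev[OF v] by (rule sum.neutral) (use R v in \<open>auto simp: J_def\<close>)
    qed
  qed
  then show ?thesis using nat_combination_annihilates_iff[of k] l by simp
qed

text \<open>A multiple of \<open>v\<close> is an integral combination of the \<open>m i\<close> with \<open>i \<in> J\<close>. Adding a large multiple of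
  their sum \<open>w\<close> makes the coefficients nonnegative, so saturation puts \<open>v + w\<close> into the semigroup.\<close>

lemma annihilator_combination:
  assumes v: "v \<in> annihilator N K"
  obtains k where "v = (\<lambda>x. \<Sum>i\<in>J. k i * m i x)"
proof -
  have JN: "m i \<in> dual N" if "i \<in> J" for i using that gens by (auto simp: J_def)
  have finJ: "finite J" by (auto simp: J_def)
  have vN: "v \<in> dual N" using v by (auto simp: annihilator_def)
  obtain k0 e0 where ke0: "k0 \<noteq> (0::int)" "\<And>x. k0 * v x = (\<Sum>l\<in>m ` J. e0 l * l x)"
    using double_annihilator[OF N, of "m ` J" v] finJ JN v
    by (auto simp: annihilator_def cone_sublattice_carrier)
  \<comment> \<open>\<open>double_annihilator\<close> indexes coefficients by functionals,
    \<open>J\<close> by indices. Each functional hands its coefficient to one chosen index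
    \<open>g l\<close>; other indices with the same functional receive 0.\<close>
  define g where "g l = inv_into J m l" for l
  have g: "l \<in> m ` J \<Longrightarrow> g l \<in> J \<and> m (g l) = l" for l
    by (auto simp: g_def intro: inv_into_into f_inv_into_f)
  define e1 where "e1 i = (if g (m i) = i then e0 (m i) else 0)" for i
  have ke1: "k0 * v x = (\<Sum>i\<in>J. e1 i * m i x)" for x
  proof -
    have "(\<Sum>i\<in>J. e1 i * m i x) = (\<Sum>i\<in>g ` m ` J. e1 i * m i x)"
    proof (rule sum.mono_neutral_right)
      show "g ` m ` J \<subseteq> J" using g by auto
      show "\<forall>i\<in>J - g ` m ` J. e1 i * m i x = 0" unfolding e1_def by (auto simp: image_iff) metis
    qed (rule finJ)
    also have "\<dots> = (\<Sum>l\<in>m ` J. e1 (g l) * m (g l) x)"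
      by (rule sum.reindex_cong[of g]) (auto intro!: inj_on_inverseI[of _ m] g[THEN conjunct2])
    also have "\<dots> = (\<Sum>l\<in>m ` J. e0 l * l x)"
      by (rule sum.cong) (use g in \<open>auto simp: e1_def\<close>)
    finally show ?thesis using ke0(2) by simp
  qed
  \<comment> \<open>Saturation asks for a positive multiplier, so the sign of \<open>k0\<close> is
    moved into the coefficients.\<close>
  define k e where "k = nat \<bar>k0\<bar>" and "e i = sgn k0 * e1 i" for i
  have k: "k > 0" "int k = sgn k0 * k0" using ke0(1) by (auto simp: k_def sgn_if abs_if)
  have ke: "int k * v x = (\<Sum>i\<in>J. e i * m i x)" for x
    using ke1 by (simp add: k(2) e_def mult.assoc sum_distrib_left[symmetric])
  \<comment> \<open>From \<open>\<bar>e i\<bar> \<le> t \<le> k * t\<close> the coefficients of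
    \<open>k * (v + w)\<close> are nonnegative.\<close>
  define t where "t = (\<Sum>i\<in>J. nat \<bar>e i\<bar>)"
  have t: "0 \<le> e i + int k * int t" if "i \<in> J" for i
  proof -
    have "nat \<bar>e i\<bar> \<le> t" unfolding t_def using that finJ by (intro member_le_sum) auto
    then have "\<bar>e i\<bar> \<le> int t" by linarith
    moreover have "int t \<le> int k * int t" using k(1) mult_right_mono[of 1 "int k" "int t"] by simp
    ultimately show ?thesis by linarith
  qed
  define w where "w = (\<lambda>x. \<Sum>i\<in>J. int t * m i x)"
  have JS: "(\<lambda>x. \<Sum>i\<in>J. int (c i) * m i x) \<in> S" for c
  proof (rule nat_combinationsI[where k = "\<lambda>i. if i \<in> J then c i else 0"])
    show "(\<lambda>x. \<Sum>i\<in>J. int (c i) * m i x) = (\<lambda>x. \<Sum>i=1..r. int (if i \<in> J then c i else 0) * m i x)"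
      by (intro ext sum.mono_neutral_cong_left) (auto simp: J_def)
  qed
  have wN: "w \<in> dual N" unfolding w_def using JN by (rule dual_combination)
  have vwN: "v + w \<in> dual N" using vN wN by (rule dual_add)
  then obtain d where d: "v + w = (\<lambda>x. \<Sum>i=1..r. d i * m i x)"
    unfolding int_gens[symmetric] int_combinations_def by auto
  \<comment> \<open>Since \<open>d i + \<bar>d i\<bar> \<ge> 0\<close>, both \<open>s\<close> and
    \<open>v + w + s\<close> lie in the semigroup, so the monomial with exponent
    \<open>v + w\<close> is a fraction of elements of the semigroup ring.\<close>
  define s where "s = (\<lambda>x. \<Sum>i=1..r. int (nat \<bar>d i\<bar>) * m i x)"
  have "v + w \<in> S"
  proof (rule normal_semigroup_saturated[OF normal k(1)])
    have "int k * (v + w) x = (\<Sum>i\<in>J. int (nat (e i + int k * int t)) * m i x)" for x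
      using t by (simp add: ke distrib_left w_def sum_distrib_left distrib_right sum.distrib mult.assoc)
    then have "(\<lambda>x. int k * (v + w) x) = (\<lambda>x. \<Sum>i\<in>J. int (nat (e i + int k * int t)) * m i x)"
      by blast
    then show "(\<lambda>x. int k * (v + w) x) \<in> S" using JS by metis
    show "s \<in> S" unfolding s_def by (rule nat_combinationsI[where k = "\<lambda>i. nat \<bar>d i\<bar>"]) (rule refl)
    have "v + w + s = (\<lambda>x. \<Sum>i=1..r. int (nat (d i + \<bar>d i\<bar>)) * m i x)"
      by (auto simp: d s_def fun_eq_iff distrib_right sum.distrib[symmetric] intro!: sum.cong)
    then show "v + w + s \<in> S" by (rule nat_combinationsI)
  qed
  then obtain c where c: "v + w = (\<lambda>x. \<Sum>i=1..r. int (c i) * m i x)" by (auto simp: nat_combinations_def)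
  \<comment> \<open>Normality may produce a combination of arbitrary generators; the face property
    removes those outside \<open>J\<close>.\<close>
  have "v + w \<in> annihilator N K"
    using v vwN by (auto simp: annihilator_def w_def cone_sublattice_carrier)
  then have "\<forall>i\<in>{1..r}. c i \<noteq> 0 \<longrightarrow> i \<in> J"
    unfolding c nat_combination_annihilates_iff .
  then have "(v + w) x = (\<Sum>i\<in>J. int (c i) * m i x)" for x
    unfolding c by (intro sum.mono_neutral_right) (auto simp: J_def)
  then have "v x = (\<Sum>i\<in>J. (int (c i) - int t) * m i x)" for x
    by (simp add: w_def left_diff_distrib sum_subtractf) (metis add_diff_cancel_right')
  then have "v = (\<lambda>x. \<Sum>i\<in>J. (int (c i) - int t) * m i x)" by blast
  then show thesis by (rule that)
qed

end

section \<open>Points of algebras spanned by monomials\<close>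

abbreviation keys :: "('m \<Rightarrow>\<^sub>0 'b::zero) \<Rightarrow> 'm set" where
  "keys \<equiv> Poly_Mapping.keys"

lemma poly_mapping_eq_sum_single:
  "f = (\<Sum>m\<in>keys f. Poly_Mapping.single m (Poly_Mapping.lookup f m))"
proof (rule poly_mapping_eqI)
  fix k
  show "Poly_Mapping.lookup f k =
      Poly_Mapping.lookup (\<Sum>m\<in>keys f. Poly_Mapping.single m (Poly_Mapping.lookup f m)) k"
    by (auto simp: Poly_Mapping.lookup_sum lookup_single when_def in_keys_iff)
qed

lemma poly_mapping_keys_induct [consumes 1, case_names zero single add]:
  fixes f :: "'m \<Rightarrow>\<^sub>0 'b::comm_monoid_add"
  assumes "keys f \<subseteq> S"
    and "P 0"
    and single: "\<And>m z. m \<in> S \<Longrightarrow> P (Poly_Mapping.single m z)"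
    and add: "\<And>f g. keys f \<subseteq> S \<Longrightarrow> keys g \<subseteq> S \<Longrightarrow> P f \<Longrightarrow> P g \<Longrightarrow> P (f + g)"
  shows "P f"
proof -
  have "keys (\<Sum>m\<in>F. Poly_Mapping.single m (z m)) \<subseteq> S \<and> P (\<Sum>m\<in>F. Poly_Mapping.single m (z m))"
    if "finite F" "F \<subseteq> S" for F z
    using that
  proof induction
    case (insert x F)
    have "keys (Poly_Mapping.single x (z x)) \<subseteq> S"
      using insert.prems by auto
    moreover have "keys (Poly_Mapping.single x (z x) + (\<Sum>m\<in>F. Poly_Mapping.single m (z m))) \<subseteq> S"
      using Poly_Mapping.keys_add[of "Poly_Mapping.single x (z x)" "\<Sum>m\<in>F. Poly_Mapping.single m (z m)"] insert calculation
      by blast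
    ultimately show ?case
      using insert add[of "Poly_Mapping.single x (z x)"] single[of x] by simp
  qed (use assms in auto)
  from this[of "keys f" "Poly_Mapping.lookup f"] show ?thesis
    using assms(1) by (simp flip: poly_mapping_eq_sum_single)
qed

section \<open>Linear extension of values on monomials\<close>

definition lin_ext :: "'u superalgebra \<Rightarrow> ('m \<Rightarrow> 'u) \<Rightarrow> ('m \<Rightarrow>\<^sub>0 complex) \<Rightarrow> 'u" where
  "lin_ext A V f = (\<Oplus>\<^bsub>A\<^esub>m\<in>keys f. Poly_Mapping.lookup f m \<odot>\<^bsub>A\<^esub> V m)"

context
  fixes A :: "'u superalgebra" (structure)
  assumes A: "superalgebra A"
begin

interpretation ring A
  by (rule superalgebra.axioms(1)[OF A])

lemma salg_smult_closed: "x \<in> carrier A \<Longrightarrow> z \<odot> x \<in> carrier A"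
  using module.smult_closed[OF superalgebra.axioms(2)[OF A], of z x] by (simp add: ring_of_type_algebra_def)

lemma smult_add_left: "x \<in> carrier A \<Longrightarrow> (z + w) \<odot> x = z \<odot> x \<oplus> w \<odot> x"
  using module.smult_l_distr[OF superalgebra.axioms(2)[OF A], of z w x] by (simp add: ring_of_type_algebra_def)

lemma smult_smult: "x \<in> carrier A \<Longrightarrow> (z * w) \<odot> x = z \<odot> (w \<odot> x)"
  using module.smult_assoc1[OF superalgebra.axioms(2)[OF A], of z w x] by (simp add: ring_of_type_algebra_def)

lemma one_smult: "x \<in> carrier A \<Longrightarrow> 1 \<odot> x = x"
  using module.smult_one[OF superalgebra.axioms(2)[OF A], of x] by (simp add: ring_of_type_algebra_def)

lemma zero_smult: "x \<in> carrier A \<Longrightarrow> 0 \<odot> x = \<zero>"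
  using smult_add_left[of x 0 0] add.l_cancel_one[of "0 \<odot> x" "0 \<odot> x"] salg_smult_closed[of x 0] by simp

lemma smult_zero: "z \<odot> \<zero> = \<zero>"
  using smult_smult[of \<zero> z 0] by (simp add: zero_smult)

lemma smult_add_right:
  "x \<in> carrier A \<Longrightarrow> y \<in> carrier A \<Longrightarrow> z \<odot> (x \<oplus> y) = z \<odot> x \<oplus> z \<odot> y"
  using module.smult_r_distr[OF superalgebra.axioms(2)[OF A], of z x y] by (simp add: ring_of_type_algebra_def)

lemmas salg_simps [simp] = salg_smult_closed one_smult zero_smult smult_zero

lemma even_carrier: "x \<in> even_part A \<Longrightarrow> x \<in> carrier A"
  using module.submoduleE(1)[OF superalgebra.axioms(2)[OF A] superalgebra.even_submodule[OF A]] by auto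

lemma odd_carrier: "x \<in> odd_part A \<Longrightarrow> x \<in> carrier A"
  using module.submoduleE(1)[OF superalgebra.axioms(2)[OF A] superalgebra.odd_submodule[OF A]] by auto

lemma zero_even: "\<zero> \<in> even_part A" and zero_odd: "\<zero> \<in> odd_part A"
  using superalgebra.direct[OF A] by auto

lemma add_even: "x \<in> even_part A \<Longrightarrow> y \<in> even_part A \<Longrightarrow> x \<oplus> y \<in> even_part A"
  using module.submoduleE(5)[OF superalgebra.axioms(2)[OF A] superalgebra.even_submodule[OF A]] .

lemma add_odd: "x \<in> odd_part A \<Longrightarrow> y \<in> odd_part A \<Longrightarrow> x \<oplus> y \<in> odd_part A"
  using module.submoduleE(5)[OF superalgebra.axioms(2)[OF A] superalgebra.odd_submodule[OF A]] .

lemma smult_even: "x \<in> even_part A \<Longrightarrow> (z::complex) \<odot> x \<in> even_part A"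
  using module.submoduleE(4)[OF superalgebra.axioms(2)[OF A] superalgebra.even_submodule[OF A]] by (simp add: ring_of_type_algebra_def)

lemma smult_odd: "x \<in> odd_part A \<Longrightarrow> (z::complex) \<odot> x \<in> odd_part A"
  using module.submoduleE(4)[OF superalgebra.axioms(2)[OF A] superalgebra.odd_submodule[OF A]] by (simp add: ring_of_type_algebra_def)

lemma finsum_even:
  "finite F \<Longrightarrow> V \<in> F \<rightarrow> even_part A \<Longrightarrow> (\<Oplus>m\<in>F. V m) \<in> even_part A"
proof (induction F rule: finite_induct)
  case (insert x F)
  then have "V \<in> insert x F \<rightarrow> carrier A" using even_carrier by auto
  with insert show ?case by (simp add: add_even Pi_iff)
qed (simp add: zero_even)

lemma finsum_odd:
  "finite F \<Longrightarrow> V \<in> F \<rightarrow> odd_part A \<Longrightarrow> (\<Oplus>m\<in>F. V m) \<in> odd_part A"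
proof (induction F rule: finite_induct)
  case (insert x F)
  then have "V \<in> insert x F \<rightarrow> carrier A" using odd_carrier by auto
  with insert show ?case by (simp add: add_odd Pi_iff)
qed (simp add: zero_odd)

text \<open>Terms of \<open>f + g\<close> can cancel, so \<open>keys\<close> is not additive. Sums
  are compared over a common finite superset, where missing exponents contribute zero.\<close>

lemma lin_ext_superset:
  assumes "finite F" "keys f \<subseteq> F" "V \<in> F \<rightarrow> carrier A"
  shows "lin_ext A V f = (\<Oplus>m\<in>F. Poly_Mapping.lookup f m \<odot> V m)"
  unfolding lin_ext_def
  by (rule add.finprod_mono_neutral_cong)
    (use assms in \<open>auto simp: in_keys_iff Pi_iff\<close>)

lemma lin_ext_closed [simp]:
  "V \<in> keys f \<rightarrow> carrier A \<Longrightarrow> lin_ext A V f \<in> carrier A"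
  unfolding lin_ext_def by (rule finsum_closed) (auto simp: Pi_iff)

lemma lin_ext_zero [simp]: "lin_ext A V 0 = \<zero>"
  by (simp add: lin_ext_def)

lemma lin_ext_single [simp]: "V m \<in> carrier A \<Longrightarrow> lin_ext A V (Poly_Mapping.single m z) = z \<odot> V m"
  by (subst lin_ext_superset[of "{m}"]) (auto simp: Pi_iff)

lemma lin_ext_add:
  assumes "V \<in> keys f \<union> keys g \<rightarrow> carrier A"
  shows "lin_ext A V (f + g) = lin_ext A V f \<oplus> lin_ext A V g"
proof -
  let ?F = "keys f \<union> keys g"
  have V: "V m \<in> carrier A" if "m \<in> ?F" for m
    using that assms by auto
  have "lin_ext A V (f + g) = (\<Oplus>m\<in>?F. Poly_Mapping.lookup f m \<odot> V m \<oplus> Poly_Mapping.lookup g m \<odot> V m)"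
    using assms V Poly_Mapping.keys_add[of f g]
    by (subst lin_ext_superset[of ?F], simp, simp, simp, intro finsum_cong') (auto simp: lookup_add smult_add_left)
  also have "\<dots> = (\<Oplus>m\<in>?F. Poly_Mapping.lookup f m \<odot> V m) \<oplus> (\<Oplus>m\<in>?F. Poly_Mapping.lookup g m \<odot> V m)"
    by (rule finsum_addf) (use V in auto)
  finally show ?thesis
    using assms by (simp add: lin_ext_superset[of ?F])
qed

lemma lin_ext_smult:
  fixes f :: "'m::comm_monoid_add \<Rightarrow>\<^sub>0 complex"
  assumes "keys f \<subseteq> S" "V \<in> S \<rightarrow> carrier A"
  shows "lin_ext A V (Poly_Mapping.single 0 z * f) = z \<odot> lin_ext A V f"
  using assms(1)
proof (induction rule: poly_mapping_keys_induct)
  case (single m w)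
  then show ?case using assms(2) by (auto simp: mult_single smult_smult lin_ext_single Pi_iff)
next
  case (add f g)
  have "keys (Poly_Mapping.single 0 z * h) \<subseteq> keys h" for h :: "'m \<Rightarrow>\<^sub>0 complex"
    using keys_mult[of "Poly_Mapping.single 0 z" h] by (auto split: if_splits)
  with add assms(2) have "V \<in> keys f \<union> keys g \<rightarrow> carrier A"
    "V \<in> keys (Poly_Mapping.single 0 z * f) \<union> keys (Poly_Mapping.single 0 z * g) \<rightarrow> carrier A"
    by blast+
  with add show ?case
    by (simp add: lin_ext_add distrib_left) (subst smult_add_right, auto)
qed simp

text \<open>Both sides are bilinear, so monomials suffice. Three separate value functions make the
  products even-even, even-odd, odd-even and odd-odd (with \<open>U\<close> zero) instances of one
  statement.\<close>

lemma lin_ext_mult: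
  assumes "keys f \<subseteq> P" "keys g \<subseteq> Q"
    and U: "\<And>m l. m \<in> P \<Longrightarrow> l \<in> Q \<Longrightarrow> U (m + l) = V m \<otimes> W l"
    and V: "\<And>m. m \<in> P \<Longrightarrow> V m \<in> carrier A" and W: "\<And>l. l \<in> Q \<Longrightarrow> W l \<in> carrier A"
  shows "lin_ext A U (f * g) = lin_ext A V f \<otimes> lin_ext A W g"
proof -
  have UPQ: "U x \<in> carrier A" if x: "x \<in> keys (f' * g')" "keys f' \<subseteq> P" "keys g' \<subseteq> Q" for x f' g'
  proof -
    obtain m l where "m \<in> P" "l \<in> Q" "x = m + l"
      using subsetD[OF keys_mult x(1)] x(2,3) by blast
    then show ?thesis using U V W by simp
  qed
  show ?thesis
    using assms(1)
  proof (induction rule: poly_mapping_keys_induct)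
    case zero
    have "lin_ext A W g \<in> carrier A" using W assms(2) by (intro lin_ext_closed) auto
    then show ?case by simp
  next
    case (single m z)
    note m = single
    show ?case
      using assms(2)
    proof (induction rule: poly_mapping_keys_induct)
      case zero
      show ?case using m V by simp
    next
      case (single l w)
      have "U (m + l) \<in> carrier A" using U[OF m single] V[OF m] W[OF single] by simp
      moreover have "w \<odot> (z \<odot> (V m \<otimes> W l)) = z \<odot> (w \<odot> (V m \<otimes> W l))"
        using V[OF m] W[OF single] smult_smult[of "V m \<otimes> W l"] by (metis m_closed mult.commute)
      ultimately show ?case
        using m single V W U
        by (simp add: mult_single smult_smult superalgebra.smult_mult_left[OF A] superalgebra.smult_mult_right[OF A])
    next
      case (add f' g')
      have "lin_ext A U (Poly_Mapping.single m z * f' + Poly_Mapping.single m z * g') =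
         lin_ext A U (Poly_Mapping.single m z * f') \<oplus> lin_ext A U (Poly_Mapping.single m z * g')"
        by (rule lin_ext_add) (use add m UPQ[of _ "Poly_Mapping.single m z"] in auto)
      moreover have "lin_ext A W (f' + g') = lin_ext A W f' \<oplus> lin_ext A W g'"
        by (rule lin_ext_add) (use add W in auto)
      moreover have "lin_ext A W f' \<in> carrier A" "lin_ext A W g' \<in> carrier A"
        using add W by (auto intro!: lin_ext_closed)
      ultimately show ?case
        using add m V by (simp add: distrib_left r_distr)
    qed
  next
    case (add f1 f2)
    have "lin_ext A U (f1 * g + f2 * g) = lin_ext A U (f1 * g) \<oplus> lin_ext A U (f2 * g)"
      by (rule lin_ext_add) (use add assms(2) UPQ[of _ _ g] in auto)
    moreover have "lin_ext A V (f1 + f2) = lin_ext A V f1 \<oplus> lin_ext A V f2"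
      by (rule lin_ext_add) (use add V in auto)
    moreover have "lin_ext A V f1 \<in> carrier A" "lin_ext A V f2 \<in> carrier A" "lin_ext A W g \<in> carrier A"
      using add V W assms(2) by (auto intro!: lin_ext_closed)
    ultimately show ?case
      using add by (simp add: distrib_right l_distr)
  qed
qed

lemma lin_ext_even:
  "V \<in> keys f \<rightarrow> even_part A \<Longrightarrow> lin_ext A V f \<in> even_part A"
  unfolding lin_ext_def by (rule finsum_even) (auto intro: smult_even)

lemma lin_ext_odd:
  "V \<in> keys f \<rightarrow> odd_part A \<Longrightarrow> lin_ext A V f \<in> odd_part A"
  unfolding lin_ext_def by (rule finsum_odd) (auto intro: smult_odd)

lemma lin_ext_cong:
  assumes "\<And>m. m \<in> keys f \<Longrightarrow> V m = V' m" "\<And>m. m \<in> keys f \<Longrightarrow> V' m \<in> carrier A"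
  shows "lin_ext A V f = lin_ext A V' f"
  unfolding lin_ext_def by (rule finsum_cong') (use assms in auto)

end

text \<open>One form for three rings: the supertorus has \<open>P\<close> and \<open>Q\<close> both
  equal to the dual lattice, the ordinary torus has \<open>Q\<close> empty, and the coordinate ring
  of \<open>X\<close> has its even and odd exponents.\<close>

definition spoly_alg :: "'m::comm_monoid_add set \<Rightarrow> 'm set \<Rightarrow> 'm spoly superalgebra" where
  "spoly_alg P Q = \<lparr>
     carrier = {(f, g). keys f \<subseteq> P \<and> keys g \<subseteq> Q},
     monoid.mult = (\<lambda>(f, g) (f', g'). (f * f', f * g' + g * f')),
     one = (1, 0),
     ring.zero = (0, 0),
     add = (\<lambda>(f, g) (f', g'). (f + f', g + g')),
     module.smult = (\<lambda>z (f, g). (Poly_Mapping.single 0 z * f, Poly_Mapping.single 0 z * g)),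
     even_part = {(f, g). keys f \<subseteq> P \<and> g = 0},
     odd_part = {(f, g). f = 0 \<and> keys g \<subseteq> Q}\<rparr>"

lemma supertorus_ring_eq: "supertorus_ring L = spoly_alg (dual L) (dual L)"
  by (simp add: supertorus_ring_def spoly_alg_def)

lemma torus_ring_eq: "torus_ring L = spoly_alg (dual L) {}"
  by (auto simp: torus_ring_def sub_superalgebra_def supertorus_ring_def spoly_alg_def)

text \<open>The condition for the span to contain 1 and be closed under products; there is no clause
  for sums of two odd exponents because those products vanish.\<close>

definition exponents :: "'m::comm_monoid_add set \<Rightarrow> 'm set \<Rightarrow> bool" where
  "exponents P Q \<longleftrightarrow> 0 \<in> P \<and> (\<forall>m\<in>P. \<forall>l\<in>P. m + l \<in> P) \<and> (\<forall>m\<in>P. \<forall>l\<in>Q. m + l \<in> Q)"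

lemma exponentsD:
  assumes "exponents P Q"
  shows "0 \<in> P" "m \<in> P \<Longrightarrow> l \<in> P \<Longrightarrow> m + l \<in> P" "m \<in> P \<Longrightarrow> l \<in> Q \<Longrightarrow> m + l \<in> Q"
  using assms by (auto simp: exponents_def)

text \<open>The possible values of a superalgebra homomorphism on monomials. The last clause
  reflects \<open>\<xi>\<^sup>2 = 0\<close>; for two different exponents anticommutativity alone
  does not give it.\<close>

definition char_data ::
  "'m::comm_monoid_add set \<Rightarrow> 'm set \<Rightarrow> 'u superalgebra \<Rightarrow> ('m \<Rightarrow> 'u) \<Rightarrow> ('m \<Rightarrow> 'u) \<Rightarrow> bool" where
  "char_data P Q A V W \<longleftrightarrow> V \<in> P \<rightarrow> even_part A \<and> W \<in> Q \<rightarrow> odd_part A \<and> V 0 = \<one>\<^bsub>A\<^esub> \<and>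
     (\<forall>m\<in>P. \<forall>l\<in>P. V (m + l) = V m \<otimes>\<^bsub>A\<^esub> V l) \<and>
     (\<forall>m\<in>P. \<forall>l\<in>Q. W (m + l) = V m \<otimes>\<^bsub>A\<^esub> W l) \<and>
     (\<forall>m\<in>Q. \<forall>l\<in>Q. W m \<otimes>\<^bsub>A\<^esub> W l = \<zero>\<^bsub>A\<^esub>)"

lemma char_dataI:
  assumes "\<And>m. m \<in> P \<Longrightarrow> V m \<in> even_part A" "\<And>m. m \<in> Q \<Longrightarrow> W m \<in> odd_part A"
    "V 0 = \<one>\<^bsub>A\<^esub>" "\<And>m l. m \<in> P \<Longrightarrow> l \<in> P \<Longrightarrow> V (m + l) = V m \<otimes>\<^bsub>A\<^esub> V l"
    "\<And>m l. m \<in> P \<Longrightarrow> l \<in> Q \<Longrightarrow> W (m + l) = V m \<otimes>\<^bsub>A\<^esub> W l"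
    "\<And>m l. m \<in> Q \<Longrightarrow> l \<in> Q \<Longrightarrow> W m \<otimes>\<^bsub>A\<^esub> W l = \<zero>\<^bsub>A\<^esub>"
  shows "char_data P Q A V W"
  using assms by (auto simp: char_data_def)

lemma char_dataD:
  assumes "char_data P Q A V W"
  shows "m \<in> P \<Longrightarrow> V m \<in> even_part A" "m \<in> Q \<Longrightarrow> W m \<in> odd_part A"
    "V 0 = \<one>\<^bsub>A\<^esub>" "m \<in> P \<Longrightarrow> l \<in> P \<Longrightarrow> V (m + l) = V m \<otimes>\<^bsub>A\<^esub> V l"
    "m \<in> P \<Longrightarrow> l \<in> Q \<Longrightarrow> W (m + l) = V m \<otimes>\<^bsub>A\<^esub> W l"
    "m \<in> Q \<Longrightarrow> l \<in> Q \<Longrightarrow> W m \<otimes>\<^bsub>A\<^esub> W l = \<zero>\<^bsub>A\<^esub>"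
  using assms by (auto simp: char_data_def)

definition extend_data ::
  "'m::comm_monoid_add set \<Rightarrow> 'm set \<Rightarrow> 'u superalgebra \<Rightarrow> ('m \<Rightarrow> 'u) \<Rightarrow> ('m \<Rightarrow> 'u) \<Rightarrow> ('m spoly \<Rightarrow> 'u)" where
  "extend_data P Q A V W = (\<lambda>f\<in>carrier (spoly_alg P Q). lin_ext A V (fst f) \<oplus>\<^bsub>A\<^esub> lin_ext A W (snd f))"

text \<open>The two sums in \<open>act\<close> are linear extensions, so statements about products
  and translated points become statements about values on monomials.\<close>

lemma act_eq_extend_data:
  "act (carrier (spoly_alg P Q)) c A g h = extend_data P Q A
     (\<lambda>m. g (monomial m) \<otimes>\<^bsub>A\<^esub> h (monomial m) \<oplus>\<^bsub>A\<^esub>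
        (if c m = 0 then \<zero>\<^bsub>A\<^esub>
         else c m \<odot>\<^bsub>A\<^esub> (g (monomial_xi m) \<otimes>\<^bsub>A\<^esub> h (monomial_xi m))))
     (\<lambda>m. g (monomial_xi m) \<otimes>\<^bsub>A\<^esub> h (monomial m) \<oplus>\<^bsub>A\<^esub> g (monomial m) \<otimes>\<^bsub>A\<^esub> h (monomial_xi m))"
  by (simp add: act_def extend_data_def lin_ext_def)

lemma monomial_carrier [simp]: "monomial m \<in> carrier (spoly_alg P Q) \<longleftrightarrow> m \<in> P"
  by (auto simp: monomial_def spoly_alg_def)

lemma monomial_xi_carrier [simp]: "monomial_xi m \<in> carrier (spoly_alg P Q) \<longleftrightarrow> m \<in> Q"
  by (auto simp: monomial_xi_def spoly_alg_def)

lemma monomial_even: "m \<in> P \<Longrightarrow> monomial m \<in> even_part (spoly_alg P Q)"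
  by (auto simp: monomial_def spoly_alg_def)

lemma monomial_xi_odd: "m \<in> Q \<Longrightarrow> monomial_xi m \<in> odd_part (spoly_alg P Q)"
  by (auto simp: monomial_xi_def spoly_alg_def)

lemma monomial_mult: "monomial m \<otimes>\<^bsub>spoly_alg P Q\<^esub> monomial l = monomial (m + l)"
  by (simp add: monomial_def spoly_alg_def mult_single)

lemma monomial_mult_xi: "monomial m \<otimes>\<^bsub>spoly_alg P Q\<^esub> monomial_xi l = monomial_xi (m + l)"
  by (simp add: monomial_def monomial_xi_def spoly_alg_def mult_single)

lemma monomial_xi_mult_xi: "monomial_xi m \<otimes>\<^bsub>spoly_alg P Q\<^esub> monomial_xi l = \<zero>\<^bsub>spoly_alg P Q\<^esub>"
  by (simp add: monomial_xi_def spoly_alg_def)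

lemma monomial_zero: "monomial 0 = \<one>\<^bsub>spoly_alg P Q\<^esub>"
  by (simp add: monomial_def spoly_alg_def)

lemma salg_homD:
  assumes "h \<in> salg_hom R A"
  shows "x \<in> carrier R \<Longrightarrow> h x \<in> carrier A"
    "x \<in> carrier R \<Longrightarrow> y \<in> carrier R \<Longrightarrow> h (x \<otimes>\<^bsub>R\<^esub> y) = h x \<otimes>\<^bsub>A\<^esub> h y"
    "x \<in> carrier R \<Longrightarrow> y \<in> carrier R \<Longrightarrow> h (x \<oplus>\<^bsub>R\<^esub> y) = h x \<oplus>\<^bsub>A\<^esub> h y"
    "x \<in> carrier R \<Longrightarrow> h (z \<odot>\<^bsub>R\<^esub> x) = z \<odot>\<^bsub>A\<^esub> h x"
    "h \<one>\<^bsub>R\<^esub> = \<one>\<^bsub>A\<^esub>"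
    "x \<in> even_part R \<Longrightarrow> h x \<in> even_part A"
    "x \<in> odd_part R \<Longrightarrow> h x \<in> odd_part A"
    "h \<in> extensional (carrier R)"
  using assms unfolding salg_hom_def ring_hom_def by blast+

context
  fixes A :: "'u superalgebra" (structure)
  assumes A: "superalgebra A"
begin

interpretation ring A
  by (rule superalgebra.axioms(1)[OF A])

lemma extend_data_monomial:
  "m \<in> P \<Longrightarrow> V m \<in> carrier A \<Longrightarrow> extend_data P Q A V W (monomial m) = V m"
  using A by (simp add: extend_data_def) (simp add: monomial_def lin_ext_single one_smult lin_ext_zero)

lemma extend_data_monomial_xi:
  "m \<in> Q \<Longrightarrow> W m \<in> carrier A \<Longrightarrow> extend_data P Q A V W (monomial_xi m) = W m"
  using A by (simp add: extend_data_def) (simp add: monomial_xi_def lin_ext_single one_smult lin_ext_zero)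

lemma extend_data_cong:
  assumes "\<And>m. m \<in> P \<Longrightarrow> V m = V' m" "\<And>m. m \<in> P \<Longrightarrow> V' m \<in> carrier A"
    "\<And>m. m \<in> Q \<Longrightarrow> W m = W' m" "\<And>m. m \<in> Q \<Longrightarrow> W' m \<in> carrier A"
  shows "extend_data P Q A V W = extend_data P Q A V' W'"
  unfolding extend_data_def
proof (rule restrict_ext)
  fix f assume "f \<in> carrier (spoly_alg P Q)"
  then have "keys (fst f) \<subseteq> P" "keys (snd f) \<subseteq> Q"
    by (auto simp: spoly_alg_def)
  with assms have "lin_ext A V (fst f) = lin_ext A V' (fst f)" "lin_ext A W (snd f) = lin_ext A W' (snd f)"
    by (auto intro!: lin_ext_cong[OF A])
  then show "lin_ext A V (fst f) \<oplus> lin_ext A W (snd f) = lin_ext A V' (fst f) \<oplus> lin_ext A W' (snd f)"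
    by simp
qed

lemma extend_data_eq_iff:
  assumes "\<And>m. m \<in> P \<Longrightarrow> V m \<in> carrier A" "\<And>m. m \<in> P \<Longrightarrow> V' m \<in> carrier A"
    "\<And>m. m \<in> Q \<Longrightarrow> W m \<in> carrier A" "\<And>m. m \<in> Q \<Longrightarrow> W' m \<in> carrier A"
  shows "extend_data P Q A V W = extend_data P Q A V' W' \<longleftrightarrow> (\<forall>m\<in>P. V m = V' m) \<and> (\<forall>m\<in>Q. W m = W' m)"
proof
  assume eq: "extend_data P Q A V W = extend_data P Q A V' W'"
  show "(\<forall>m\<in>P. V m = V' m) \<and> (\<forall>m\<in>Q. W m = W' m)"
    using assms extend_data_monomial[of _ P V Q W] extend_data_monomial[of _ P V' Q W']
      extend_data_monomial_xi[of _ Q W P V] extend_data_monomial_xi[of _ Q W' P V'] eq by auto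
qed (use assms in \<open>auto intro!: extend_data_cong\<close>)

text \<open>Together with \<open>salg_hom_char_data\<close> and
  \<open>salg_hom_eq_extend_data\<close> this identifies the \<open>A\<close>-points of a monomial
  algebra with \<open>char_data\<close>. The crossed products work out because even values are
  central and products of two odd values vanish.\<close>

lemma extend_data_salg_hom:
  fixes P Q :: "'m::comm_monoid_add set"
  assumes PQ: "exponents P Q" and data: "char_data P Q A V W"
  shows "extend_data P Q A V W \<in> salg_hom (spoly_alg P Q) A"
proof -
  let ?R = "spoly_alg P Q" and ?h = "extend_data P Q A V W"
  note d = char_dataD[OF data]
  have V: "V m \<in> carrier A" if "m \<in> P" for m using d(1)[OF that] even_carrier[OF A] by auto
  have W: "W m \<in> carrier A" if "m \<in> Q" for m using d(2)[OF that] odd_carrier[OF A] by auto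
  have lV: "lin_ext A V f \<in> carrier A" if "keys f \<subseteq> P" for f
    using that V by (intro lin_ext_closed[OF A]) auto
  have lW: "lin_ext A W f \<in> carrier A" if "keys f \<subseteq> Q" for f
    using that W by (intro lin_ext_closed[OF A]) auto
  have h: "?h (f, g) = lin_ext A V f \<oplus> lin_ext A W g" if "keys f \<subseteq> P" "keys g \<subseteq> Q" for f g
    using that by (simp add: extend_data_def spoly_alg_def)
  have kPP: "keys (f * g) \<subseteq> P" if "keys f \<subseteq> P" "keys g \<subseteq> P" for f g :: "'m \<Rightarrow>\<^sub>0 complex"
    using keys_mult[of f g] that exponentsD(2)[OF PQ] by blast
  have kPQ: "keys (f * g) \<subseteq> Q" if "keys f \<subseteq> P" "keys g \<subseteq> Q" for f g :: "'m \<Rightarrow>\<^sub>0 complex"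
    using keys_mult[of f g] that exponentsD(3)[OF PQ] by blast
  have kQP: "keys (f * g) \<subseteq> Q" if "keys f \<subseteq> Q" "keys g \<subseteq> P" for f g :: "'m \<Rightarrow>\<^sub>0 complex"
    using kPQ[OF that(2,1)] by (simp add: mult.commute)
  have kadd: "keys (f + g) \<subseteq> T" if "keys f \<subseteq> T" "keys g \<subseteq> T" for f g :: "'m \<Rightarrow>\<^sub>0 complex" and T
    using Poly_Mapping.keys_add[of f g] that by blast
  have addV: "lin_ext A V (f + g) = lin_ext A V f \<oplus> lin_ext A V g" if "keys f \<subseteq> P" "keys g \<subseteq> P" for f g
    by (rule lin_ext_add[OF A]) (use that V in auto)
  have addW: "lin_ext A W (f + g) = lin_ext A W f \<oplus> lin_ext A W g" if "keys f \<subseteq> Q" "keys g \<subseteq> Q" for f g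
    by (rule lin_ext_add[OF A]) (use that W in auto)
  have multVV: "lin_ext A V (f * g) = lin_ext A V f \<otimes> lin_ext A V g" if "keys f \<subseteq> P" "keys g \<subseteq> P" for f g
    by (rule lin_ext_mult[OF A that]) (use d(4) V in auto)
  have multVW: "lin_ext A W (f * g) = lin_ext A V f \<otimes> lin_ext A W g" if "keys f \<subseteq> P" "keys g \<subseteq> Q" for f g
    by (rule lin_ext_mult[OF A that]) (use d(5) V W in auto)
  have multWV: "lin_ext A W (f * g) = lin_ext A W f \<otimes> lin_ext A V g" if "keys f \<subseteq> Q" "keys g \<subseteq> P" for f g
  proof (rule lin_ext_mult[OF A that])
    fix m l assume "m \<in> Q" "l \<in> P"
    then show "W (m + l) = W m \<otimes> V l"
      using d(5)[of l m] superalgebra.even_central[OF A d(1)[of l] W[of m]] by (simp add: add.commute)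
  qed (use V W in auto)
  have multWW: "lin_ext A W f \<otimes> lin_ext A W g = \<zero>" if "keys f \<subseteq> Q" "keys g \<subseteq> Q" for f g
  proof -
    have "lin_ext A (\<lambda>_. \<zero>) (f * g) = lin_ext A W f \<otimes> lin_ext A W g"
      by (rule lin_ext_mult[OF A that]) (use d(6) W in auto)
    moreover have "lin_ext A (\<lambda>_. \<zero>) (f * g) = \<zero>"
      using A by (simp add: lin_ext_def smult_zero)
    ultimately show ?thesis by simp
  qed
  have evenV: "lin_ext A V f \<in> even_part A" if "keys f \<subseteq> P" for f
    by (rule lin_ext_even[OF A]) (use that d(1) in auto)
  have oddW: "lin_ext A W f \<in> odd_part A" if "keys f \<subseteq> Q" for f
    by (rule lin_ext_odd[OF A]) (use that d(2) in auto)
  have hom: "?h \<in> ring_hom ?R A"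
  proof (rule ring_hom_memI)
    fix x assume "x \<in> carrier ?R"
    then show "?h x \<in> carrier A"
      by (cases x) (auto simp: spoly_alg_def h lV lW)
  next
    fix x y assume xy: "x \<in> carrier ?R" "y \<in> carrier ?R"
    obtain f g f' g' where x: "x = (f, g)" and y: "y = (f', g')" by (cases x, cases y)
    have k: "keys f \<subseteq> P" "keys g \<subseteq> Q" "keys f' \<subseteq> P" "keys g' \<subseteq> Q"
      using xy by (auto simp: x y spoly_alg_def)
    have "?h (x \<oplus>\<^bsub>?R\<^esub> y) = ?h (f + f', g + g')" by (simp add: x y spoly_alg_def)
    also have "\<dots> = ?h x \<oplus> ?h y"
      using k lV lW by (simp add: h kadd addV addW x y a_ac)
    finally show "?h (x \<oplus>\<^bsub>?R\<^esub> y) = ?h x \<oplus> ?h y" .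
    have "?h (x \<otimes>\<^bsub>?R\<^esub> y) = ?h (f * f', f * g' + g * f')" by (simp add: x y spoly_alg_def)
    also have "\<dots> = lin_ext A V f \<otimes> lin_ext A V f' \<oplus> (lin_ext A V f \<otimes> lin_ext A W g' \<oplus> lin_ext A W g \<otimes> lin_ext A V f')"
      using k by (simp add: h kadd kPP kPQ kQP addW multVV multVW multWV)
    also have "\<dots> = ?h x \<otimes> ?h y"
      using k lV lW multWW[of g g'] by (simp add: h x y l_distr r_distr a_ac)
    finally show "?h (x \<otimes>\<^bsub>?R\<^esub> y) = ?h x \<otimes> ?h y" .
  next
    have "\<one>\<^bsub>?R\<^esub> = monomial 0" by (rule monomial_zero[symmetric])
    then show "?h \<one>\<^bsub>?R\<^esub> = \<one>"
      using extend_data_monomial[of 0 P V Q W] exponentsD(1)[OF PQ] d(3) by simp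
  qed
  have smult: "?h (z \<odot>\<^bsub>?R\<^esub> x) = z \<odot> ?h x" if "x \<in> carrier ?R" for z x
  proof -
    obtain f g where x: "x = (f, g)" by (cases x)
    have k: "keys f \<subseteq> P" "keys g \<subseteq> Q" using that by (auto simp: x spoly_alg_def)
    have k': "keys (Poly_Mapping.single 0 z * f') \<subseteq> keys f'" for f' :: "'m \<Rightarrow>\<^sub>0 complex"
      using keys_mult[of "Poly_Mapping.single 0 z" f'] by (auto split: if_splits)
    have "?h (z \<odot>\<^bsub>?R\<^esub> x) = lin_ext A V (Poly_Mapping.single 0 z * f) \<oplus> lin_ext A W (Poly_Mapping.single 0 z * g)"
      using k k'[of f] k'[of g] by (simp add: x spoly_alg_def) (rule h, auto)
    also have "\<dots> = z \<odot> lin_ext A V f \<oplus> z \<odot> lin_ext A W g"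
      using lin_ext_smult[OF A k(1), of V z] lin_ext_smult[OF A k(2), of W z] V W by auto
    finally show ?thesis using k lV lW smult_add_right[OF A] by (simp add: x h)
  qed
  have "?h ` even_part ?R \<subseteq> even_part A"
    using evenV even_carrier[OF A] A by (auto simp: spoly_alg_def h lin_ext_zero)
  moreover have "?h ` odd_part ?R \<subseteq> odd_part A"
    using oddW odd_carrier[OF A] A by (auto simp: spoly_alg_def h lin_ext_zero)
  ultimately show ?thesis
    using hom smult by (auto simp: salg_hom_def extend_data_def)
qed

lemma salg_hom_zero:
  assumes PQ: "exponents P Q" and h: "h \<in> salg_hom (spoly_alg P Q) A"
  shows "h (0, 0) = \<zero>"
proof -
  let ?R = "spoly_alg P Q"
  have "(0,0) \<in> carrier ?R" "(0,0) \<oplus>\<^bsub>?R\<^esub> (0,0) = (0,0)" by (auto simp: spoly_alg_def)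
  then have "h (0,0) = h (0,0) \<oplus> h (0,0)" "h (0,0) \<in> carrier A"
    using h by (auto simp: salg_hom_def ring_hom_def) metis
  then show ?thesis using add.r_cancel_one by metis
qed

lemma salg_hom_char_data:
  assumes PQ: "exponents P Q" and h: "h \<in> salg_hom (spoly_alg P Q) A"
  shows "char_data P Q A (\<lambda>m. h (monomial m)) (\<lambda>m. h (monomial_xi m))"
proof (rule char_dataI)
  let ?R = "spoly_alg P Q"
  have hom: "h (x \<otimes>\<^bsub>?R\<^esub> y) = h x \<otimes> h y" if "x \<in> carrier ?R" "y \<in> carrier ?R" for x y
    using salg_homD[OF h] that by blast
  show "h (monomial m) \<in> even_part A" if "m \<in> P" for m
    using h monomial_even[OF that, of Q] by (auto simp: salg_hom_def)
  show "h (monomial_xi m) \<in> odd_part A" if "m \<in> Q" for m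
    using h monomial_xi_odd[OF that, of P] by (auto simp: salg_hom_def)
  show "h (monomial 0) = \<one>"
    using h by (auto simp: monomial_zero[of P Q] salg_hom_def ring_hom_def)
  show "h (monomial (m + l)) = h (monomial m) \<otimes> h (monomial l)" if "m \<in> P" "l \<in> P" for m l
    using hom[of "monomial m" "monomial l"] that by (simp add: monomial_mult)
  show "h (monomial_xi (m + l)) = h (monomial m) \<otimes> h (monomial_xi l)" if "m \<in> P" "l \<in> Q" for m l
    using hom[of "monomial m" "monomial_xi l"] that by (simp add: monomial_mult_xi)
  show "h (monomial_xi m) \<otimes> h (monomial_xi l) = \<zero>" if "m \<in> Q" "l \<in> Q" for m l
    using hom[of "monomial_xi m" "monomial_xi l"] that salg_hom_zero[OF PQ h]
    by (simp add: monomial_xi_mult_xi) (simp add: spoly_alg_def)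
qed

lemma salg_hom_eq_extend_data:
  assumes PQ: "exponents P Q" and h: "h \<in> salg_hom (spoly_alg P Q) A"
  shows "h = extend_data P Q A (\<lambda>m. h (monomial m)) (\<lambda>m. h (monomial_xi m))"
proof (rule extensionalityI[of _ "carrier (spoly_alg P Q)"])
  let ?R = "spoly_alg P Q"
  note d = char_dataD[OF salg_hom_char_data[OF PQ h]]
  have V: "h (monomial m) \<in> carrier A" if "m \<in> P" for m using d(1)[OF that] even_carrier[OF A] by auto
  have W: "h (monomial_xi m) \<in> carrier A" if "m \<in> Q" for m using d(2)[OF that] odd_carrier[OF A] by auto
  have hom_add: "h (x \<oplus>\<^bsub>?R\<^esub> y) = h x \<oplus> h y" if "x \<in> carrier ?R" "y \<in> carrier ?R" for x y
    using salg_homD[OF h] that by blast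
  have smult: "h (z \<odot>\<^bsub>?R\<^esub> x) = z \<odot> h x" if "x \<in> carrier ?R" for x z
    using h that by (auto simp: salg_hom_def)
  have hV: "h (f, 0) = lin_ext A (\<lambda>m. h (monomial m)) f" if "keys f \<subseteq> P" for f
    using that
  proof (induction rule: poly_mapping_keys_induct)
    case zero
    then show ?case using salg_hom_zero[OF PQ h] A by (simp add: lin_ext_zero)
  next
    case (single m z)
    have "h (z \<odot>\<^bsub>?R\<^esub> monomial m) = z \<odot> h (monomial m)" using smult single by simp
    moreover have "z \<odot>\<^bsub>?R\<^esub> monomial m = (Poly_Mapping.single m z, 0)"
      by (simp add: spoly_alg_def monomial_def mult_single)
    ultimately show ?case using A V[OF single] by (simp add: lin_ext_single)
  next
    case (add f g)
    have "(f, 0) \<oplus>\<^bsub>?R\<^esub> (g, 0) = (f + g, 0)" "(f, 0) \<in> carrier ?R" "(g, 0) \<in> carrier ?R"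
      using add by (auto simp: spoly_alg_def)
    then have "h (f + g, 0) = h (f, 0) \<oplus> h (g, 0)"
      using hom_add[of "(f, 0)" "(g, 0)"] by simp
    moreover have "lin_ext A (\<lambda>m. h (monomial m)) (f + g) = lin_ext A (\<lambda>m. h (monomial m)) f \<oplus> lin_ext A (\<lambda>m. h (monomial m)) g"
      by (rule lin_ext_add[OF A]) (use add V in auto)
    ultimately show ?case using add by simp
  qed
  have hW: "h (0, f) = lin_ext A (\<lambda>m. h (monomial_xi m)) f" if "keys f \<subseteq> Q" for f
    using that
  proof (induction rule: poly_mapping_keys_induct)
    case zero
    then show ?case using salg_hom_zero[OF PQ h] A by (simp add: lin_ext_zero)
  next
    case (single m z)
    have "h (z \<odot>\<^bsub>?R\<^esub> monomial_xi m) = z \<odot> h (monomial_xi m)" using smult single by simp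
    moreover have "z \<odot>\<^bsub>?R\<^esub> monomial_xi m = (0, Poly_Mapping.single m z)"
      by (simp add: spoly_alg_def monomial_xi_def mult_single)
    ultimately show ?case using A W[OF single] by (simp add: lin_ext_single)
  next
    case (add f g)
    have "(0, f) \<oplus>\<^bsub>?R\<^esub> (0, g) = (0, f + g)" "(0, f) \<in> carrier ?R" "(0, g) \<in> carrier ?R"
      using add by (auto simp: spoly_alg_def)
    then have "h (0, f + g) = h (0, f) \<oplus> h (0, g)"
      using hom_add[of "(0, f)" "(0, g)"] by simp
    moreover have "lin_ext A (\<lambda>m. h (monomial_xi m)) (f + g) = lin_ext A (\<lambda>m. h (monomial_xi m)) f \<oplus> lin_ext A (\<lambda>m. h (monomial_xi m)) g"
      by (rule lin_ext_add[OF A]) (use add W in auto)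
    ultimately show ?case using add by simp
  qed
  show "h x = extend_data P Q A (\<lambda>m. h (monomial m)) (\<lambda>m. h (monomial_xi m)) x" if "x \<in> carrier ?R" for x
  proof -
    obtain f g where x: "x = (f, g)" by (cases x)
    have k: "keys f \<subseteq> P" "keys g \<subseteq> Q" using that by (auto simp: x spoly_alg_def)
    have "x = (f, 0) \<oplus>\<^bsub>?R\<^esub> (0, g)" "(f, 0) \<in> carrier ?R" "(0, g) \<in> carrier ?R"
      using k by (auto simp: x spoly_alg_def)
    then have "h x = h (f, 0) \<oplus> h (0, g)" using hom_add by metis
    with hV[OF k(1)] hW[OF k(2)] that show ?thesis by (simp add: extend_data_def x)
  qed
qed (use h in \<open>auto simp: salg_hom_def extend_data_def\<close>)

end

lemma lin_ext_hom:
  assumes A: "superalgebra A" and B: "superalgebra B" and \<phi>: "\<phi> \<in> salg_hom A B"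
    and V: "\<And>m. m \<in> S \<Longrightarrow> V m \<in> carrier A" and f: "keys f \<subseteq> S"
  shows "\<phi> (lin_ext A V f) = lin_ext B (\<lambda>m. \<phi> (V m)) f"
proof -
  interpret A: ring A by (rule superalgebra.axioms(1)[OF A])
  interpret B: ring B by (rule superalgebra.axioms(1)[OF B])
  note hom = salg_homD[OF \<phi>]
  have hom_zero: "\<phi> \<zero>\<^bsub>A\<^esub> = \<zero>\<^bsub>B\<^esub>"
    using hom(4)[OF A.zero_closed, of 0] zero_smult[OF A A.zero_closed] zero_smult[OF B hom(1)[OF A.zero_closed]]
    by simp
  show ?thesis
    using f
  proof (induction rule: poly_mapping_keys_induct)
    case zero
    show ?case using A B by (simp add: hom_zero lin_ext_zero)
  next
    case (single m z)
    then show ?case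
      using V hom A B by (simp add: lin_ext_single)
  next
    case (add f g)
    have "lin_ext A V (f + g) = lin_ext A V f \<oplus>\<^bsub>A\<^esub> lin_ext A V g"
      by (rule lin_ext_add[OF A]) (use add V in auto)
    moreover have "lin_ext B (\<lambda>m. \<phi> (V m)) (f + g) = lin_ext B (\<lambda>m. \<phi> (V m)) f \<oplus>\<^bsub>B\<^esub> lin_ext B (\<lambda>m. \<phi> (V m)) g"
      by (rule lin_ext_add[OF B]) (use add V hom in auto)
    moreover have "lin_ext A V f \<in> carrier A" "lin_ext A V g \<in> carrier A"
      using add V by (auto intro!: lin_ext_closed[OF A])
    ultimately show ?case
      using add hom(3) by simp
  qed
qed

lemma compose_extend_data:
  assumes A: "superalgebra A" and B: "superalgebra B" and \<phi>: "\<phi> \<in> salg_hom A B"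
    and V: "\<And>m. m \<in> P \<Longrightarrow> V m \<in> carrier A" and W: "\<And>m. m \<in> Q \<Longrightarrow> W m \<in> carrier A"
  shows "compose (carrier (spoly_alg P Q)) \<phi> (extend_data P Q A V W) =
    extend_data P Q B (\<lambda>m. \<phi> (V m)) (\<lambda>m. \<phi> (W m))"
  unfolding compose_def extend_data_def
proof (rule restrict_ext)
  fix f assume f: "f \<in> carrier (spoly_alg P Q)"
  then have k: "keys (fst f) \<subseteq> P" "keys (snd f) \<subseteq> Q"
    by (auto simp: spoly_alg_def)
  have "lin_ext A V (fst f) \<in> carrier A" "lin_ext A W (snd f) \<in> carrier A"
    using k V W by (auto intro!: lin_ext_closed[OF A])
  then show "\<phi> ((\<lambda>f\<in>carrier (spoly_alg P Q). lin_ext A V (fst f) \<oplus>\<^bsub>A\<^esub> lin_ext A W (snd f)) f) =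
      lin_ext B (\<lambda>m. \<phi> (V m)) (fst f) \<oplus>\<^bsub>B\<^esub> lin_ext B (\<lambda>m. \<phi> (W m)) (snd f)"
    using f k lin_ext_hom[OF A B \<phi>, where S = P and V = V] lin_ext_hom[OF A B \<phi>, where S = Q and V = W] V W
    by (simp add: salg_homD(3)[OF \<phi>])
qed

section \<open>The product of points and the action on a closed point\<close>

text \<open>Lets a closed point, being a homomorphism to \<complex>, be treated like any other
  point.\<close>

lemma superalgebra_complex: "superalgebra complex_salg"
proof -
  have neg_ex: "\<exists>y. y + x = 0" for x :: complex
    by (rule exI[of _ "- x"]) simp
  have group: "abelian_group complex_salg"
    using neg_ex by (intro abelian_groupI) (auto simp: complex_salg_def algebra_simps)
  have ring: "ring complex_salg"
    by (intro ringI group monoid.intro) (auto simp: complex_salg_def algebra_simps)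
  have module: "module complex_ring complex_salg"
    by (intro moduleI group cring_from_type_algebra)
      (auto simp: complex_salg_def algebra_simps ring_of_type_algebra_def)
  interpret module complex_ring complex_salg by (rule module)
  have neg: "\<ominus>\<^bsub>complex_salg\<^esub> x = - x" for x
    using M.minus_equality[of "- x" x] by (simp add: complex_salg_def)
  have "submodule UNIV complex_ring complex_salg"
    by (rule submoduleI) (auto simp: neg, auto simp: complex_salg_def)
  moreover have "submodule {0} complex_ring complex_salg"
    by (rule submoduleI) (auto simp: neg, auto simp: complex_salg_def)
  moreover have "even_part complex_salg = UNIV" "odd_part complex_salg = {0}"
    by (simp_all add: complex_salg_def)
  ultimately show ?thesis
    using ring module by (auto simp: superalgebra_def superalgebra_axioms_def neg) (auto simp: complex_salg_def)
qed

lemma salg_hom_compose: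
  assumes "g \<in> salg_hom R A" "\<phi> \<in> salg_hom A B"
    and R: "\<And>x y. x \<in> carrier R \<Longrightarrow> y \<in> carrier R \<Longrightarrow> x \<otimes>\<^bsub>R\<^esub> y \<in> carrier R \<and> x \<oplus>\<^bsub>R\<^esub> y \<in> carrier R"
      "\<one>\<^bsub>R\<^esub> \<in> carrier R" "\<And>z x. x \<in> carrier R \<Longrightarrow> z \<odot>\<^bsub>R\<^esub> x \<in> carrier R"
      "even_part R \<subseteq> carrier R" "odd_part R \<subseteq> carrier R"
  shows "compose (carrier R) \<phi> g \<in> salg_hom R B"
  using R salg_homD[OF assms(1)] salg_homD[OF assms(2)]
  unfolding salg_hom_def by (auto simp: compose_def subset_iff intro!: ring_hom_memI)

section \<open>Additive maps of exponents and the maps of points they induce\<close>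

definition add_map :: "'m::comm_monoid_add set \<Rightarrow> 'k::comm_monoid_add set \<Rightarrow> ('m \<Rightarrow> 'k) \<Rightarrow> bool" where
  "add_map P Q f \<longleftrightarrow> f \<in> P \<rightarrow> Q \<and> f 0 = 0 \<and> (\<forall>m\<in>P. \<forall>l\<in>P. f (m + l) = f m + f l)"

lemma add_mapD:
  assumes "add_map P Q f"
  shows "m \<in> P \<Longrightarrow> f m \<in> Q" "f 0 = 0" "m \<in> P \<Longrightarrow> l \<in> P \<Longrightarrow> f (m + l) = f m + f l"
  using assms by (auto simp: add_map_def)

text \<open>Composition of a point with the algebra map sending the monomial of \<open>m\<close> to
  that of \<open>f m\<close> and fixing \<xi>, that is, its image under the homomorphism of tori
  dual to \<open>f\<close>. An empty \<open>Q\<close> also forgets the value at \<xi>.\<close>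

definition pull ::
  "'m::comm_monoid_add set \<Rightarrow> 'm set \<Rightarrow> ('m \<Rightarrow> 'k::comm_monoid_add) \<Rightarrow> 'u superalgebra \<Rightarrow> ('k spoly \<Rightarrow> 'u) \<Rightarrow> ('m spoly \<Rightarrow> 'u)" where
  "pull P Q f A g = extend_data P Q A (\<lambda>m. g (monomial (f m))) (\<lambda>m. g (monomial_xi (f m)))"

context
  fixes A :: "'u superalgebra" (structure)
  assumes A: "superalgebra A"
begin

interpretation ring A
  by (rule superalgebra.axioms(1)[OF A])

lemma smult_cancel:
  assumes "z \<odot> x = z \<odot> y" "z \<noteq> 0" "x \<in> carrier A" "y \<in> carrier A"
  shows "x = y"
proof -
  have "(inverse z * z) \<odot> x = (inverse z * z) \<odot> y"
    using assms(1,3,4) by (simp only: smult_smult[OF A])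
  then show ?thesis using assms(2-4) by (simp add: one_smult[OF A])
qed

lemma unit_map_salg_hom: "(\<lambda>z. z \<odot> \<one>) \<in> salg_hom complex_salg A"
proof -
  have "(\<lambda>z. z \<odot> \<one>) \<in> ring_hom complex_salg A"
  proof (rule ring_hom_memI)
    fix z w assume "z \<in> carrier complex_salg" "w \<in> carrier complex_salg"
    show "(z \<otimes>\<^bsub>complex_salg\<^esub> w) \<odot> \<one> = (z \<odot> \<one>) \<otimes> (w \<odot> \<one>)"
      by (simp add: complex_salg_def smult_smult[OF A] superalgebra.smult_mult_left[OF A] salg_smult_closed[OF A])
    show "(z \<oplus>\<^bsub>complex_salg\<^esub> w) \<odot> \<one> = (z \<odot> \<one>) \<oplus> (w \<odot> \<one>)"
      by (simp add: complex_salg_def smult_add_left[OF A])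
  qed (auto simp: complex_salg_def one_smult[OF A] salg_smult_closed[OF A])
  then show ?thesis
    using smult_even[OF A superalgebra.one_even[OF A]] zero_smult[OF A one_closed] zero_odd[OF A]
    by (auto simp: salg_hom_def complex_salg_def smult_smult[OF A] extensional_def)
qed

lemma salg_hom_pull:
  assumes PQ: "exponents P Q" and QP: "Q \<subseteq> P" and M: "exponents M M" and f: "add_map P M f"
    and g: "g \<in> salg_hom (spoly_alg M M) A"
  shows "pull P Q f A g \<in> salg_hom (spoly_alg P Q) A"
  unfolding pull_def
proof (rule extend_data_salg_hom[OF A PQ], rule char_dataI)
  note d = char_dataD[OF salg_hom_char_data[OF A M g]] and f = add_mapD[OF f]
  show "g (monomial (f m)) \<in> even_part A" if "m \<in> P" for m using d(1) f(1) that by auto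
  show "g (monomial_xi (f m)) \<in> odd_part A" if "m \<in> Q" for m using d(2) f(1) that QP by auto
  show "g (monomial (f 0)) = \<one>" using d(3) f(2) by simp
  show "g (monomial (f (m + l))) = g (monomial (f m)) \<otimes> g (monomial (f l))" if "m \<in> P" "l \<in> P" for m l
    using d(4)[of "f m" "f l"] f that by simp
  show "g (monomial_xi (f (m + l))) = g (monomial (f m)) \<otimes> g (monomial_xi (f l))" if "m \<in> P" "l \<in> Q" for m l
    using d(5)[of "f m" "f l"] f that QP by auto
  show "g (monomial_xi (f m)) \<otimes> g (monomial_xi (f l)) = \<zero>" if "m \<in> Q" "l \<in> Q" for m l
    using d(6)[of "f m" "f l"] f that QP by auto
qed

lemma salg_hom_monomial:
  assumes "exponents P Q" "g \<in> salg_hom (spoly_alg P Q) A"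
  shows "m \<in> P \<Longrightarrow> g (monomial m) \<in> carrier A" "m \<in> Q \<Longrightarrow> g (monomial_xi m) \<in> carrier A"
  using char_dataD(1,2)[OF salg_hom_char_data[OF A assms]] even_carrier[OF A] odd_carrier[OF A] by blast+

lemma salg_hom_eqI:
  assumes "exponents P Q" "g \<in> salg_hom (spoly_alg P Q) A" "h \<in> salg_hom (spoly_alg P Q) A"
    "\<And>m. m \<in> P \<Longrightarrow> g (monomial m) = h (monomial m)" "\<And>m. m \<in> Q \<Longrightarrow> g (monomial_xi m) = h (monomial_xi m)"
  shows "g = h"
proof -
  have "extend_data P Q A (\<lambda>m. g (monomial m)) (\<lambda>m. g (monomial_xi m)) =
    extend_data P Q A (\<lambda>m. h (monomial m)) (\<lambda>m. h (monomial_xi m))"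
    by (rule extend_data_cong[OF A]) (use assms salg_hom_monomial in auto)
  then show ?thesis
    using salg_hom_eq_extend_data[OF A assms(1)] assms(2,3) by metis
qed

lemma pull_monomial:
  assumes M: "exponents M M" and f: "add_map P M f" and g: "g \<in> salg_hom (spoly_alg M M) A"
  shows "m \<in> P \<Longrightarrow> pull P Q f A g (monomial m) = g (monomial (f m))"
    "m \<in> Q \<Longrightarrow> Q \<subseteq> P \<Longrightarrow> pull P Q f A g (monomial_xi m) = g (monomial_xi (f m))"
  unfolding pull_def
  using salg_hom_monomial[OF M g] add_mapD(1)[OF f]
  by (auto intro!: extend_data_monomial[OF A] extend_data_monomial_xi[OF A])

lemma salg_hom_inverse:
  assumes M: "exponents M M" and g: "g \<in> salg_hom (spoly_alg M M) A" and m: "m \<in> M" "- m \<in> M"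
  shows "g (monomial (m::'m::ab_group_add)) \<otimes> g (monomial (- m)) = \<one>"
  using char_dataD(3)[OF salg_hom_char_data[OF A M g]] char_dataD(4)[OF salg_hom_char_data[OF A M g] m] by simp

lemma salg_hom_xi:
  assumes M: "exponents M M" and g: "g \<in> salg_hom (spoly_alg M M) A" and m: "m \<in> M"
  shows "g (monomial_xi m) = g (monomial m) \<otimes> g (monomial_xi 0)"
  using char_dataD(5)[OF salg_hom_char_data[OF A M g] m exponentsD(1)[OF M]] by simp

lemma act_monomial:
  fixes c :: "'m::comm_monoid_add \<Rightarrow> complex"
  assumes M: "exponents M M" and g: "g \<in> salg_hom (spoly_alg M M) A" and h: "h \<in> salg_hom (spoly_alg M M) A"
    and m: "m \<in> M"
  shows "act (carrier (spoly_alg M M)) c A g h (monomial m) =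
      g (monomial m) \<otimes> h (monomial m) \<oplus> c m \<odot> (g (monomial_xi m) \<otimes> h (monomial_xi m))"
    and "act (carrier (spoly_alg M M)) c A g h (monomial_xi m) =
      g (monomial_xi m) \<otimes> h (monomial m) \<oplus> g (monomial m) \<otimes> h (monomial_xi m)"
  using salg_hom_monomial[OF M g m] salg_hom_monomial[OF M h m] m
  by (auto simp: act_eq_extend_data extend_data_monomial[OF A] extend_data_monomial_xi[OF A]
      salg_smult_closed[OF A] zero_smult[OF A])

text \<open>Multiplicativity of the comultiplication. In the even part the two terms linear in
  \<open>c\<close> produce the same odd-odd product, which is why \<open>c\<close> must be additive,
  and the term quadratic in \<open>c\<close> contains products of two odd values of one point, which
  vanish.\<close>

lemma act_salg_hom:
  fixes c :: "'m::comm_monoid_add \<Rightarrow> complex"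
  assumes M: "exponents M M" and g: "g \<in> salg_hom (spoly_alg M M) A" and h: "h \<in> salg_hom (spoly_alg M M) A"
    and c0: "c 0 = 0" and c_add: "\<And>m l. m \<in> M \<Longrightarrow> l \<in> M \<Longrightarrow> c (m + l) = c m + c l"
  shows "act (carrier (spoly_alg M M)) c A g h \<in> salg_hom (spoly_alg M M) A"
proof -
  note dg = char_dataD[OF salg_hom_char_data[OF A M g]] and dh = char_dataD[OF salg_hom_char_data[OF A M h]]
  note M_add = exponentsD(2)[OF M]
  define t x t' x' where "t m = g (monomial m)" and "x m = g (monomial_xi m)"
    and "t' m = h (monomial m)" and "x' m = h (monomial_xi m)" for m
  have ev: "t m \<in> even_part A" "t' m \<in> even_part A" and od: "x m \<in> odd_part A" "x' m \<in> odd_part A" if "m \<in> M" for m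
    using dg(1,2) dh(1,2) that by (auto simp: t_def x_def t'_def x'_def)
  have cl [simp]: "t m \<in> carrier A" "t' m \<in> carrier A" "x m \<in> carrier A" "x' m \<in> carrier A" if "m \<in> M" for m
    using ev od that even_carrier[OF A] odd_carrier[OF A] by auto
  have smcl [simp]: "z \<odot> y \<in> carrier A" if "y \<in> carrier A" for y and z :: complex
    using that by (rule salg_smult_closed[OF A])
  have tt: "t (m + l) = t m \<otimes> t l" "t' (m + l) = t' m \<otimes> t' l" "x (m + l) = t m \<otimes> x l" "x' (m + l) = t' m \<otimes> x' l"
    if "m \<in> M" "l \<in> M" for m l
    using that dg(4,5) dh(4,5) by (auto simp: t_def x_def t'_def x'_def)
  have xx: "x m \<otimes> x l = \<zero>" "x' m \<otimes> x' l = \<zero>" if "m \<in> M" "l \<in> M" for m l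
    using that dg(6) dh(6) by (auto simp: x_def x'_def)
  have comm: "y \<otimes> w = w \<otimes> y" if "y \<in> even_part A" "w \<in> carrier A" for y w
    using superalgebra.even_central[OF A that] .
  have anti: "x' m \<otimes> x l = \<ominus> (x l \<otimes> x' m)" if "m \<in> M" "l \<in> M" for m l
    using superalgebra.odd_anticommute[OF A od(2)[OF that(1)] od(1)[OF that(2)]] .
  \<comment> \<open>Interchange of the middle factors; \<open>swap4'\<close> is the version for two
    odd middle factors, where the sign appears.\<close>
  have swap4: "(a1 \<otimes> b1) \<otimes> (a2 \<otimes> b2) = (a1 \<otimes> a2) \<otimes> (b1 \<otimes> b2)"
    if "a1 \<in> carrier A" "b1 \<in> carrier A" "a2 \<in> carrier A" "b2 \<in> carrier A" "b1 \<otimes> a2 = a2 \<otimes> b1" for a1 b1 a2 b2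
  proof -
    have "(a1 \<otimes> b1) \<otimes> (a2 \<otimes> b2) = a1 \<otimes> (b1 \<otimes> a2) \<otimes> b2" using that(1-4) by (simp add: m_assoc)
    also have "\<dots> = (a1 \<otimes> a2) \<otimes> (b1 \<otimes> b2)" unfolding that(5) using that(1-4) by (simp add: m_assoc)
    finally show ?thesis .
  qed
  have swap4': "(a1 \<otimes> b1) \<otimes> (a2 \<otimes> b2) = \<ominus> ((a1 \<otimes> a2) \<otimes> (b1 \<otimes> b2))"
    if "a1 \<in> carrier A" "b1 \<in> carrier A" "a2 \<in> carrier A" "b2 \<in> carrier A" "b1 \<otimes> a2 = \<ominus> (a2 \<otimes> b1)" for a1 b1 a2 b2
  proof -
    have "(a1 \<otimes> b1) \<otimes> (a2 \<otimes> b2) = a1 \<otimes> (b1 \<otimes> a2) \<otimes> b2" using that(1-4) by (simp add: m_assoc)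
    also have "\<dots> = \<ominus> ((a1 \<otimes> a2) \<otimes> (b1 \<otimes> b2))" unfolding that(5) using that(1-4) by (simp add: m_assoc l_minus r_minus)
    finally show ?thesis .
  qed
  define V W where "V m = t m \<otimes> t' m \<oplus> c m \<odot> (x m \<otimes> x' m)" and "W m = x m \<otimes> t' m \<oplus> t m \<otimes> x' m" for m
  have V: "V m \<otimes> (a \<otimes> b) = (t m \<otimes> a) \<otimes> (t' m \<otimes> b) \<oplus> c m \<odot> ((x m \<otimes> x' m) \<otimes> (a \<otimes> b))"
    if "m \<in> M" "a \<in> carrier A" "b \<in> carrier A" for m a b
    using that comm[OF ev(2)[of m], of a]
    by (simp add: V_def l_distr swap4 superalgebra.smult_mult_left[OF A])
  have "char_data M M A V W"
  proof (rule char_dataI)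
    show "V m \<in> even_part A" if "m \<in> M" for m
      unfolding V_def using ev[OF that] od[OF that]
      by (intro add_even[OF A] smult_even[OF A] superalgebra.even_even[OF A] superalgebra.odd_odd[OF A])
    show "W m \<in> odd_part A" if "m \<in> M" for m
      unfolding W_def using superalgebra.even_odd[OF A ev(2)[OF that] od(1)[OF that]]
        comm[OF ev(2)[OF that] cl(3)[OF that]] superalgebra.even_odd[OF A ev(1)[OF that] od(2)[OF that]]
      by (intro add_odd[OF A]) auto
    show "V 0 = \<one>"
      using dg(3) dh(3) cl(3,4)[OF exponentsD(1)[OF M]]
      by (simp add: V_def c0 t_def t'_def zero_smult[OF A])
  next
    fix m l assume ml: "m \<in> M" "l \<in> M"
    have lm: "x (m + l) = t l \<otimes> x m" "x' (m + l) = t' l \<otimes> x' m"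
      using tt(3,4)[OF ml(2,1)] by (simp_all add: add.commute)
    have 1: "V m \<otimes> (t l \<otimes> t' l) = t (m + l) \<otimes> t' (m + l) \<oplus> c m \<odot> (x (m + l) \<otimes> x' (m + l))"
    proof -
      have "(x m \<otimes> x' m) \<otimes> (t l \<otimes> t' l) = (x m \<otimes> t l) \<otimes> (x' m \<otimes> t' l)"
        using ml comm[OF ev(1)[OF ml(2)] cl(4)[OF ml(1)]] by (intro swap4) auto
      also have "\<dots> = x (m + l) \<otimes> x' (m + l)"
        using ml comm[OF ev(1)[OF ml(2)] cl(3)[OF ml(1)]] comm[OF ev(2)[OF ml(2)] cl(4)[OF ml(1)]]
        by (simp add: lm)
      finally show ?thesis using V[OF ml(1), of "t l" "t' l"] ml by (simp add: tt)
    qed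
    have 2: "V m \<otimes> (x l \<otimes> x' l) = x (m + l) \<otimes> x' (m + l)"
    proof -
      have "(x m \<otimes> x' m) \<otimes> (x l \<otimes> x' l) = \<ominus> ((x m \<otimes> x l) \<otimes> (x' m \<otimes> x' l))"
        using ml anti by (intro swap4') auto
      also have "\<dots> = \<zero>" using ml xx by simp
      finally show ?thesis using V[OF ml(1), of "x l" "x' l"] ml by (simp add: tt smult_zero[OF A])
    qed
    have Vc: "V m \<in> carrier A" using ml by (simp add: V_def)
    have "V m \<otimes> V l = V m \<otimes> (t l \<otimes> t' l) \<oplus> c l \<odot> (V m \<otimes> (x l \<otimes> x' l))"
      using ml Vc unfolding V_def[of l] by (simp add: r_distr superalgebra.smult_mult_right[OF A])
    also have "\<dots> = t (m + l) \<otimes> t' (m + l) \<oplus> (c m + c l) \<odot> (x (m + l) \<otimes> x' (m + l))"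
      using ml M_add[OF ml] by (simp add: 1 2 smult_add_left[OF A] a_assoc)
    also have "\<dots> = V (m + l)" using ml c_add by (simp add: V_def)
    finally show "V (m + l) = V m \<otimes> V l" ..
    have 3: "V m \<otimes> (x l \<otimes> t' l) = x (m + l) \<otimes> t' (m + l)"
    proof -
      have "(x m \<otimes> x' m) \<otimes> (x l \<otimes> t' l) = \<ominus> ((x m \<otimes> x l) \<otimes> (x' m \<otimes> t' l))"
        using ml anti by (intro swap4') auto
      also have "\<dots> = \<zero>" using ml xx by simp
      finally show ?thesis using V[OF ml(1), of "x l" "t' l"] ml by (simp add: tt smult_zero[OF A])
    qed
    have 4: "V m \<otimes> (t l \<otimes> x' l) = t (m + l) \<otimes> x' (m + l)"
    proof -
      have "(x m \<otimes> x' m) \<otimes> (t l \<otimes> x' l) = (x m \<otimes> t l) \<otimes> (x' m \<otimes> x' l)"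
        using ml comm[OF ev(1)[OF ml(2)] cl(4)[OF ml(1)]] by (intro swap4) auto
      also have "\<dots> = \<zero>" using ml xx by simp
      finally show ?thesis using V[OF ml(1), of "t l" "x' l"] ml by (simp add: tt smult_zero[OF A])
    qed
    show "W (m + l) = V m \<otimes> W l"
      using ml Vc by (simp add: W_def r_distr 3 4)
    \<comment> \<open>Of the four terms of \<open>W m \<otimes> W l\<close>, two contain two odd
      values of the same point and vanish; the other two cancel by anticommutativity.\<close>
    have "x m \<otimes> t' m \<otimes> (x l \<otimes> t' l) = \<zero>" "t m \<otimes> x' m \<otimes> (t l \<otimes> x' l) = \<zero>"
      using ml swap4[of "x m" "t' m" "x l" "t' l"] swap4[of "t m" "x' m" "t l" "x' l"] xx
        comm[OF ev(2)[OF ml(1)] cl(3)[OF ml(2)]] comm[OF ev(1)[OF ml(2)] cl(4)[OF ml(1)]] by simp_all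
    moreover have "x m \<otimes> t' m \<otimes> (t l \<otimes> x' l) = x (m + l) \<otimes> x' (m + l)"
      using ml swap4[of "x m" "t' m" "t l" "x' l"] comm[OF ev(2)[OF ml(1)] cl(1)[OF ml(2)]]
        comm[OF ev(1)[OF ml(2)] cl(3)[OF ml(1)]] lm(1) tt(4) by simp
    moreover have "t m \<otimes> x' m \<otimes> (x l \<otimes> t' l) = \<ominus> (x (m + l) \<otimes> x' (m + l))"
      using ml swap4'[of "t m" "x' m" "x l" "t' l"] anti
        comm[OF ev(2)[OF ml(2)] cl(4)[OF ml(1)]] lm(2) tt(3) by simp
    ultimately show "W m \<otimes> W l = \<zero>"
      using ml M_add[OF ml] by (simp add: W_def r_distr l_distr r_neg l_neg)
  qed
  from extend_data_salg_hom[OF A M this]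
  have "extend_data M M A V W \<in> salg_hom (spoly_alg M M) A" .
  moreover have "act (carrier (spoly_alg M M)) c A g h = extend_data M M A V W"
    unfolding act_eq_extend_data
    by (rule extend_data_cong[OF A])
      (auto simp: V_def W_def t_def[symmetric] t'_def[symmetric] x_def[symmetric] x'_def[symmetric] zero_smult[OF A])
  ultimately show ?thesis by simp
qed

end

lemma spoly_alg_closed:
  fixes P Q :: "'m::comm_monoid_add set"
  assumes "exponents P Q"
  shows "x \<in> carrier (spoly_alg P Q) \<Longrightarrow> y \<in> carrier (spoly_alg P Q) \<Longrightarrow>
      x \<otimes>\<^bsub>spoly_alg P Q\<^esub> y \<in> carrier (spoly_alg P Q) \<and> x \<oplus>\<^bsub>spoly_alg P Q\<^esub> y \<in> carrier (spoly_alg P Q)"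
    and "\<one>\<^bsub>spoly_alg P Q\<^esub> \<in> carrier (spoly_alg P Q)"
    and "x \<in> carrier (spoly_alg P Q) \<Longrightarrow> z \<odot>\<^bsub>spoly_alg P Q\<^esub> x \<in> carrier (spoly_alg P Q)"
proof -
  have add: "keys (f + g) \<subseteq> U" if "keys f \<subseteq> U" "keys g \<subseteq> U" for f g :: "'m \<Rightarrow>\<^sub>0 complex" and U
    using Poly_Mapping.keys_add[of f g] that by blast
  have mult: "keys (f * g) \<subseteq> U3"
    if "keys f \<subseteq> U1" "keys g \<subseteq> U2" "\<And>a b. a \<in> U1 \<Longrightarrow> b \<in> U2 \<Longrightarrow> a + b \<in> U3"
    for f g :: "'m \<Rightarrow>\<^sub>0 complex" and U1 U2 U3
    using keys_mult[of f g] that by blast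
  note e = exponentsD[OF assms]
  have scale: "keys (Poly_Mapping.single 0 z * f) \<subseteq> U" if "keys f \<subseteq> U" for f :: "'m \<Rightarrow>\<^sub>0 complex" and U
    by (rule mult[of _ "{0}" _ U]) (use that in auto)
  show "x \<otimes>\<^bsub>spoly_alg P Q\<^esub> y \<in> carrier (spoly_alg P Q) \<and> x \<oplus>\<^bsub>spoly_alg P Q\<^esub> y \<in> carrier (spoly_alg P Q)"
    if xy: "x \<in> carrier (spoly_alg P Q)" "y \<in> carrier (spoly_alg P Q)"
  proof -
    obtain f g f' g' where x: "x = (f, g)" and y: "y = (f', g')" by (cases x, cases y)
    have k: "keys f \<subseteq> P" "keys g \<subseteq> Q" "keys f' \<subseteq> P" "keys g' \<subseteq> Q"
      using xy by (auto simp: x y spoly_alg_def)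
    have "keys (f * f') \<subseteq> P" by (rule mult[OF k(1,3) e(2)])
    moreover have "keys (f * g' + g * f') \<subseteq> Q"
      by (rule add, rule mult[OF k(1,4) e(3)], assumption+, rule mult[OF k(2,3)]) (metis add.commute e(3))
    ultimately show ?thesis using k add by (simp add: x y spoly_alg_def)
  qed
  show "\<one>\<^bsub>spoly_alg P Q\<^esub> \<in> carrier (spoly_alg P Q)" using e(1) by (auto simp: spoly_alg_def)
  show "z \<odot>\<^bsub>spoly_alg P Q\<^esub> x \<in> carrier (spoly_alg P Q)" if "x \<in> carrier (spoly_alg P Q)"
    using that scale by (auto simp: spoly_alg_def)
qed

lemma salg_hom_compose_spoly:
  assumes "exponents P Q" "g \<in> salg_hom (spoly_alg P Q) A" "\<phi> \<in> salg_hom A B"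
  shows "compose (carrier (spoly_alg P Q)) \<phi> g \<in> salg_hom (spoly_alg P Q) B"
  by (rule salg_hom_compose[OF assms(2,3)])
    (use spoly_alg_closed[OF assms(1)] in \<open>auto simp: spoly_alg_def\<close>)

lemma compose_pull:
  assumes A: "superalgebra A" and B: "superalgebra B" and \<phi>: "\<phi> \<in> salg_hom A B"
    and M: "exponents M M" and f: "add_map P M f" and QP: "Q \<subseteq> P" and g: "g \<in> salg_hom (spoly_alg M M) A"
  shows "compose (carrier (spoly_alg P Q)) \<phi> (pull P Q f A g) = pull P Q f B (compose (carrier (spoly_alg M M)) \<phi> g)"
proof -
  note gc = salg_hom_monomial[OF A M g] and fM = add_mapD(1)[OF f]
  have "compose (carrier (spoly_alg P Q)) \<phi> (pull P Q f A g) =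
      extend_data P Q B (\<lambda>m. \<phi> (g (monomial (f m)))) (\<lambda>m. \<phi> (g (monomial_xi (f m))))"
    unfolding pull_def by (rule compose_extend_data[OF A B \<phi>]) (use gc fM QP in auto)
  also have "\<dots> = pull P Q f B (compose (carrier (spoly_alg M M)) \<phi> g)"
    unfolding pull_def
    by (rule extend_data_cong[OF B]) (use gc fM QP salg_homD(1)[OF \<phi>] in \<open>auto simp: compose_def\<close>)
  finally show ?thesis .
qed

text \<open>At an exponent in \<open>P - Q\<close> the smaller algebra has no odd monomial to carry
  the deformation term, so that term has to vanish. This happens either because \<open>c\<close> is
  zero at \<open>f m\<close> (orbit) or because the odd values are zero (stabilizer). For
  \<open>P = Q\<close> the condition is void.\<close>

lemma pull_act:
  assumes A: "superalgebra A" and M: "exponents M M" and f: "add_map P M f" and QP: "Q \<subseteq> P"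
    and g: "g \<in> salg_hom (spoly_alg M M) A" and h: "h \<in> salg_hom (spoly_alg M M) A"
    and c': "\<And>m. m \<in> Q \<Longrightarrow> c' m = c (f m)" "\<And>m. m \<in> P - Q \<Longrightarrow> c' m = 0"
    and vanish: "\<And>m. m \<in> P - Q \<Longrightarrow> c (f m) \<odot>\<^bsub>A\<^esub> (g (monomial_xi (f m)) \<otimes>\<^bsub>A\<^esub> h (monomial_xi (f m))) = \<zero>\<^bsub>A\<^esub>"
  shows "pull P Q f A (act (carrier (spoly_alg M M)) c A g h) =
    act (carrier (spoly_alg P Q)) c' A (pull P Q f A g) (pull P Q f A h)"
proof -
  interpret ring A by (rule superalgebra.axioms(1)[OF A])
  note gc = salg_hom_monomial[OF A M g] and hc = salg_hom_monomial[OF A M h] and fM = add_mapD(1)[OF f]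
  note pg = pull_monomial[OF A M f g, of _ Q] and ph = pull_monomial[OF A M f h, of _ Q]
  have even: "act (carrier (spoly_alg M M)) c A g h (monomial (f m)) =
      pull P Q f A g (monomial m) \<otimes>\<^bsub>A\<^esub> pull P Q f A h (monomial m) \<oplus>\<^bsub>A\<^esub>
        (if c' m = 0 then \<zero>\<^bsub>A\<^esub>
         else c' m \<odot>\<^bsub>A\<^esub> (pull P Q f A g (monomial_xi m) \<otimes>\<^bsub>A\<^esub> pull P Q f A h (monomial_xi m)))"
    if "m \<in> P" for m
  proof (cases "m \<in> Q")
    case True
    then show ?thesis
      using that c'(1) act_monomial(1)[OF A M g h fM, of m c] pg ph gc hc fM QP
      by (auto simp: zero_smult[OF A])
  next
    case False
    then show ?thesis
      using that c'(2)[of m] vanish[of m] act_monomial(1)[OF A M g h fM, of m c] pg ph by auto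
  qed
  have odd: "act (carrier (spoly_alg M M)) c A g h (monomial_xi (f m)) =
      pull P Q f A g (monomial_xi m) \<otimes>\<^bsub>A\<^esub> pull P Q f A h (monomial m) \<oplus>\<^bsub>A\<^esub>
        pull P Q f A g (monomial m) \<otimes>\<^bsub>A\<^esub> pull P Q f A h (monomial_xi m)"
    if "m \<in> Q" for m
    using that act_monomial(2)[OF A M g h fM, of m c] pg ph QP by auto
  have clo: "act (carrier (spoly_alg M M)) c A g h (monomial (f m)) \<in> carrier A"
    "act (carrier (spoly_alg M M)) c A g h (monomial_xi (f m)) \<in> carrier A" if "m \<in> P" for m
    using act_monomial[OF A M g h fM[OF that], of c] gc[OF fM[OF that]] hc[OF fM[OF that]]
    by (auto simp: salg_smult_closed[OF A])
  show ?thesis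
    unfolding act_eq_extend_data[of P Q] pull_def[of P Q f A "act (carrier (spoly_alg M M)) c A g h"]
    by (rule extend_data_cong[OF A]) (use even odd clo QP in \<open>force+\<close>)
qed

text \<open>\<open>M\<close> is the dual lattice, \<open>S\<close> and \<open>T\<close> are the exponents of the even and the odd monomials of \<open>X\<close>,
  and \<open>R\<close> stands for \<open>M \<inter> \<sigma>\<^sup>\<bottom>\<close>. The assumption \<open>c_T\<close> is what makes the coaction of the supertorus on
  \<open>X\<close> well defined.\<close>

locale point_action =
  fixes M S T R :: "'m::ab_group_add set" and c :: "'m \<Rightarrow> complex" and pt :: "'m spoly \<Rightarrow> complex"
  assumes M_zero: "0 \<in> M" and M_add: "\<And>m l. m \<in> M \<Longrightarrow> l \<in> M \<Longrightarrow> m + l \<in> M"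
    and M_neg: "\<And>m. m \<in> M \<Longrightarrow> - m \<in> M"
    and ST: "exponents S T" and S_M: "S \<subseteq> M" and T_S: "T \<subseteq> S"
    and c_zero: "c 0 = 0" and c_add: "\<And>m l. m \<in> M \<Longrightarrow> l \<in> M \<Longrightarrow> c (m + l) = c m + c l"
    and c_T: "\<And>m. m \<in> S \<Longrightarrow> c m \<noteq> 0 \<Longrightarrow> m \<in> T"
    and pt: "pt \<in> salg_hom (spoly_alg S T) complex_salg"
    and R_M: "R \<subseteq> M" and R_diff: "\<And>v. v \<in> R \<Longrightarrow> \<exists>a\<in>S \<inter> R. \<exists>b\<in>S \<inter> R. a = v + b"
    and support: "\<And>m. m \<in> S \<Longrightarrow> pt (monomial m) \<noteq> 0 \<longleftrightarrow> m \<in> R"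
begin

lemma M: "exponents M M"
  using M_zero M_add by (auto simp: exponents_def)

text \<open>The orbit map of the closed point; its fibres decide both the stabilizer and the
  orbit.\<close>

definition move :: "'u superalgebra \<Rightarrow> ('m spoly \<Rightarrow> 'u) \<Rightarrow> ('m spoly \<Rightarrow> 'u)" where
  "move A g = act (carrier (spoly_alg S T)) c A g (base_change_point (spoly_alg S T) pt A)"

abbreviation pts where "pts A \<equiv> salg_hom (spoly_alg M M) A"
abbreviation mul where "mul A \<equiv> act (carrier (spoly_alg M M)) c A"

lemma pt_xi: "m \<in> T \<Longrightarrow> pt (monomial_xi m) = 0"
  using salg_homD(7)[OF pt monomial_xi_odd[of m T S]] by (simp add: complex_salg_def)

lemma base_change_eq:
  assumes A: "superalgebra A"
  shows "base_change_point (spoly_alg S T) pt A =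
    extend_data S T A (\<lambda>m. pt (monomial m) \<odot>\<^bsub>A\<^esub> \<one>\<^bsub>A\<^esub>) (\<lambda>_. \<zero>\<^bsub>A\<^esub>)"
proof -
  interpret ring A by (rule superalgebra.axioms(1)[OF A])
  have "base_change_point (spoly_alg S T) pt A = compose (carrier (spoly_alg S T)) (\<lambda>z. z \<odot>\<^bsub>A\<^esub> \<one>\<^bsub>A\<^esub>) pt"
    by (simp add: base_change_point_def compose_def)
  also have "\<dots> = compose (carrier (spoly_alg S T)) (\<lambda>z. z \<odot>\<^bsub>A\<^esub> \<one>\<^bsub>A\<^esub>)
      (extend_data S T complex_salg (\<lambda>m. pt (monomial m)) (\<lambda>m. pt (monomial_xi m)))"
    using salg_hom_eq_extend_data[OF superalgebra_complex ST pt] by simp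
  also have "\<dots> = extend_data S T A (\<lambda>m. pt (monomial m) \<odot>\<^bsub>A\<^esub> \<one>\<^bsub>A\<^esub>) (\<lambda>m. pt (monomial_xi m) \<odot>\<^bsub>A\<^esub> \<one>\<^bsub>A\<^esub>)"
    by (rule compose_extend_data[OF superalgebra_complex A unit_map_salg_hom[OF A]]) (auto simp: complex_salg_def)
  also have "\<dots> = extend_data S T A (\<lambda>m. pt (monomial m) \<odot>\<^bsub>A\<^esub> \<one>\<^bsub>A\<^esub>) (\<lambda>_. \<zero>\<^bsub>A\<^esub>)"
    by (rule extend_data_cong[OF A]) (auto simp: pt_xi zero_smult[OF A] salg_smult_closed[OF A])
  finally show ?thesis .
qed

lemma move_eq:
  assumes A: "superalgebra A" and g: "g \<in> pts A"
  shows "move A g = extend_data S T A (\<lambda>m. pt (monomial m) \<odot>\<^bsub>A\<^esub> g (monomial m)) (\<lambda>m. pt (monomial m) \<odot>\<^bsub>A\<^esub> g (monomial_xi m))"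
proof -
  interpret ring A by (rule superalgebra.axioms(1)[OF A])
  let ?b = "base_change_point (spoly_alg S T) pt A"
  have b: "?b (monomial m) = pt (monomial m) \<odot>\<^bsub>A\<^esub> \<one>\<^bsub>A\<^esub>" if "m \<in> S" for m
    using that by (simp add: base_change_eq[OF A] extend_data_monomial[OF A] salg_smult_closed[OF A])
  have bxi: "?b (monomial_xi m) = \<zero>\<^bsub>A\<^esub>" if "m \<in> T" for m
    using that by (simp add: base_change_eq[OF A] extend_data_monomial_xi[OF A])
  have gc: "g (monomial m) \<in> carrier A" "g (monomial_xi m) \<in> carrier A" if "m \<in> S" for m
    using salg_hom_monomial[OF A M g] that S_M by auto
  \<comment> \<open>Here \<open>c_T\<close> enters: if \<open>c m\<close> is nonzero then
    \<open>m \<in> T\<close>, so the base point is defined at the odd monomial of \<open>m\<close>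
    and vanishes there.\<close>
  show ?thesis
    unfolding move_def act_eq_extend_data
    by (rule extend_data_cong[OF A])
      (use gc T_S c_T in \<open>auto simp: b bxi superalgebra.smult_mult_right[OF A] salg_smult_closed[OF A] smult_zero[OF A] subset_iff\<close>)
qed

text \<open>Coordinates outside \<open>R\<close> carry the factor 0, and on \<open>R\<close> a
  nonzero complex factor cancels. Agreement on \<open>S \<inter> R\<close> extends to all of
  \<open>R\<close> because each element is a difference of two such exponents and characters take
  unit values.\<close>

lemma move_eq_iff:
  assumes A: "superalgebra A" and g: "g \<in> pts A" and h: "h \<in> pts A"
  shows "move A g = move A h \<longleftrightarrow>
    (\<forall>m\<in>R. g (monomial m) = h (monomial m)) \<and> (\<forall>m\<in>T \<inter> R. g (monomial_xi m) = h (monomial_xi m))"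
proof -
  interpret ring A by (rule superalgebra.axioms(1)[OF A])
  note gc = salg_hom_monomial[OF A M g] and hc = salg_hom_monomial[OF A M h]
  have scl: "pt (monomial m) \<odot>\<^bsub>A\<^esub> x = pt (monomial m) \<odot>\<^bsub>A\<^esub> y \<longleftrightarrow> (m \<in> R \<longrightarrow> x = y)"
    if "m \<in> S" "x \<in> carrier A" "y \<in> carrier A" for m x y
    using smult_cancel[OF A, of "pt (monomial m)" x y] that support[OF that(1)] by (auto simp: zero_smult[OF A])
  have "move A g = move A h \<longleftrightarrow>
     (\<forall>m\<in>S. pt (monomial m) \<odot>\<^bsub>A\<^esub> g (monomial m) = pt (monomial m) \<odot>\<^bsub>A\<^esub> h (monomial m)) \<and>
     (\<forall>m\<in>T. pt (monomial m) \<odot>\<^bsub>A\<^esub> g (monomial_xi m) = pt (monomial m) \<odot>\<^bsub>A\<^esub> h (monomial_xi m))"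
    unfolding move_eq[OF A g] move_eq[OF A h]
    by (rule extend_data_eq_iff[OF A]) (use gc hc S_M T_S in \<open>auto simp: salg_smult_closed[OF A] subset_iff\<close>)
  also have "\<dots> \<longleftrightarrow> (\<forall>m\<in>S \<inter> R. g (monomial m) = h (monomial m)) \<and>
      (\<forall>m\<in>T \<inter> R. g (monomial_xi m) = h (monomial_xi m))"
    using scl gc hc S_M T_S by (auto simp: subset_iff)
  also have "(\<forall>m\<in>S \<inter> R. g (monomial m) = h (monomial m)) \<longleftrightarrow> (\<forall>m\<in>R. g (monomial m) = h (monomial m))"
  proof
    assume eq: "\<forall>m\<in>S \<inter> R. g (monomial m) = h (monomial m)"
    show "\<forall>m\<in>R. g (monomial m) = h (monomial m)"
    proof
      fix v assume v: "v \<in> R"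
      then obtain a b where ab: "a \<in> S \<inter> R" "b \<in> S \<inter> R" "a = v + b" using R_diff by blast
      have vM: "v \<in> M" "b \<in> M" "- b \<in> M" using v ab R_M M_neg by auto
      have "g (monomial v) \<otimes>\<^bsub>A\<^esub> g (monomial b) = h (monomial v) \<otimes>\<^bsub>A\<^esub> g (monomial b)"
        using eq ab char_dataD(4)[OF salg_hom_char_data[OF A M g] vM(1,2)]
          char_dataD(4)[OF salg_hom_char_data[OF A M h] vM(1,2)] by auto
      then have "g (monomial v) \<otimes>\<^bsub>A\<^esub> g (monomial b) \<otimes>\<^bsub>A\<^esub> g (monomial (- b)) =
          h (monomial v) \<otimes>\<^bsub>A\<^esub> g (monomial b) \<otimes>\<^bsub>A\<^esub> g (monomial (- b))" by simp
      then show "g (monomial v) = h (monomial v)"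
        using gc vM hc salg_hom_inverse[OF A M g vM(2,3)] by (simp add: m_assoc)
    qed
  qed auto
  finally show ?thesis .
qed

lemma move_eq_iff_torus:
  assumes "superalgebra A" "g \<in> pts A" "h \<in> pts A" "T \<inter> R = {}"
  shows "move A g = move A h \<longleftrightarrow> (\<forall>m\<in>R. g (monomial m) = h (monomial m))"
  using move_eq_iff[OF assms(1-3)] assms(4) by auto

text \<open>A single \<open>l \<in> T \<inter> R\<close> suffices: dividing the odd coordinate at
  \<open>l\<close> by the unit value of the character recovers the image of \<xi>.\<close>

lemma move_eq_iff_supertorus:
  assumes A: "superalgebra A" and g: "g \<in> pts A" and h: "h \<in> pts A" and "T \<inter> R \<noteq> {}"
  shows "move A g = move A h \<longleftrightarrow>
    (\<forall>m\<in>R. g (monomial m) = h (monomial m)) \<and> g (monomial_xi 0) = h (monomial_xi 0)"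
proof -
  interpret ring A by (rule superalgebra.axioms(1)[OF A])
  obtain l where l: "l \<in> T" "l \<in> R" using assms(4) by auto
  have lM: "l \<in> M" "- l \<in> M" using l R_M M_neg by auto
  note gc = salg_hom_monomial[OF A M g] and hc = salg_hom_monomial[OF A M h]
  have "(\<forall>m\<in>T \<inter> R. g (monomial_xi m) = h (monomial_xi m)) \<longleftrightarrow> g (monomial_xi 0) = h (monomial_xi 0)"
    if eq: "\<forall>m\<in>R. g (monomial m) = h (monomial m)"
  proof
    assume "g (monomial_xi 0) = h (monomial_xi 0)"
    then show "\<forall>m\<in>T \<inter> R. g (monomial_xi m) = h (monomial_xi m)"
      using eq salg_hom_xi[OF A M g] salg_hom_xi[OF A M h] R_M by auto
  next
    assume "\<forall>m\<in>T \<inter> R. g (monomial_xi m) = h (monomial_xi m)"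
    then have "g (monomial l) \<otimes>\<^bsub>A\<^esub> g (monomial_xi 0) = g (monomial l) \<otimes>\<^bsub>A\<^esub> h (monomial_xi 0)"
      using eq l salg_hom_xi[OF A M g lM(1)] salg_hom_xi[OF A M h lM(1)] by auto
    then have "g (monomial (- l)) \<otimes>\<^bsub>A\<^esub> (g (monomial l) \<otimes>\<^bsub>A\<^esub> g (monomial_xi 0)) =
        g (monomial (- l)) \<otimes>\<^bsub>A\<^esub> (g (monomial l) \<otimes>\<^bsub>A\<^esub> h (monomial_xi 0))" by simp
    then show "g (monomial_xi 0) = h (monomial_xi 0)"
      using gc hc lM M_zero salg_hom_inverse[OF A M g lM(2)] by (simp flip: m_assoc)
  qed
  then show ?thesis using move_eq_iff[OF A g h] by blast
qed

text \<open>The neutral element as an extension of monomial values. It turns stabilizing the base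
  point into an instance of equality in the orbit.\<close>

definition unit_pt :: "'u superalgebra \<Rightarrow> ('m spoly \<Rightarrow> 'u)" where
  "unit_pt A = extend_data M M A (\<lambda>_. \<one>\<^bsub>A\<^esub>) (\<lambda>_. \<zero>\<^bsub>A\<^esub>)"

lemma unit_pt:
  assumes A: "superalgebra A"
  shows "unit_pt A \<in> pts A" "m \<in> M \<Longrightarrow> unit_pt A (monomial m) = \<one>\<^bsub>A\<^esub>" "m \<in> M \<Longrightarrow> unit_pt A (monomial_xi m) = \<zero>\<^bsub>A\<^esub>"
    and "move A (unit_pt A) = base_change_point (spoly_alg S T) pt A"
proof -
  interpret ring A by (rule superalgebra.axioms(1)[OF A])
  show 1: "unit_pt A \<in> pts A"
    unfolding unit_pt_def
    by (rule extend_data_salg_hom[OF A M], rule char_dataI) (auto simp: superalgebra.one_even[OF A] zero_odd[OF A])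
  show 2: "m \<in> M \<Longrightarrow> unit_pt A (monomial m) = \<one>\<^bsub>A\<^esub>" "m \<in> M \<Longrightarrow> unit_pt A (monomial_xi m) = \<zero>\<^bsub>A\<^esub>" for m
    by (auto simp: unit_pt_def extend_data_monomial[OF A] extend_data_monomial_xi[OF A])
  show "move A (unit_pt A) = base_change_point (spoly_alg S T) pt A"
    unfolding move_eq[OF A 1] base_change_eq[OF A]
    by (rule extend_data_cong[OF A]) (use 2 S_M T_S in \<open>auto simp: smult_zero[OF A] salg_smult_closed[OF A] subset_iff\<close>)
qed

text \<open>The suffix names the type of the stabilizer, which is opposite to that of the orbit: a
  supertorus stabilizer belongs to \<open>move_eq_iff_torus\<close>.\<close>

lemma stabilizer_iff_supertorus:
  assumes A: "superalgebra A" and g: "g \<in> pts A" and "T \<inter> R = {}"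
  shows "move A g = base_change_point (spoly_alg S T) pt A \<longleftrightarrow> (\<forall>m\<in>R. g (monomial m) = \<one>\<^bsub>A\<^esub>)"
  using move_eq_iff_torus[OF A g unit_pt(1)[OF A] assms(3)] unit_pt(2,4)[OF A] R_M by auto

lemma stabilizer_iff_torus:
  assumes A: "superalgebra A" and g: "g \<in> pts A" and "T \<inter> R \<noteq> {}"
  shows "move A g = base_change_point (spoly_alg S T) pt A \<longleftrightarrow>
    (\<forall>m\<in>R. g (monomial m) = \<one>\<^bsub>A\<^esub>) \<and> g (monomial_xi 0) = \<zero>\<^bsub>A\<^esub>"
  using move_eq_iff_supertorus[OF A g unit_pt(1)[OF A] assms(3)] unit_pt(2-4)[OF A] R_M M_zero by auto

lemma mul_closed: "superalgebra A \<Longrightarrow> g \<in> pts A \<Longrightarrow> h \<in> pts A \<Longrightarrow> mul A g h \<in> pts A"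
  using act_salg_hom[OF _ M _ _ c_zero c_add] by blast

lemma compose_closed: "g \<in> pts A \<Longrightarrow> \<phi> \<in> salg_hom A B \<Longrightarrow> compose (carrier (spoly_alg M M)) \<phi> g \<in> pts B"
  by (rule salg_hom_compose_spoly[OF M])

lemma move_natural:
  assumes A: "superalgebra A" and B: "superalgebra B" and \<phi>: "\<phi> \<in> salg_hom A B" and g: "g \<in> pts A"
  shows "compose (carrier (spoly_alg S T)) \<phi> (move A g) = move B (compose (carrier (spoly_alg M M)) \<phi> g)"
proof -
  note gc = salg_hom_monomial[OF A M g]
  have "compose (carrier (spoly_alg S T)) \<phi> (move A g) =
      extend_data S T B (\<lambda>m. \<phi> (pt (monomial m) \<odot>\<^bsub>A\<^esub> g (monomial m))) (\<lambda>m. \<phi> (pt (monomial m) \<odot>\<^bsub>A\<^esub> g (monomial_xi m)))"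
    unfolding move_eq[OF A g]
    by (rule compose_extend_data[OF A B \<phi>]) (use gc S_M T_S in \<open>auto simp: salg_smult_closed[OF A] subset_iff\<close>)
  also have "\<dots> = move B (compose (carrier (spoly_alg M M)) \<phi> g)"
    unfolding move_eq[OF B compose_closed[OF g \<phi>]]
    by (rule extend_data_cong[OF B])
      (use gc S_M T_S salg_homD(1,4)[OF \<phi>] in \<open>auto simp: compose_def salg_smult_closed[OF B] subset_iff\<close>)
  finally show ?thesis .
qed

end

text \<open>A point of the orbit is sent to the value of \<open>\<Phi>\<close> at an arbitrary group element that carries the
  base point to it.\<close>

lemma orbit_isoI:
  fixes \<Phi> :: "'u superalgebra \<Rightarrow> (('n \<Rightarrow> int) spoly \<Rightarrow> 'u) \<Rightarrow> ('y \<Rightarrow> 'u)"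
    and G :: "('y, 'u) group_functor" and N :: "('n, 'b) monoid_scheme" and c :: "('n \<Rightarrow> int) \<Rightarrow> complex"
    and R :: "('n \<Rightarrow> int) spoly superalgebra" and p :: "('n \<Rightarrow> int) spoly \<Rightarrow> complex"
  defines "pts \<equiv> \<lambda>A :: 'u superalgebra. salg_hom (supertorus_ring N) A"
    and "mv \<equiv> \<lambda>(A :: 'u superalgebra) g. act (carrier R) c A g (base_change_point R p A)"
    and "mul \<equiv> \<lambda>A :: 'u superalgebra. act (carrier (supertorus_ring N)) c A"
  assumes eq_iff: "\<And>A g h. superalgebra A \<Longrightarrow> g \<in> pts A \<Longrightarrow> h \<in> pts A \<Longrightarrow> mv A g = mv A h \<longleftrightarrow> \<Phi> A g = \<Phi> A h"
    and surj: "\<And>A. superalgebra A \<Longrightarrow> \<Phi> A ` pts A = carrier (points G A)"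
    and natural: "\<And>A B \<phi> g. superalgebra A \<Longrightarrow> superalgebra B \<Longrightarrow> \<phi> \<in> salg_hom A B \<Longrightarrow> g \<in> pts A \<Longrightarrow>
      \<Phi> B (compose (carrier (supertorus_ring N)) \<phi> g) = compose (coord_set G) \<phi> (\<Phi> A g)"
    and mv_natural: "\<And>A B \<phi> g. superalgebra A \<Longrightarrow> superalgebra B \<Longrightarrow> \<phi> \<in> salg_hom A B \<Longrightarrow> g \<in> pts A \<Longrightarrow>
      compose (carrier R) \<phi> (mv A g) = mv B (compose (carrier (supertorus_ring N)) \<phi> g)"
    and compose_closed: "\<And>A B \<phi> g. superalgebra A \<Longrightarrow> superalgebra B \<Longrightarrow> \<phi> \<in> salg_hom A B \<Longrightarrow> g \<in> pts A \<Longrightarrow>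
      compose (carrier (supertorus_ring N)) \<phi> g \<in> pts B"
    and mul_closed: "\<And>A g h. superalgebra A \<Longrightarrow> g \<in> pts A \<Longrightarrow> h \<in> pts A \<Longrightarrow> mul A g h \<in> pts A"
    and mult: "\<And>A g h. superalgebra A \<Longrightarrow> g \<in> pts A \<Longrightarrow> h \<in> pts A \<Longrightarrow>
      \<Phi> A (mul A g h) = \<Phi> A g \<otimes>\<^bsub>points G A\<^esub> \<Phi> A h"
  shows "orbit_iso N c R p G"
proof -
  define \<eta> where "\<eta> A y = \<Phi> A (SOME g. g \<in> pts A \<and> mv A g = y)" for A y
  have \<eta>: "\<eta> A (mv A g) = \<Phi> A g" if A: "superalgebra A" and g: "g \<in> pts A" for A g
  proof -
    have "(SOME h. h \<in> pts A \<and> mv A h = mv A g) \<in> pts A \<and> mv A (SOME h. h \<in> pts A \<and> mv A h = mv A g) = mv A g"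
      by (rule someI[of "\<lambda>h. h \<in> pts A \<and> mv A h = mv A g" g]) (use g in simp)
    then show ?thesis using eq_iff[OF A] g unfolding \<eta>_def by blast
  qed
  have orb: "orbit N c R p A = mv A ` pts A" for A :: "'u superalgebra"
    by (simp add: orbit_def mv_def pts_def supertorus_def)
  have pts: "carrier (points (supertorus N c) A) = pts A" and mul: "monoid.mult (points (supertorus N c) A) = mul A"
    for A :: "'u superalgebra"
    by (simp_all add: pts_def mul_def supertorus_def)
  show ?thesis
    unfolding orbit_iso_def
  proof (intro exI[of _ \<eta>] conjI allI impI; (elim conjE)?)
    fix A :: "'u superalgebra" assume A: "superalgebra A"
    show "bij_betw (\<eta> A) (orbit N c R p A) (carrier (points G A))"
      unfolding bij_betw_def inj_on_def orb
      using \<eta>[OF A] eq_iff[OF A] surj[OF A] by (auto simp: image_image cong: image_cong)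
  next
    fix A B :: "'u superalgebra" and \<phi> y
    assume *: "superalgebra A" "superalgebra B" "\<phi> \<in> salg_hom A B" "y \<in> orbit N c R p A"
    then obtain g where g: "g \<in> pts A" "y = mv A g" by (auto simp: orb)
    show "\<eta> B (compose (carrier R) \<phi> y) = compose (coord_set G) \<phi> (\<eta> A y)"
      using *(1-3) g by (simp add: mv_natural \<eta> compose_closed natural)
  next
    fix A :: "'u superalgebra" and g h
    assume *: "superalgebra A" "g \<in> carrier (points (supertorus N c) A)" "h \<in> carrier (points (supertorus N c) A)"
    then have gh: "g \<in> pts A" "h \<in> pts A" by (simp_all add: pts)
    show "\<eta> A (act (carrier R) c A (g \<otimes>\<^bsub>points (supertorus N c) A\<^esub> h) (base_change_point R p A)) =
        \<eta> A (act (carrier R) c A g (base_change_point R p A)) \<otimes>\<^bsub>points G A\<^esub>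
        \<eta> A (act (carrier R) c A h (base_change_point R p A))"
      using \<eta>[OF *(1) gh(1)] \<eta>[OF *(1) gh(2)] \<eta>[OF *(1) mul_closed[OF *(1) gh]] mult[OF *(1) gh]
      by (simp add: mul mv_def)
  qed
qed

section \<open>The sublattice and the quotient lattice of a face\<close>

text \<open>Pullback of functionals along \<open>h\<close>, cut off outside the carrier as
  \<open>dual\<close> requires. It serves for the inclusion of the sublattice, the quotient map, and
  the retraction onto the sublattice.\<close>

definition inflate :: "('n, 'b) monoid_scheme \<Rightarrow> ('n \<Rightarrow> 'p) \<Rightarrow> ('p \<Rightarrow> int) \<Rightarrow> 'n \<Rightarrow> int" where
  "inflate L h l = (\<lambda>x. if x \<in> carrier L then l (h x) else 0)"

lemma add_map_inflate:
  assumes "\<And>x. x \<in> carrier L \<Longrightarrow> h x \<in> carrier L'"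
    and "\<And>x y. x \<in> carrier L \<Longrightarrow> y \<in> carrier L \<Longrightarrow> x \<otimes>\<^bsub>L\<^esub> y \<in> carrier L"
    and "\<And>x y. x \<in> carrier L \<Longrightarrow> y \<in> carrier L \<Longrightarrow> h (x \<otimes>\<^bsub>L\<^esub> y) = h x \<otimes>\<^bsub>L'\<^esub> h y"
  shows "add_map (dual L') (dual L) (inflate L h)"
  unfolding add_map_def
proof (intro conjI ballI funcsetI)
  show "inflate L h l \<in> dual L" if "l \<in> dual L'" for l
    by (rule dualI) (use assms that in \<open>auto simp: inflate_def dual_mult\<close>)
qed (auto simp: inflate_def fun_eq_iff)

context toric_face
begin

abbreviation Nsub where "Nsub \<equiv> cone_sublattice N \<sigma>"
abbreviation Nquot where "Nquot \<equiv> cone_quotient N \<sigma>"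

lemma mult_Nsub [simp]: "monoid.mult Nsub = monoid.mult N"
  by (simp add: cone_sublattice_def subgroup_generated_def)

lemma K_subgroup: "subgroup K N"
  unfolding cone_sublattice_def by (rule subgroup_subgroup_generated)

lemma K_carrier: "x \<in> K \<Longrightarrow> x \<in> carrier N"
  by (simp add: cone_sublattice_carrier)

lemma K_normal: "K \<lhd> N"
  using K_subgroup by (rule subgroup_imp_normal)

abbreviation restrict_dual where "restrict_dual \<equiv> inflate Nsub (\<lambda>x. x)"
abbreviation coset_dual where "coset_dual \<equiv> inflate N (\<lambda>x. K #> x)"

lemma add_map_restrict: "add_map (dual N) (dual Nsub) restrict_dual"
  by (rule add_map_inflate) (use K_carrier subgroup.m_closed[OF K_subgroup] in auto)

lemma add_map_coset: "add_map (dual Nquot) (dual N) coset_dual"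
  by (rule add_map_inflate)
    (auto simp: cone_quotient_def carrier_FactGroup normal.rcos_sum[OF K_normal])

text \<open>The retraction exists because the sublattice is the common kernel of finitely many
  functionals. Dually it yields an additive section of the restriction of functionals.\<close>

lemma retraction:
  obtains h where "\<And>x. x \<in> carrier N \<Longrightarrow> h x \<in> K" "\<And>x. x \<in> K \<Longrightarrow> h x = x"
    "add_map (dual Nsub) (dual N) (inflate N h)"
proof -
  have J: "finite (m ` J)" "m ` J \<subseteq> dual N" using gens by (auto simp: J_def)
  obtain h where h: "h \<in> hom N N" "\<And>x l. x \<in> carrier N \<Longrightarrow> l \<in> m ` J \<Longrightarrow> l (h x) = 0"
    "\<And>x. x \<in> carrier N \<Longrightarrow> \<forall>l\<in>m ` J. l x = 0 \<Longrightarrow> h x = x"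
    using annihilator_retraction[OF N J] by metis
  have hK: "h x \<in> K" if "x \<in> carrier N" for x
    using h(1,2) that by (auto simp: cone_sublattice_carrier hom_def)
  have "add_map (dual Nsub) (dual N) (inflate N h)"
    by (rule add_map_inflate) (use hK h(1) in \<open>auto simp: hom_def\<close>)
  moreover have "h x = x" if "x \<in> K" for x
    using h(3)[of x] that by (auto simp: cone_sublattice_carrier)
  ultimately show thesis using that hK by blast
qed

lemma restrict_inflate:
  assumes "\<And>x. x \<in> K \<Longrightarrow> h x = x" "l \<in> dual Nsub"
  shows "restrict_dual (inflate N h l) = l"
  using assms dual_outside[OF assms(2)] K_carrier by (auto simp: inflate_def fun_eq_iff)

lemma inflate_restrict:
  assumes "\<And>x. x \<in> carrier N \<Longrightarrow> h x \<in> K" "\<And>x. x \<in> K \<Longrightarrow> h x = x"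
    "add_map (dual Nsub) (dual N) (inflate N h)" "l \<in> dual N"
  shows "l - inflate N h (restrict_dual l) \<in> annihilator N K"
proof -
  have "inflate N h (restrict_dual l) \<in> dual N"
    using add_mapD(1)[OF assms(3)] add_mapD(1)[OF add_map_restrict] assms(4) by blast
  then show ?thesis
    using assms K_carrier by (auto simp: annihilator_def inflate_def intro: dual_diff)
qed

lemma coset_dual_annihilator:
  assumes "l \<in> dual Nquot"
  shows "coset_dual l \<in> annihilator N K"
proof -
  have "l K = 0"
  proof -
    have "K \<in> carrier Nquot" "K \<otimes>\<^bsub>Nquot\<^esub> K = K"
      using subgroup.subgroup_in_rcosets[OF K_subgroup is_group] normal.rcosets_mult_eq[OF K_normal]
      by (auto simp: cone_quotient_def FactGroup_def)
    then show ?thesis using dual_mult[OF assms, of K K] by simp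
  qed
  moreover have "K #> x = K" if "x \<in> K" for x
    using coset_join2[OF K_carrier[OF that] K_subgroup that] .
  ultimately show ?thesis
    using add_mapD(1)[OF add_map_coset assms] K_carrier by (auto simp: annihilator_def inflate_def)
qed

lemma coset_dual_inj: "inj_on coset_dual (dual Nquot)"
proof (rule inj_onI)
  fix l l' assume l: "l \<in> dual Nquot" "l' \<in> dual Nquot" and eq: "coset_dual l = coset_dual l'"
  show "l = l'"
  proof (rule dual_eqI[OF l])
    fix C assume "C \<in> carrier Nquot"
    then obtain x where "x \<in> carrier N" "C = K #> x" by (auto simp: cone_quotient_def carrier_FactGroup)
    then show "l C = l' C" using fun_cong[OF eq, of x] by (simp add: inflate_def)
  qed
qed

lemma coset_dual_surj:
  assumes l: "l \<in> annihilator N K"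
  shows "l \<in> coset_dual ` dual Nquot"
proof -
  have lN: "l \<in> dual N" using l by (auto simp: annihilator_def)
  \<comment> \<open>A functional killing \<open>K\<close> is constant on each coset, so its image of
    a coset is a singleton.\<close>
  define l' where "l' C = (if C \<in> carrier Nquot then the_elem (l ` C) else 0)" for C
  have img: "l ` (K #> x) = {l x}" if x: "x \<in> carrier N" for x
  proof -
    have "l y = l x" if "y \<in> K #> x" for y
    proof -
      obtain k where "k \<in> K" "y = k \<otimes> x" using \<open>y \<in> K #> x\<close> by (auto simp: r_coset_def)
      then show ?thesis using l x K_carrier by (auto simp: annihilator_def dual_mult)
    qed
    moreover have "x \<in> K #> x" using rcos_self[OF x K_subgroup] .
    ultimately show ?thesis by blast
  qed
  have l': "l' (K #> x) = l x" if "x \<in> carrier N" for x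
    using that by (simp add: l'_def img cone_quotient_def carrier_FactGroup)
  have "l' \<in> dual Nquot"
  proof (rule dualI)
    fix C D assume "C \<in> carrier Nquot" "D \<in> carrier Nquot"
    then obtain x y where xy: "x \<in> carrier N" "C = K #> x" "y \<in> carrier N" "D = K #> y"
      by (auto simp: cone_quotient_def carrier_FactGroup)
    then have "C \<otimes>\<^bsub>Nquot\<^esub> D = K #> (x \<otimes> y)"
      by (simp add: cone_quotient_def normal.rcos_sum[OF K_normal])
    then show "l' (C \<otimes>\<^bsub>Nquot\<^esub> D) = l' C + l' D"
      using xy lN by (simp add: l' dual_mult)
  qed (simp add: l'_def)
  moreover have "coset_dual l' = l"
    using l' dual_outside[OF lN] by (auto simp: inflate_def fun_eq_iff)
  ultimately show ?thesis by blast
qed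

text \<open>Subtracting the inflated restriction projects the dual of \<open>N\<close> onto the
  annihilator, which is the dual of the quotient. This splitting lifts points of the quotient torus
  over every \<open>A\<close>.\<close>

lemma coset_dual_section:
  obtains f where "add_map (dual N) (dual Nquot) f" "\<And>l. l \<in> dual Nquot \<Longrightarrow> f (coset_dual l) = l"
proof -
  obtain h where h: "\<And>x. x \<in> carrier N \<Longrightarrow> h x \<in> K" "\<And>x. x \<in> K \<Longrightarrow> h x = x"
    "add_map (dual Nsub) (dual N) (inflate N h)"
    using retraction by metis
  define g where "g = inv_into (dual Nquot) coset_dual"
  define d where "d l = l - inflate N h (restrict_dual l)" for l
  have d: "d l \<in> annihilator N K" if "l \<in> dual N" for l
    unfolding d_def using inflate_restrict[OF h that] .
  have g: "g l \<in> dual Nquot" "coset_dual (g l) = l" if "l \<in> annihilator N K" for l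
    using coset_dual_surj[OF that] by (auto simp: g_def inv_into_into f_inv_into_f)
  have gj: "g (coset_dual l) = l" if "l \<in> dual Nquot" for l
    unfolding g_def using coset_dual_inj that by (rule inv_into_f_f)
  have g_add: "g (l + l') = g l + g l'" if "l \<in> annihilator N K" "l' \<in> annihilator N K" for l l'
  proof -
    have "l + l' = coset_dual (g l + g l')"
      using g[OF that(1)] g[OF that(2)] add_mapD(3)[OF add_map_coset] by simp
    then show ?thesis using gj dual_add g(1) that by metis
  qed
  have "add_map (dual N) (dual Nquot) (\<lambda>l. g (d l))"
    unfolding add_map_def
  proof (intro conjI ballI funcsetI)
    show "g (d l) \<in> dual Nquot" if "l \<in> dual N" for l using g(1) d that by blast
    have "d 0 = 0" using add_mapD(2)[OF add_map_restrict] add_mapD(2)[OF h(3)] by (simp add: d_def)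
    then show "g (d 0) = 0" using gj[OF dual_zero] add_mapD(2)[OF add_map_coset] by simp
    show "g (d (l + l')) = g (d l) + g (d l')" if "l \<in> dual N" "l' \<in> dual N" for l l'
    proof -
      have "d (l + l') = d l + d l'"
        using that add_mapD(1,3)[OF add_map_restrict] add_mapD(3)[OF h(3)] by (simp add: d_def)
      then show ?thesis using g_add d that by simp
    qed
  qed
  moreover have "g (d (coset_dual l)) = l" if "l \<in> dual Nquot" for l
  proof -
    have "restrict_dual (coset_dual l) = 0"
      using coset_dual_annihilator[OF that] by (auto simp: annihilator_def inflate_def[of Nsub] fun_eq_iff)
    then have "d (coset_dual l) = coset_dual l"
      using add_mapD(2)[OF h(3)] by (simp add: d_def)
    then show ?thesis using gj that by simp
  qed
  ultimately show thesis by (rule that)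
qed

text \<open>Integral coefficients on \<open>J\<close> are separated into positive and negative
  parts. Through \<open>annihilator_combination\<close> this is where normality reaches the
  action.\<close>

lemma annihilator_diff:
  assumes "v \<in> annihilator N K"
  shows "\<exists>a\<in>S \<inter> annihilator N K. \<exists>b\<in>S \<inter> annihilator N K. a = v + b"
proof -
  obtain k where k: "v = (\<lambda>x. \<Sum>i\<in>J. k i * m i x)" using annihilator_combination[OF assms] .
  have SR: "(\<lambda>x. \<Sum>i\<in>J. int (c i) * m i x) \<in> S \<inter> annihilator N K" for c
  proof -
    have "(\<lambda>x. \<Sum>i\<in>J. int (c i) * m i x) = (\<lambda>x. \<Sum>i=1..r. int (if i \<in> J then c i else 0) * m i x)"
      by (intro ext sum.mono_neutral_cong_left) (auto simp: J_def)
    then show ?thesis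
      using nat_combination_annihilates_iff[of "\<lambda>i. if i \<in> J then c i else 0"]
      by (auto intro: nat_combinationsI)
  qed
  have "(\<lambda>x. \<Sum>i\<in>J. int (nat (k i)) * m i x) = v + (\<lambda>x. \<Sum>i\<in>J. int (nat (- k i)) * m i x)"
  proof
    fix x
    have "int (nat (k i)) * m i x = k i * m i x + int (nat (- k i)) * m i x" for i
      by (cases "k i \<ge> 0") auto
    then show "(\<Sum>i\<in>J. int (nat (k i)) * m i x) = (v + (\<lambda>x. \<Sum>i\<in>J. int (nat (- k i)) * m i x)) x"
      by (simp only: k plus_fun_apply sum.distrib)
  qed
  then show ?thesis by (rule bexI[OF bexI[OF _ SR] SR])
qed

end

text \<open>With \<open>f\<close> dual to \<open>h\<close>, this is the pushforward along
  \<open>h\<close>: every lattice point of a representation of \<open>c\<close> is replaced by its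
  image, and coefficients are collected over the fibres of \<open>h\<close>.\<close>

lemma lat_tensor_pullback:
  assumes c: "c \<in> lat_tensor L" and h: "\<And>x. x \<in> carrier L \<Longrightarrow> h x \<in> carrier L'"
    and f: "\<And>l. l \<in> dual L' \<Longrightarrow> f l \<in> dual L" "\<And>l x. l \<in> dual L' \<Longrightarrow> x \<in> carrier L \<Longrightarrow> f l x = l (h x)"
  shows "(\<lambda>l. if l \<in> dual L' then c (f l) else 0) \<in> lat_tensor L'"
proof -
  obtain F z where F: "finite F" "F \<subseteq> carrier L" "c = (\<lambda>m. \<Sum>n\<in>F. z n * lat_incl L n m)"
    using c by (rule lat_tensor_rep)
  define w where "w y = (\<Sum>n | n \<in> F \<and> h n = y. z n)" for y
  have "(if l \<in> dual L' then c (f l) else 0) = (\<Sum>y\<in>h ` F. w y * lat_incl L' y l)" for l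
  proof (cases "l \<in> dual L'")
    case True
    have "c (f l) = (\<Sum>n\<in>F. z n * of_int (l (h n)))"
      unfolding F(3) by (rule sum.cong) (use True f F(2) in \<open>auto simp: lat_incl_def\<close>)
    also have "\<dots> = (\<Sum>y\<in>h ` F. \<Sum>n | n \<in> F \<and> h n = y. z n * of_int (l (h n)))"
      by (rule sum.image_gen[OF F(1)])
    also have "\<dots> = (\<Sum>y\<in>h ` F. w y * lat_incl L' y l)"
      by (rule sum.cong) (auto simp: w_def lat_incl_def True sum_distrib_right intro!: sum.cong)
    finally show ?thesis using True by simp
  qed (simp add: lat_incl_def)
  then show ?thesis
    unfolding lat_tensor_def using F(1,2) h by (intro CollectI exI[of _ "h ` F"] exI[of _ w]) auto
qed

section \<open>The coordinate ring\<close>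

lemma nat_combination_closed:
  assumes "0 \<in> D" "\<And>l l'. l \<in> D \<Longrightarrow> l' \<in> D \<Longrightarrow> l + l' \<in> D" "\<And>i. i \<in> {1..r} \<Longrightarrow> m i \<in> D"
  shows "nat_combinations r m \<subseteq> D"
proof
  fix l assume "l \<in> nat_combinations r m"
  then obtain k where l: "l = (\<lambda>x. \<Sum>i=1..r. int (k i) * m i x)" by (auto simp: nat_combinations_def)
  have 1: "(\<lambda>x. int e * m i x) \<in> D" if "i \<in> {1..r}" for e i
  proof (induction e)
    case 0
    then show ?case using assms(1) by (simp add: zero_fun_def)
  next
    case (Suc e)
    have "(\<lambda>x. int (Suc e) * m i x) = m i + (\<lambda>x. int e * m i x)" by (auto simp: fun_eq_iff algebra_simps)
    then show ?case using assms(2)[OF assms(3)[OF that] Suc] by simp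
  qed
  have "(\<lambda>x. \<Sum>i\<in>I. int (k i) * m i x) \<in> D" if "finite I" "I \<subseteq> {1..r}" for I
    using that
  proof (induction I rule: finite_induct)
    case empty
    then show ?case using assms(1) by (simp add: zero_fun_def)
  next
    case (insert i I)
    have "(\<lambda>x. \<Sum>i\<in>insert i I. int (k i) * m i x) = (\<lambda>x. int (k i) * m i x) + (\<lambda>x. \<Sum>i\<in>I. int (k i) * m i x)"
      using insert by (auto simp: fun_eq_iff)
    then show ?case using assms(2) 1 insert by simp
  qed
  then show "l \<in> D" unfolding l by simp
qed

text \<open>The translates of the \<open>n j\<close> by the semigroup: the odd part of the
  coordinate ring is the module over the even part generated by the odd generators.\<close>

definition odd_exponents :: "nat \<Rightarrow> nat \<Rightarrow> (nat \<Rightarrow> 'n \<Rightarrow> int) \<Rightarrow> (nat \<Rightarrow> 'n \<Rightarrow> int) \<Rightarrow> ('n \<Rightarrow> int) set" where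
  "odd_exponents r s m n = {l + n j | l j. l \<in> nat_combinations r m \<and> j \<in> {1..s}}"

lemma exponents_coord: "exponents (nat_combinations r m) (odd_exponents r s m n)"
proof -
  have "a + (l + n j) \<in> odd_exponents r s m n" if "a \<in> nat_combinations r m" "l \<in> nat_combinations r m" "j \<in> {1..s}" for a l j
    using nat_combinations_add[OF that(1,2)] that(3) unfolding odd_exponents_def
    by (intro CollectI exI[of _ "a + l"] exI[of _ j]) (simp add: add.assoc)
  then show ?thesis
    by (auto simp: exponents_def nat_combinations_zero nat_combinations_add odd_exponents_def[of r s m n])
qed

text \<open>The generated ring is spanned by monomials. The span is closed under the ring operations
  and contains the generators; conversely each spanning monomial is a product of generators and
  constants.\<close>

lemma coord_ring_eq:
  assumes m: "\<And>i. i \<in> {1..r} \<Longrightarrow> m i \<in> dual N" and n: "\<And>j. j \<in> {1..s} \<Longrightarrow> n j \<in> nat_combinations r m"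
  shows "coord_ring N r s m n = spoly_alg (nat_combinations r m) (odd_exponents r s m n)"
proof -
  let ?S = "nat_combinations r m" and ?T = "odd_exponents r s m n" and ?R = "supertorus_ring N"
  let ?C = "carrier (spoly_alg ?S ?T)"
  define H where "H = range (\<lambda>z. z \<odot>\<^bsub>?R\<^esub> \<one>\<^bsub>?R\<^esub>) \<union> (\<lambda>i. monomial (m i)) ` {1..r} \<union> (\<lambda>j. monomial_xi (n j)) ` {1..s}"
  let ?G = "generate_ring ?R H"
  have E: "exponents ?S ?T" by (rule exponents_coord)
  have SN: "?S \<subseteq> dual N" using m by (auto simp: nat_combinations_def intro!: dual_combination)
  have TN: "?T \<subseteq> dual N" using SN n by (auto simp: odd_exponents_def intro!: dual_add)
  have ops: "monoid.mult ?R = monoid.mult (spoly_alg ?S ?T)" "add ?R = add (spoly_alg ?S ?T)"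
    "one ?R = one (spoly_alg ?S ?T)" "module.smult ?R = module.smult (spoly_alg ?S ?T)"
    by (simp_all add: supertorus_ring_def spoly_alg_def)
  have nT: "n j \<in> ?T" if "j \<in> {1..s}" for j
    unfolding odd_exponents_def using that nat_combinations_zero[of r m] by (intro CollectI exI[of _ 0] exI[of _ j]) auto
  \<comment> \<open>Negation is a definite description over the carrier, so it is computed after
    checking that the negatives have keys in the dual.\<close>
  have uminus: "\<ominus>\<^bsub>?R\<^esub> (f, g) = (- f, - g)" if "keys f \<subseteq> dual N" "keys g \<subseteq> dual N" for f g
  proof -
    have "keys (- f) \<subseteq> dual N" "keys (- g) \<subseteq> dual N"
      using that by (simp_all add: subset_iff in_keys_iff)
    then show ?thesis
      using that unfolding a_inv_def m_inv_def
      by (intro the_equality) (auto simp: supertorus_ring_def add_eq_0_iff)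
  qed
  have "h \<in> ?C" if "h \<in> ?G" for h
    using that
  proof (induction rule: generate_ring.induct)
    case one
    then show ?case using spoly_alg_closed(2)[OF E] by (simp add: ops)
  next
    case (incl h)
    then show ?case
      using spoly_alg_closed(3)[OF E spoly_alg_closed(2)[OF E]] nat_combinations_gen[of _ r m] nT by (auto simp: H_def ops)
  next
    case (a_inv h)
    then have "\<ominus>\<^bsub>?R\<^esub> h = (- fst h, - snd h)"
      using uminus[of "fst h" "snd h"] SN TN by (auto simp: spoly_alg_def)
    then show ?case using a_inv by (auto simp: spoly_alg_def subset_iff in_keys_iff)
  next
    case (eng_add h1 h2)
    then show ?case using spoly_alg_closed(1)[OF E] by (simp add: ops)
  next
    case (eng_mult h1 h2)
    then show ?case using spoly_alg_closed(1)[OF E] by (simp add: ops)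
  qed
  moreover have "h \<in> ?G" if "h \<in> ?C" for h
  proof -
    note mult = generate_ring.eng_mult[where R = ?R and H = H] and add = generate_ring.eng_add[where R = ?R and H = H]
    have const: "(Poly_Mapping.single 0 z, 0) \<in> ?G" for z
    proof -
      have "z \<odot>\<^bsub>?R\<^esub> \<one>\<^bsub>?R\<^esub> = (Poly_Mapping.single 0 z, 0)" by (simp add: supertorus_ring_def)
      then show ?thesis by (metis (no_types, lifting) H_def UnI1 generate_ring.incl rangeI)
    qed
    \<comment> \<open>The exponents whose monomials are generated form a submonoid containing all
      \<open>m i\<close>.\<close>
    have mon: "?S \<subseteq> {l. monomial l \<in> ?G}"
    proof (rule nat_combination_closed; (unfold mem_Collect_eq)?)
      show "monomial 0 \<in> ?G" using const[of 1] by (simp add: monomial_def)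
      show "monomial (l + l') \<in> ?G" if "monomial l \<in> ?G" "monomial l' \<in> ?G" for l l'
        using mult[OF that] by (simp add: ops monomial_mult)
      show "monomial (m i) \<in> ?G" if "i \<in> {1..r}" for i
        using that by (intro generate_ring.incl) (auto simp: H_def)
    qed
    have single: "(Poly_Mapping.single l z, 0) \<in> ?G" if "l \<in> ?S" for l z
      using mult[OF const[of z], of "monomial l"] mon that
      by (auto simp: supertorus_ring_def monomial_def mult_single)
    have even: "(f, 0) \<in> ?G" if "keys f \<subseteq> ?S" for f
      using that
    proof (induction rule: poly_mapping_keys_induct)
      case zero
      then show ?case using const[of 0] by simp
    next
      case (single l z)
      then show ?case by (rule \<open>\<And>l z. l \<in> ?S \<Longrightarrow> (Poly_Mapping.single l z, 0) \<in> ?G\<close>)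
    next
      case (add f g)
      then show ?case using generate_ring.eng_add[OF add(3,4)] by (simp add: supertorus_ring_def)
    qed
    have odd: "(0, f) \<in> ?G" if "keys f \<subseteq> ?T" for f
      using that
    proof (induction rule: poly_mapping_keys_induct)
      case zero
      then show ?case using const[of 0] by simp
    next
      case (single l z)
      then obtain l' j where l: "l = l' + n j" "l' \<in> ?S" "j \<in> {1..s}" by (auto simp: odd_exponents_def)
      then have "monomial_xi (n j) \<in> ?G" by (intro generate_ring.incl) (auto simp: H_def)
      from mult[OF \<open>\<And>l z. l \<in> ?S \<Longrightarrow> (Poly_Mapping.single l z, 0) \<in> ?G\<close>[OF l(2), of z] this]
      show ?case by (simp add: supertorus_ring_def monomial_xi_def mult_single l(1))
    next
      case (add f g)
      then show ?case using generate_ring.eng_add[OF add(3,4)] by (simp add: supertorus_ring_def)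
    qed
    obtain f g where h: "h = (f, g)" by (cases h)
    have "(f, 0) \<in> ?G" "(0, g) \<in> ?G" using that even odd by (auto simp: h spoly_alg_def)
    from add[OF this] show ?thesis by (simp add: h supertorus_ring_def)
  qed
  ultimately have "?G = ?C" by blast
  then have "coord_ring N r s m n = sub_superalgebra ?R ?C"
    by (simp add: coord_ring_def H_def)
  also have "\<dots> = spoly_alg ?S ?T"
    using SN TN by (auto simp: sub_superalgebra_def supertorus_ring_def spoly_alg_def)
  finally show ?thesis .
qed

text \<open>Rewrites the value of the closed point at \<open>n j\<close> as the product of powers of
  the \<open>a i\<close> that governs the case distinction.\<close>

lemma character_nat_combination:
  fixes ev :: "('n \<Rightarrow> int) \<Rightarrow> complex"
  assumes "ev 0 = 1" "\<And>l l'. l \<in> nat_combinations r m \<Longrightarrow> l' \<in> nat_combinations r m \<Longrightarrow> ev (l + l') = ev l * ev l'"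
  shows "ev (\<lambda>x. \<Sum>i=1..r. int (k i) * m i x) = (\<Prod>i=1..r. ev (m i) ^ k i)"
proof -
  note S = nat_combinations_gen[of _ r m] nat_combinations_zero[of r m] nat_combinations_add[of _ r m]
  have 1: "(\<lambda>x. int e * m i x) \<in> nat_combinations r m \<and> ev (\<lambda>x. int e * m i x) = ev (m i) ^ e" if "i \<in> {1..r}" for e i
  proof (induction e)
    case 0
    then show ?case using assms(1) S(2) by (simp add: zero_fun_def)
  next
    case (Suc e)
    have "(\<lambda>x. int (Suc e) * m i x) = m i + (\<lambda>x. int e * m i x)" by (auto simp: fun_eq_iff algebra_simps)
    then show ?case using assms(2) S(1)[OF that] S(3) Suc by simp
  qed
  have "(\<lambda>x. \<Sum>i\<in>I. int (k i) * m i x) \<in> nat_combinations r m \<and>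
      ev (\<lambda>x. \<Sum>i\<in>I. int (k i) * m i x) = (\<Prod>i\<in>I. ev (m i) ^ k i)" if "finite I" "I \<subseteq> {1..r}" for I
    using that
  proof (induction I rule: finite_induct)
    case empty
    then show ?case using assms(1) S(2) by (simp add: zero_fun_def)
  next
    case (insert i I)
    have "(\<lambda>x. \<Sum>i\<in>insert i I. int (k i) * m i x) = (\<lambda>x. int (k i) * m i x) + (\<lambda>x. \<Sum>i\<in>I. int (k i) * m i x)"
      using insert by (auto simp: fun_eq_iff)
    then show ?case using assms(2) 1[of i "k i"] S(3) insert by simp
  qed
  from this[of "{1..r}"] show ?thesis by simp
qed

section \<open>Stabilizers and orbits\<close>

lemma exponents_dual: "exponents (dual L) (dual L)" "exponents (dual L) {}"
  by (auto simp: exponents_def dual_zero dual_add)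

lemma supertorus_simps:
  "coord_set (supertorus L c) = carrier (spoly_alg (dual L) (dual L))"
  "carrier (points (supertorus L c) A) = salg_hom (spoly_alg (dual L) (dual L)) A"
  "monoid.mult (points (supertorus L c) A) = act (carrier (spoly_alg (dual L) (dual L))) c A"
  by (simp_all add: supertorus_def supertorus_ring_eq)

lemma torus_simps:
  "coord_set (torus L) = carrier (spoly_alg (dual L) {})"
  "carrier (points (torus L) A) = salg_hom (spoly_alg (dual L) {}) A"
  "monoid.mult (points (torus L) A) = act (carrier (spoly_alg (dual L) {})) (\<lambda>_. 0) A"
  by (simp_all add: torus_def torus_ring_eq)

lemma stabilizer_simps:
  "coord_set (stabilizer N c Y p) = carrier (spoly_alg (dual N) (dual N))"
  "carrier (points (stabilizer N c Y p) A) = {g \<in> salg_hom (spoly_alg (dual N) (dual N)) A.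
     act (carrier Y) c A g (base_change_point Y p A) = base_change_point Y p A}"
  "monoid.mult (points (stabilizer N c Y p) A) = act (carrier (spoly_alg (dual N) (dual N))) c A"
  by (simp_all add: stabilizer_def supertorus_simps)

lemma group_functor_isoI:
  fixes F :: "('x, 'u) group_functor" and G :: "('y, 'u) group_functor"
  assumes "\<And>A g. superalgebra A \<Longrightarrow> g \<in> carrier (points F A) \<Longrightarrow> \<Phi> A g \<in> carrier (points G A) \<and> \<Psi> A (\<Phi> A g) = g"
    and "\<And>A g. superalgebra A \<Longrightarrow> g \<in> carrier (points G A) \<Longrightarrow> \<Psi> A g \<in> carrier (points F A) \<and> \<Phi> A (\<Psi> A g) = g"
    and "\<And>A g h. superalgebra A \<Longrightarrow> g \<in> carrier (points F A) \<Longrightarrow> h \<in> carrier (points F A) \<Longrightarrow>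
      \<Phi> A (g \<otimes>\<^bsub>points F A\<^esub> h) = \<Phi> A g \<otimes>\<^bsub>points G A\<^esub> \<Phi> A h"
    and "\<And>A B \<phi> g. superalgebra A \<Longrightarrow> superalgebra B \<Longrightarrow> \<phi> \<in> salg_hom A B \<Longrightarrow> g \<in> carrier (points F A) \<Longrightarrow>
      \<Phi> B (compose (coord_set F) \<phi> g) = compose (coord_set G) \<phi> (\<Phi> A g)"
  shows "group_functor_iso F G"
  unfolding group_functor_iso_def
proof (intro exI[of _ \<Phi>] conjI allI impI)
  fix A :: "'u superalgebra" assume A: "superalgebra A"
  have "bij_betw (\<Phi> A) (carrier (points F A)) (carrier (points G A))"
    by (rule bij_betwI[of _ _ _ "\<Psi> A"]) (use assms(1,2)[OF A] in auto)
  then show "\<Phi> A \<in> iso (points F A) (points G A)"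
    using assms(1,3)[OF A] by (auto simp: iso_def hom_def)
qed (use assms(4) in auto)

text \<open>Here \<open>L\<close> is the sublattice, \<open>e\<close> restricts functionals and
  \<open>f\<close> is a section of \<open>e\<close>. A stabilizing point is trivial on
  \<open>R\<close>, and \<open>l - f (e l) \<in> R\<close>, so it factors through \<open>e\<close>
  and is recovered from its values along \<open>f\<close>. The value at \<xi> stays free.\<close>

lemma stabilizer_iso_supertorus:
  assumes "point_action (dual N) S T R c pt" and TR: "T \<inter> R = {}"
    and f: "add_map (dual L) (dual N) f" and e: "add_map (dual N) (dual L) e"
    and ef: "\<And>l. l \<in> dual L \<Longrightarrow> e (f l) = l"
    and fe: "\<And>l. l \<in> dual N \<Longrightarrow> l - f (e l) \<in> R"
    and eR: "\<And>l. l \<in> R \<Longrightarrow> e l = 0"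
    and c': "\<And>l. l \<in> dual L \<Longrightarrow> c' l = c (f l)"
  shows "group_functor_iso (stabilizer N c (spoly_alg S T) pt :: (('n \<Rightarrow> int) spoly, 'u) group_functor) (supertorus L c')"
proof -
  interpret point_action "dual N" S T R c pt by fact
  note EL = exponents_dual(1)[of L]
  show ?thesis
  proof (rule group_functor_isoI[where \<Phi> = "pull (dual L) (dual L) f" and \<Psi> = "pull (dual N) (dual N) e"];
      unfold supertorus_simps stabilizer_simps move_def[symmetric])
    fix A :: "'u superalgebra" and g
    assume A: "superalgebra A" and "g \<in> {g \<in> pts A. move A g = base_change_point (spoly_alg S T) pt A}"
    then have g: "g \<in> pts A" and gR: "\<And>l. l \<in> R \<Longrightarrow> g (monomial l) = \<one>\<^bsub>A\<^esub>"
      using stabilizer_iff_supertorus[OF A _ TR] by auto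
    interpret ring A by (rule superalgebra.axioms(1)[OF A])
    have pg: "pull (dual L) (dual L) f A g \<in> salg_hom (spoly_alg (dual L) (dual L)) A"
      by (rule salg_hom_pull[OF A EL _ M f g]) simp
    have ppg: "pull (dual N) (dual N) e A (pull (dual L) (dual L) f A g) \<in> pts A"
      by (rule salg_hom_pull[OF A M _ EL e pg]) simp
    have t: "g (monomial (f (e l))) = g (monomial l)" if l: "l \<in> dual N" for l
    proof -
      have fel: "f (e l) \<in> dual N" using add_mapD(1)[OF f] add_mapD(1)[OF e] l by blast
      have "g (monomial l) = g (monomial ((l - f (e l)) + f (e l)))" by simp
      also have "\<dots> = g (monomial (l - f (e l))) \<otimes>\<^bsub>A\<^esub> g (monomial (f (e l)))"
        using fel l dual_diff by (intro char_dataD(4)[OF salg_hom_char_data[OF A M g]])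
      finally show ?thesis using gR[OF fe[OF l]] salg_hom_monomial(1)[OF A M g fel] by simp
    qed
    have "pull (dual N) (dual N) e A (pull (dual L) (dual L) f A g) = g"
    proof (rule salg_hom_eqI[OF A M ppg g])
      fix l assume l: "l \<in> dual N"
      then have el: "e l \<in> dual L" and fel: "f (e l) \<in> dual N" using add_mapD(1)[OF f] add_mapD(1)[OF e] by blast+
      show "pull (dual N) (dual N) e A (pull (dual L) (dual L) f A g) (monomial l) = g (monomial l)"
        using l el t pull_monomial(1)[OF A EL e pg] pull_monomial(1)[OF A M f g] by simp
      show "pull (dual N) (dual N) e A (pull (dual L) (dual L) f A g) (monomial_xi l) = g (monomial_xi l)"
        using l el t pull_monomial(2)[OF A EL e pg] pull_monomial(2)[OF A M f g]
          salg_hom_xi[OF A M g l] salg_hom_xi[OF A M g fel] by simp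
    qed
    with pg show "pull (dual L) (dual L) f A g \<in> salg_hom (spoly_alg (dual L) (dual L)) A \<and>
        pull (dual N) (dual N) e A (pull (dual L) (dual L) f A g) = g" by simp
  next
    fix A :: "'u superalgebra" and g
    assume A: "superalgebra A" and g: "g \<in> salg_hom (spoly_alg (dual L) (dual L)) A"
    have pg: "pull (dual N) (dual N) e A g \<in> pts A"
      by (rule salg_hom_pull[OF A M _ EL e g]) simp
    have ppg: "pull (dual L) (dual L) f A (pull (dual N) (dual N) e A g) \<in> salg_hom (spoly_alg (dual L) (dual L)) A"
      by (rule salg_hom_pull[OF A EL _ M f pg]) simp
    have "pull (dual N) (dual N) e A g (monomial l) = \<one>\<^bsub>A\<^esub>" if "l \<in> R" for l
      using that R_M eR pull_monomial(1)[OF A EL e g] char_dataD(3)[OF salg_hom_char_data[OF A EL g]] by auto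
    then have "move A (pull (dual N) (dual N) e A g) = base_change_point (spoly_alg S T) pt A"
      using stabilizer_iff_supertorus[OF A pg TR] by blast
    moreover have "pull (dual L) (dual L) f A (pull (dual N) (dual N) e A g) = g"
      by (rule salg_hom_eqI[OF A EL ppg g])
        (use pull_monomial[OF A EL e g] pull_monomial[OF A M f pg] add_mapD(1)[OF f] ef in auto)
    ultimately show "pull (dual N) (dual N) e A g \<in> {g \<in> pts A. move A g = base_change_point (spoly_alg S T) pt A} \<and>
        pull (dual L) (dual L) f A (pull (dual N) (dual N) e A g) = g"
      using pg by simp
  next
    fix A :: "'u superalgebra" and g h
    assume "superalgebra A" "g \<in> {g \<in> pts A. move A g = base_change_point (spoly_alg S T) pt A}"
      "h \<in> {g \<in> pts A. move A g = base_change_point (spoly_alg S T) pt A}"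
    then show "pull (dual L) (dual L) f A (mul A g h) =
        act (carrier (spoly_alg (dual L) (dual L))) c' A (pull (dual L) (dual L) f A g) (pull (dual L) (dual L) f A h)"
      using c' by (intro pull_act[OF _ M f]) auto
  next
    fix A B :: "'u superalgebra" and \<phi> g
    assume "superalgebra A" "superalgebra B" "\<phi> \<in> salg_hom A B"
      "g \<in> {g \<in> pts A. move A g = base_change_point (spoly_alg S T) pt A}"
    then show "pull (dual L) (dual L) f B (compose (carrier (spoly_alg (dual N) (dual N))) \<phi> g) =
        compose (carrier (spoly_alg (dual L) (dual L))) \<phi> (pull (dual L) (dual L) f A g)"
      by (auto intro!: compose_pull[OF _ _ _ M f, symmetric])
  qed
qed

text \<open>A point of an ordinary torus has no value at \<xi>; pulling it back to the supertorus
  requires a choice, and 0 is taken.\<close>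

lemma even_extension:
  assumes A: "superalgebra A" and M: "exponents M M" and e: "add_map M P e" and P: "exponents P {}"
    and g: "g \<in> salg_hom (spoly_alg P {}) A"
  defines "h \<equiv> extend_data M M A (\<lambda>m. g (monomial (e m))) (\<lambda>_. \<zero>\<^bsub>A\<^esub>)"
  shows "h \<in> salg_hom (spoly_alg M M) A" "m \<in> M \<Longrightarrow> h (monomial m) = g (monomial (e m))"
    "m \<in> M \<Longrightarrow> h (monomial_xi m) = \<zero>\<^bsub>A\<^esub>"
proof -
  interpret ring A by (rule superalgebra.axioms(1)[OF A])
  note d = char_dataD[OF salg_hom_char_data[OF A P g]] and e = add_mapD[OF e]
  have c: "g (monomial (e m)) \<in> carrier A" if "m \<in> M" for m
    using salg_hom_monomial(1)[OF A P g] e(1) that by blast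
  show "h \<in> salg_hom (spoly_alg M M) A"
    unfolding h_def
    by (rule extend_data_salg_hom[OF A M], rule char_dataI) (use d(1,3,4) e c in \<open>auto simp: zero_odd[OF A]\<close>)
  show "m \<in> M \<Longrightarrow> h (monomial m) = g (monomial (e m))" "m \<in> M \<Longrightarrow> h (monomial_xi m) = \<zero>\<^bsub>A\<^esub>"
    using c by (auto simp: h_def extend_data_monomial[OF A] extend_data_monomial_xi[OF A])
qed

text \<open>The even part behaves as in the supertorus case. Stabilizing now also sends \<xi> to 0,
  so the extension by 0 is inverse to restriction and the deformation terms disappear.\<close>

lemma stabilizer_iso_torus:
  assumes "point_action (dual N) S T R c pt" and TR: "T \<inter> R \<noteq> {}"
    and f: "add_map (dual L) (dual N) f" and e: "add_map (dual N) (dual L) e"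
    and ef: "\<And>l. l \<in> dual L \<Longrightarrow> e (f l) = l"
    and fe: "\<And>l. l \<in> dual N \<Longrightarrow> l - f (e l) \<in> R"
    and eR: "\<And>l. l \<in> R \<Longrightarrow> e l = 0"
  shows "group_functor_iso (stabilizer N c (spoly_alg S T) pt :: (('n \<Rightarrow> int) spoly, 'u) group_functor) (torus L)"
proof -
  interpret point_action "dual N" S T R c pt by fact
  note EL = exponents_dual(2)[of L]
  define ext where "ext A g = extend_data (dual N) (dual N) A (\<lambda>m. g (monomial (e m))) (\<lambda>_. \<zero>\<^bsub>A\<^esub>)"
    for A :: "'u superalgebra" and g
  have ext: "ext A g \<in> pts A" "l \<in> dual N \<Longrightarrow> ext A g (monomial l) = g (monomial (e l))"
    "l \<in> dual N \<Longrightarrow> ext A g (monomial_xi l) = \<zero>\<^bsub>A\<^esub>"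
    if "superalgebra A" "g \<in> salg_hom (spoly_alg (dual L) {}) A" for A :: "'u superalgebra" and g l
    unfolding ext_def using even_extension[OF that(1) M e EL that(2)] by blast+
  have xi_zero: "g (monomial_xi l) = \<zero>\<^bsub>A\<^esub>"
    if A: "superalgebra A" and g: "g \<in> pts A" and "g (monomial_xi 0) = \<zero>\<^bsub>A\<^esub>" "l \<in> dual N" for A :: "'u superalgebra" and g l
  proof -
    interpret ring A by (rule superalgebra.axioms(1)[OF A])
    show ?thesis using salg_hom_xi[OF A M g that(4)] salg_hom_monomial(1)[OF A M g that(4)] that(3) by simp
  qed
  show ?thesis
  proof (rule group_functor_isoI[where \<Phi> = "pull (dual L) {} f" and \<Psi> = ext];
      unfold torus_simps stabilizer_simps move_def[symmetric])
    fix A :: "'u superalgebra" and g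
    assume A: "superalgebra A" and "g \<in> {g \<in> pts A. move A g = base_change_point (spoly_alg S T) pt A}"
    then have g: "g \<in> pts A" and gR: "\<And>l. l \<in> R \<Longrightarrow> g (monomial l) = \<one>\<^bsub>A\<^esub>" and g0: "g (monomial_xi 0) = \<zero>\<^bsub>A\<^esub>"
      using stabilizer_iff_torus[OF A _ TR] by auto
    interpret ring A by (rule superalgebra.axioms(1)[OF A])
    have pg: "pull (dual L) {} f A g \<in> salg_hom (spoly_alg (dual L) {}) A"
      by (rule salg_hom_pull[OF A EL _ M f g]) simp
    have t: "g (monomial (f (e l))) = g (monomial l)" if l: "l \<in> dual N" for l
    proof -
      have fel: "f (e l) \<in> dual N" using add_mapD(1)[OF f] add_mapD(1)[OF e] l by blast
      have "g (monomial l) = g (monomial ((l - f (e l)) + f (e l)))" by simp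
      also have "\<dots> = g (monomial (l - f (e l))) \<otimes>\<^bsub>A\<^esub> g (monomial (f (e l)))"
        using fel l dual_diff by (intro char_dataD(4)[OF salg_hom_char_data[OF A M g]])
      finally show ?thesis using gR[OF fe[OF l]] salg_hom_monomial(1)[OF A M g fel] by simp
    qed
    have "ext A (pull (dual L) {} f A g) = g"
    proof (rule salg_hom_eqI[OF A M ext(1)[OF A pg] g])
      fix l assume l: "l \<in> dual N"
      then have el: "e l \<in> dual L" using add_mapD(1)[OF e] by blast
      show "ext A (pull (dual L) {} f A g) (monomial l) = g (monomial l)"
        using l el t ext(2)[OF A pg] pull_monomial(1)[OF A M f g] by simp
      show "ext A (pull (dual L) {} f A g) (monomial_xi l) = g (monomial_xi l)"
        using l ext(3)[OF A pg] xi_zero[OF A g g0] by simp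
    qed
    with pg show "pull (dual L) {} f A g \<in> salg_hom (spoly_alg (dual L) {}) A \<and>
        ext A (pull (dual L) {} f A g) = g" by simp
  next
    fix A :: "'u superalgebra" and g
    assume A: "superalgebra A" and g: "g \<in> salg_hom (spoly_alg (dual L) {}) A"
    note eg = ext[OF A g]
    have ppg: "pull (dual L) {} f A (ext A g) \<in> salg_hom (spoly_alg (dual L) {}) A"
      by (rule salg_hom_pull[OF A EL _ M f eg(1)]) simp
    have "ext A g (monomial l) = \<one>\<^bsub>A\<^esub>" if "l \<in> R" for l
      using that R_M eR eg(2) char_dataD(3)[OF salg_hom_char_data[OF A EL g]] by auto
    then have "move A (ext A g) = base_change_point (spoly_alg S T) pt A"
      using stabilizer_iff_torus[OF A eg(1) TR] eg(3)[OF M_zero] by blast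
    moreover have "pull (dual L) {} f A (ext A g) = g"
      by (rule salg_hom_eqI[OF A EL ppg g])
        (use eg(2) pull_monomial(1)[OF A M f eg(1)] add_mapD(1)[OF f] ef in auto)
    ultimately show "ext A g \<in> {g \<in> pts A. move A g = base_change_point (spoly_alg S T) pt A} \<and>
        pull (dual L) {} f A (ext A g) = g"
      using eg(1) by simp
  next
    fix A :: "'u superalgebra" and g h
    assume A: "superalgebra A" and gh: "g \<in> {g \<in> pts A. move A g = base_change_point (spoly_alg S T) pt A}"
      "h \<in> {g \<in> pts A. move A g = base_change_point (spoly_alg S T) pt A}"
    interpret ring A by (rule superalgebra.axioms(1)[OF A])
    have g: "g \<in> pts A" "g (monomial_xi 0) = \<zero>\<^bsub>A\<^esub>" using gh stabilizer_iff_torus[OF A _ TR] by auto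
    have h: "h \<in> pts A" using gh by simp
    show "pull (dual L) {} f A (mul A g h) =
        act (carrier (spoly_alg (dual L) {})) (\<lambda>_. 0) A (pull (dual L) {} f A g) (pull (dual L) {} f A h)"
    proof (rule pull_act[OF A M f _ g(1) h])
      fix l assume "l \<in> dual L - {}"
      then have "f l \<in> dual N" using add_mapD(1)[OF f] by blast
      then show "c (f l) \<odot>\<^bsub>A\<^esub> (g (monomial_xi (f l)) \<otimes>\<^bsub>A\<^esub> h (monomial_xi (f l))) = \<zero>\<^bsub>A\<^esub>"
        using xi_zero[OF A g] salg_hom_monomial(2)[OF A M h] by (simp add: smult_zero[OF A])
    qed auto
  next
    fix A B :: "'u superalgebra" and \<phi> g
    assume "superalgebra A" "superalgebra B" "\<phi> \<in> salg_hom A B"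
      "g \<in> {g \<in> pts A. move A g = base_change_point (spoly_alg S T) pt A}"
    then show "pull (dual L) {} f B (compose (carrier (spoly_alg (dual N) (dual N))) \<phi> g) =
        compose (carrier (spoly_alg (dual L) {})) \<phi> (pull (dual L) {} f A g)"
      by (auto intro!: compose_pull[OF _ _ _ M f, symmetric])
  qed
qed

text \<open>As \<open>f\<close> maps onto \<open>R\<close>, pulling back along \<open>f\<close>
  retains exactly what distinguishes points of the orbit. The left inverse \<open>e\<close> makes it
  surjective, and vanishing of \<open>c\<close> on \<open>R\<close> makes it multiplicative for the
  undeformed product.\<close>

lemma orbit_iso_torus:
  assumes "point_action (dual N) S T R c pt" and TR: "T \<inter> R = {}"
    and f: "add_map (dual L) (dual N) f" and fR: "f ` dual L = R"
    and e: "add_map (dual N) (dual L) e" and ef: "\<And>l. l \<in> dual L \<Longrightarrow> e (f l) = l"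
    and cR: "\<And>l. l \<in> R \<Longrightarrow> c l = 0"
  shows "orbit_iso N c (spoly_alg S T) pt (torus L :: (_, 'u) group_functor)"
proof -
  interpret point_action "dual N" S T R c pt by fact
  note EL = exponents_dual(2)[of L]
  have pull_pts: "pull (dual L) {} f A g \<in> salg_hom (spoly_alg (dual L) {}) A"
    if "superalgebra A" "g \<in> pts A" for A :: "'u superalgebra" and g
    by (rule salg_hom_pull[OF that(1) EL _ M f that(2)]) simp
  show ?thesis
  proof (rule orbit_isoI[where \<Phi> = "pull (dual L) {} f"];
      unfold torus_simps supertorus_ring_eq move_def[symmetric])
    fix A :: "'u superalgebra" and g h assume A: "superalgebra A" and g: "g \<in> pts A" and h: "h \<in> pts A"
    have "pull (dual L) {} f A g = pull (dual L) {} f A h \<longleftrightarrow> (\<forall>l\<in>dual L. g (monomial (f l)) = h (monomial (f l)))"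
    proof
      assume "pull (dual L) {} f A g = pull (dual L) {} f A h"
      then show "\<forall>l\<in>dual L. g (monomial (f l)) = h (monomial (f l))"
        using pull_monomial(1)[OF A M f g, of _ "{}"] pull_monomial(1)[OF A M f h, of _ "{}"] by metis
    next
      assume "\<forall>l\<in>dual L. g (monomial (f l)) = h (monomial (f l))"
      then show "pull (dual L) {} f A g = pull (dual L) {} f A h"
        using pull_monomial(1)[OF A M f g] pull_monomial(1)[OF A M f h]
        by (intro salg_hom_eqI[OF A EL pull_pts[OF A g] pull_pts[OF A h]]) auto
    qed
    then show "move A g = move A h \<longleftrightarrow> pull (dual L) {} f A g = pull (dual L) {} f A h"
      using move_eq_iff_torus[OF A g h TR] by (simp flip: fR)
  next
    fix A :: "'u superalgebra" assume A: "superalgebra A"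
    show "pull (dual L) {} f A ` pts A = salg_hom (spoly_alg (dual L) {}) A"
    proof (intro equalityI subsetI)
      fix g assume g: "g \<in> salg_hom (spoly_alg (dual L) {}) A"
      note ext = even_extension[OF A M e EL g]
      have "g = pull (dual L) {} f A (extend_data (dual N) (dual N) A (\<lambda>m. g (monomial (e m))) (\<lambda>_. \<zero>\<^bsub>A\<^esub>))"
        by (rule salg_hom_eqI[OF A EL g pull_pts[OF A ext(1)]])
          (use ext(2) pull_monomial(1)[OF A M f ext(1)] add_mapD(1)[OF f] ef in auto)
      then show "g \<in> pull (dual L) {} f A ` pts A" using ext(1) by blast
    qed (use pull_pts[OF A] in auto)
  next
    fix A B :: "'u superalgebra" and \<phi> g
    assume *: "superalgebra A" "superalgebra B" "\<phi> \<in> salg_hom A B" "g \<in> pts A"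
    show "pull (dual L) {} f B (compose (carrier (spoly_alg (dual N) (dual N))) \<phi> g) =
        compose (carrier (spoly_alg (dual L) {})) \<phi> (pull (dual L) {} f A g)"
      by (rule compose_pull[OF *(1-3) M f _ *(4), symmetric]) simp
    show "compose (carrier (spoly_alg S T)) \<phi> (move A g) = move B (compose (carrier (spoly_alg (dual N) (dual N))) \<phi> g)"
      using * by (rule move_natural)
    show "compose (carrier (spoly_alg (dual N) (dual N))) \<phi> g \<in> pts B"
      using *(4,3) by (rule compose_closed)
  next
    fix A :: "'u superalgebra" and g h assume *: "superalgebra A" "g \<in> pts A" "h \<in> pts A"
    show "mul A g h \<in> pts A" using * by (rule mul_closed)
    interpret ring A by (rule superalgebra.axioms(1)[OF *(1)])
    show "pull (dual L) {} f A (mul A g h) =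
        act (carrier (spoly_alg (dual L) {})) (\<lambda>_. 0) A (pull (dual L) {} f A g) (pull (dual L) {} f A h)"
    proof (rule pull_act[OF *(1) M f _ *(2,3)])
      fix l assume "l \<in> dual L - {}"
      then have "f l \<in> dual N" "f l \<in> R" using add_mapD(1)[OF f] fR by auto
      then show "c (f l) \<odot>\<^bsub>A\<^esub> (g (monomial_xi (f l)) \<otimes>\<^bsub>A\<^esub> h (monomial_xi (f l))) = \<zero>\<^bsub>A\<^esub>"
        using salg_hom_monomial(2)[OF *(1) M] *(2,3) cR by (simp add: zero_smult[OF *(1)])
    qed auto
  qed
qed

text \<open>The same argument with the value at \<xi> retained. It is the odd value at exponent 0,
  which \<open>f\<close> fixes, and it determines all other odd values by multiplication with the
  character.\<close>

lemma orbit_iso_supertorus: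
  assumes "point_action (dual N) S T R c pt" and TR: "T \<inter> R \<noteq> {}"
    and f: "add_map (dual L) (dual N) f" and fR: "f ` dual L = R"
    and e: "add_map (dual N) (dual L) e" and ef: "\<And>l. l \<in> dual L \<Longrightarrow> e (f l) = l"
    and c': "\<And>l. l \<in> dual L \<Longrightarrow> c' l = c (f l)"
  shows "orbit_iso N c (spoly_alg S T) pt (supertorus L c' :: (_, 'u) group_functor)"
proof -
  interpret point_action "dual N" S T R c pt by fact
  note EL = exponents_dual(1)[of L]
  have pull_pts: "pull (dual L) (dual L) f A g \<in> salg_hom (spoly_alg (dual L) (dual L)) A"
    if "superalgebra A" "g \<in> pts A" for A :: "'u superalgebra" and g
    by (rule salg_hom_pull[OF that(1) EL _ M f that(2)]) simp
  show ?thesis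
  proof (rule orbit_isoI[where \<Phi> = "pull (dual L) (dual L) f"];
      unfold supertorus_simps supertorus_ring_eq move_def[symmetric])
    fix A :: "'u superalgebra" and g h assume A: "superalgebra A" and g: "g \<in> pts A" and h: "h \<in> pts A"
    note pg = pull_monomial[OF A M f g, of _ "dual L"] and ph = pull_monomial[OF A M f h, of _ "dual L"]
    have f0: "f 0 = 0" using f by (rule add_mapD(2))
    have "pull (dual L) (dual L) f A g = pull (dual L) (dual L) f A h \<longleftrightarrow>
        (\<forall>l\<in>dual L. g (monomial (f l)) = h (monomial (f l))) \<and> g (monomial_xi 0) = h (monomial_xi 0)"
    proof
      assume eq: "pull (dual L) (dual L) f A g = pull (dual L) (dual L) f A h"
      have "g (monomial (f l)) = h (monomial (f l))" if "l \<in> dual L" for l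
        using pg(1)[OF that] ph(1)[OF that] eq by simp
      moreover have "g (monomial_xi 0) = h (monomial_xi 0)"
        using pg(2)[OF dual_zero] ph(2)[OF dual_zero] eq f0 by simp
      ultimately show "(\<forall>l\<in>dual L. g (monomial (f l)) = h (monomial (f l))) \<and> g (monomial_xi 0) = h (monomial_xi 0)"
        by blast
    next
      assume eq: "(\<forall>l\<in>dual L. g (monomial (f l)) = h (monomial (f l))) \<and> g (monomial_xi 0) = h (monomial_xi 0)"
      show "pull (dual L) (dual L) f A g = pull (dual L) (dual L) f A h"
      proof (rule salg_hom_eqI[OF A EL pull_pts[OF A g] pull_pts[OF A h]])
        fix l assume l: "l \<in> dual L"
        then have fl: "f l \<in> dual N" using add_mapD(1)[OF f] by blast
        show "pull (dual L) (dual L) f A g (monomial l) = pull (dual L) (dual L) f A h (monomial l)"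
          using pg(1)[OF l] ph(1)[OF l] eq l by simp
        show "pull (dual L) (dual L) f A g (monomial_xi l) = pull (dual L) (dual L) f A h (monomial_xi l)"
          using pg(2)[OF l] ph(2)[OF l] eq l salg_hom_xi[OF A M g fl] salg_hom_xi[OF A M h fl] by simp
      qed
    qed
    then show "move A g = move A h \<longleftrightarrow> pull (dual L) (dual L) f A g = pull (dual L) (dual L) f A h"
      using move_eq_iff_supertorus[OF A g h TR] by (simp flip: fR)
  next
    fix A :: "'u superalgebra" assume A: "superalgebra A"
    show "pull (dual L) (dual L) f A ` pts A = salg_hom (spoly_alg (dual L) (dual L)) A"
    proof (intro equalityI subsetI)
      fix g assume g: "g \<in> salg_hom (spoly_alg (dual L) (dual L)) A"
      have eg: "pull (dual N) (dual N) e A g \<in> pts A"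
        by (rule salg_hom_pull[OF A M _ EL e g]) simp
      have "g = pull (dual L) (dual L) f A (pull (dual N) (dual N) e A g)"
        by (rule salg_hom_eqI[OF A EL g pull_pts[OF A eg]])
          (use pull_monomial[OF A EL e g] pull_monomial[OF A M f eg] add_mapD(1)[OF f] ef in auto)
      then show "g \<in> pull (dual L) (dual L) f A ` pts A" using eg by blast
    qed (use pull_pts[OF A] in auto)
  next
    fix A B :: "'u superalgebra" and \<phi> g
    assume *: "superalgebra A" "superalgebra B" "\<phi> \<in> salg_hom A B" "g \<in> pts A"
    show "pull (dual L) (dual L) f B (compose (carrier (spoly_alg (dual N) (dual N))) \<phi> g) =
        compose (carrier (spoly_alg (dual L) (dual L))) \<phi> (pull (dual L) (dual L) f A g)"
      by (rule compose_pull[OF *(1-3) M f _ *(4), symmetric]) simp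
    show "compose (carrier (spoly_alg S T)) \<phi> (move A g) = move B (compose (carrier (spoly_alg (dual N) (dual N))) \<phi> g)"
      using * by (rule move_natural)
    show "compose (carrier (spoly_alg (dual N) (dual N))) \<phi> g \<in> pts B"
      using *(4,3) by (rule compose_closed)
  next
    fix A :: "'u superalgebra" and g h assume *: "superalgebra A" "g \<in> pts A" "h \<in> pts A"
    show "mul A g h \<in> pts A" using * by (rule mul_closed)
    show "pull (dual L) (dual L) f A (mul A g h) =
        act (carrier (spoly_alg (dual L) (dual L))) c' A (pull (dual L) (dual L) f A g) (pull (dual L) (dual L) f A h)"
      using c' by (intro pull_act[OF *(1) M f _ *(2,3)]) auto
  qed
qed

section \<open>Verification of the action data and the two cases\<close>

theorem proposition7p13:
  fixes N :: "'n monoid"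
    and c :: "('n \<Rightarrow> int) \<Rightarrow> complex"
    and q r s :: nat
    and m n :: "nat \<Rightarrow> 'n \<Rightarrow> int"
    and p :: "nat \<Rightarrow> nat \<Rightarrow> nat"
    and a :: "nat \<Rightarrow> complex"
    and pt :: "('n \<Rightarrow> int) spoly \<Rightarrow> complex"
    and \<sigma> :: "(('n \<Rightarrow> int) \<Rightarrow> real) set"
  defines "S \<equiv> nat_combinations r m"
    and "Y \<equiv> coord_ring N r s m n"
    and "N\<^sub>\<sigma> \<equiv> cone_sublattice N \<sigma>"
    and "N\<^sub>q \<equiv> cone_quotient N \<sigma>"
  assumes lattice: "Zlattice N"
    and c: "c \<in> lat_tensor N"
    and A: "m ` {1..r} \<subseteq> dual N" "inj_on m {1..r}" "int_combinations r m = dual N"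
    and q: "q \<le> r" "\<And>i. i \<in> {1..r} \<Longrightarrow> c (m i) \<noteq> 0 \<longleftrightarrow> i \<le> q"
    and B: "1 \<le> s" "q \<le> s" "inj_on n {1..s}"
    and n: "\<And>j. j \<in> {1..s} \<Longrightarrow> n j = (\<lambda>x. \<Sum>i=1..r. int (p j i) * m i x)"
    and p_le_q: "\<And>i j. j \<in> {1..q} \<Longrightarrow> i \<in> {1..r} \<Longrightarrow> p j i = (if i = j then 1 else 0)"
    and p_gt_q: "\<And>i j. j \<in> {q<..s} \<Longrightarrow> i \<in> {1..q} \<Longrightarrow> p j i = 0"
    and normal: "normal_semigroup_ring S"
    and pt: "pt \<in> salg_hom Y complex_salg"
      "\<And>i. i \<in> {1..r} \<Longrightarrow> pt (monomial (m i)) = a i"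
      "\<And>j. j \<in> {1..s} \<Longrightarrow> pt (monomial_xi (n j)) = 0"
    and \<sigma>: "\<sigma> \<in> cone_faces N (affine_cone N S)"
      "(\<lambda>l\<in>S. pt (monomial l)) \<in> Orb N S \<sigma>"
  shows "if \<forall>j\<in>{1..s}. (\<Prod>i=1..r. a i ^ p j i) = 0
    then (\<exists>c'\<in>lat_tensor N\<^sub>\<sigma>. c = lat_pushforward N\<^sub>\<sigma> N (\<lambda>x. x) c' \<and>
            group_functor_iso
              (stabilizer N c Y pt :: (('n \<Rightarrow> int) spoly, 'u) group_functor)
              (supertorus N\<^sub>\<sigma> c')) \<and>
         orbit_iso N c Y pt (torus N\<^sub>q :: (('n set \<Rightarrow> int) spoly, 'u) group_functor)
    else group_functor_iso
           (stabilizer N c Y pt :: (('n \<Rightarrow> int) spoly, 'u) group_functor)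
           (torus N\<^sub>\<sigma>) \<and>
         orbit_iso N c Y pt
           (supertorus N\<^sub>q
              (lat_pushforward N N\<^sub>q (\<lambda>x. carrier N\<^sub>\<sigma> #>\<^bsub>N\<^esub> x) c)
              :: (('n set \<Rightarrow> int) spoly, 'u) group_functor)"
proof -
  let ?T = "odd_exponents r s m n" and ?L = "cone_sublattice N \<sigma>" and ?Q = "cone_quotient N \<sigma>"
  have N: "comm_group N" using lattice by (simp add: Zlattice_def)
  have gens: "m i \<in> dual N" if "i \<in> {1..r}" for i using A(1) that by blast
  interpret toric_face N r m \<sigma>
    by (rule toric_face.intro) (use N gens A(3) normal \<sigma>(1) in \<open>auto simp: S_def\<close>)
  let ?K = "carrier ?L"
  let ?R = "annihilator N ?K"
  have nS: "n j \<in> nat_combinations r m" if "j \<in> {1..s}" for j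
    using n[OF that] by (rule nat_combinationsI)
  have Y: "Y = spoly_alg S ?T"
    unfolding Y_def S_def using gens nS by (rule coord_ring_eq)
  have ST: "exponents S ?T" unfolding S_def by (rule exponents_coord)
  have pt': "pt \<in> salg_hom (spoly_alg S ?T) complex_salg" using pt(1) by (simp add: Y)
  have SN: "S \<subseteq> dual N" using S_dual by (auto simp: S_def)
  have TS: "?T \<subseteq> S"
    using nS nat_combinations_add unfolding odd_exponents_def S_def by blast
  have c_zero: "c 0 = 0"
    using lat_tensor_add[OF c dual_zero dual_zero] by simp
  have c_comb: "c (\<lambda>x. \<Sum>i\<in>I. k i * m i x) = (\<Sum>i\<in>I. of_int (k i) * c (m i))" if "I \<subseteq> {1..r}" for I k
    by (rule lat_tensor_combination[OF c]) (use that gens in auto)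
  have n_le_q: "n i = m i" if "i \<in> {1..q}" for i
  proof -
    have i: "i \<in> {1..r}" "i \<in> {1..s}" using that q(1) B(2) by auto
    have "(\<Sum>i'=1..r. int (p i i') * m i' x) = (\<Sum>i'=1..r. if i' = i then m i' x else 0)" for x
      by (rule sum.cong) (use p_le_q[OF that] in auto)
    then show ?thesis using n[OF i(2)] i(1) by (auto simp: fun_eq_iff)
  qed
  have c_T: "l \<in> ?T" if l: "l \<in> S" "c l \<noteq> 0" for l
  proof -
    obtain k where k: "l = (\<lambda>x. \<Sum>i=1..r. int (k i) * m i x)" using l(1) by (auto simp: S_def nat_combinations_def)
    have "(\<Sum>i=1..r. of_int (int (k i)) * c (m i)) \<noteq> 0"
      using l(2) c_comb[of "{1..r}" "\<lambda>i. int (k i)"] by (simp add: k)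
    then obtain i where i: "i \<in> {1..r}" "k i \<noteq> 0" "c (m i) \<noteq> 0"
      by (metis (no_types, lifting) mult_eq_0_iff of_int_0 of_nat_0 sum.neutral)
    then have iq: "i \<in> {1..q}" using q(2) by auto
    \<comment> \<open>A nonzero \<open>c l\<close> forces some generator with
      \<open>i \<le> q\<close> to occur in \<open>l\<close>. One copy of it is replaced by the equal
      exponent \<open>n i\<close>; the natural subtraction is exact because \<open>k i\<close> is
      nonzero.\<close>
    define k' where "k' i' = (if i' = i then k i' - 1 else k i')" for i'
    have "l = (\<lambda>x. \<Sum>i'=1..r. int (k' i') * m i' x) + n i"
    proof
      fix x
      have "l x = (\<Sum>i'=1..r. int (k' i') * m i' x + (if i' = i then m i' x else 0))"
        unfolding k by (rule sum.cong) (use i(2) in \<open>auto simp: k'_def of_nat_diff algebra_simps\<close>)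
      then show "l x = ((\<lambda>x. \<Sum>i'=1..r. int (k' i') * m i' x) + n i) x"
        using i(1) n_le_q[OF iq] by (simp add: sum.distrib)
    qed
    moreover have "(\<lambda>x. \<Sum>i'=1..r. int (k' i') * m i' x) \<in> nat_combinations r m"
      by (rule nat_combinationsI[OF refl])
    moreover have "i \<in> {1..s}" using iq B(2) by auto
    ultimately show ?thesis unfolding odd_exponents_def by blast
  qed
  note pt_data = char_dataD[OF salg_hom_char_data[OF superalgebra_complex ST pt']]
  have pt_zero: "pt (monomial 0) = 1" using pt_data(3) by (simp add: complex_salg_def)
  have pt_add: "pt (monomial (l + l')) = pt (monomial l) * pt (monomial l')" if "l \<in> S" "l' \<in> S" for l l'
    using pt_data(4)[OF that] by (simp add: complex_salg_def)
  \<comment> \<open>Membership in the orbit writes the point as a nowhere vanishing torus character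
    times the indicator of the exponents orthogonal to \<sigma>.\<close>
  have support: "pt (monomial l) \<noteq> 0 \<longleftrightarrow> l \<in> ?R" if l: "l \<in> S" for l
  proof -
    obtain t where t: "t \<in> carrier (points (torus N) complex_salg)"
      "(\<lambda>l\<in>S. pt (monomial l)) = (\<lambda>l\<in>S. t (monomial l) * (if \<forall>u\<in>\<sigma>. u l = 0 then 1 else 0))"
      using \<sigma>(2) by (auto simp: Orb_def)
    have t': "t \<in> salg_hom (spoly_alg (dual N) {}) complex_salg" using t(1) by (simp add: torus_simps)
    note td = char_dataD[OF salg_hom_char_data[OF superalgebra_complex exponents_dual(2) t']]
    have lN: "l \<in> dual N" using l SN by auto
    have "t (monomial l) * t (monomial (- l)) = 1"
      using td(3) td(4)[OF lN dual_uminus[OF lN]] by (simp add: complex_salg_def)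
    then have "t (monomial l) \<noteq> 0" by auto
    moreover have "pt (monomial l) = t (monomial l) * (if \<forall>u\<in>\<sigma>. u l = 0 then 1 else 0)"
      using fun_cong[OF t(2), of l] l by simp
    ultimately show ?thesis using orthogonal_iff_annihilates l by (auto simp: S_def)
  qed
  have PA: "point_action (dual N) S ?T ?R c pt"
  proof
    show "c (l + l') = c l + c l'" if "l \<in> dual N" "l' \<in> dual N" for l l'
      using that by (rule lat_tensor_add[OF c])
    show "?R \<subseteq> dual N" by (auto simp: annihilator_def)
    show "\<exists>a\<in>S \<inter> ?R. \<exists>b\<in>S \<inter> ?R. a = v + b" if "v \<in> ?R" for v
      using annihilator_diff[OF that] by (simp add: S_def)
  qed (use ST SN TS c_zero c_T pt' support in \<open>auto intro: dual_zero dual_add dual_uminus\<close>)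
  have pt_n: "pt (monomial (n j)) = (\<Prod>i=1..r. a i ^ p j i)" if j: "j \<in> {1..s}" for j
  proof -
    have "pt (monomial (n j)) = (\<Prod>i=1..r. pt (monomial (m i)) ^ p j i)"
      unfolding n[OF j] by (rule character_nat_combination[where ev = "\<lambda>l. pt (monomial l)"])
        (use pt_zero pt_add in \<open>auto simp: S_def\<close>)
    then show ?thesis using pt(2) by simp
  qed
  have nT: "n j \<in> ?T" if "j \<in> {1..s}" for j
    unfolding odd_exponents_def using that nat_combinations_zero[of r m]
    by (intro CollectI exI[of _ 0] exI[of _ j]) auto
  \<comment> \<open>Translates the case distinction: the point is multiplicative, so it vanishes on
    all odd exponents as soon as it vanishes at every \<open>n j\<close>.\<close>
  have TR: "?T \<inter> ?R = {} \<longleftrightarrow> (\<forall>j\<in>{1..s}. (\<Prod>i=1..r. a i ^ p j i) = 0)"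
  proof
    assume "?T \<inter> ?R = {}"
    then show "\<forall>j\<in>{1..s}. (\<Prod>i=1..r. a i ^ p j i) = 0"
      using nT support TS pt_n by (metis disjoint_iff subsetD)
  next
    assume 0: "\<forall>j\<in>{1..s}. (\<Prod>i=1..r. a i ^ p j i) = 0"
    have "pt (monomial (l + n j)) = 0" if "l \<in> S" "j \<in> {1..s}" for l j
      using pt_add[OF that(1), of "n j"] nS[OF that(2)] pt_n[OF that(2)] 0 that(2) by (simp add: S_def)
    then have "pt (monomial l) = 0" if "l \<in> ?T" for l
      using that by (auto simp: odd_exponents_def S_def)
    then show "?T \<inter> ?R = {}" using support TS by blast
  qed
  obtain h where h: "\<And>x. x \<in> carrier N \<Longrightarrow> h x \<in> ?K" "\<And>x. x \<in> ?K \<Longrightarrow> h x = x"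
    "add_map (dual ?L) (dual N) (inflate N h)"
    using retraction by metis
  have restrict_inflate_h: "restrict_dual (inflate N h l) = l" if "l \<in> dual ?L" for l
    using h(2) that by (rule restrict_inflate)
  have inflate_restrict_h: "l - inflate N h (restrict_dual l) \<in> ?R" if "l \<in> dual N" for l
    using inflate_restrict[OF h that] .
  have restrict_R: "restrict_dual l = 0" if "l \<in> ?R" for l
    using that by (auto simp: annihilator_def inflate_def fun_eq_iff)
  obtain f where f: "add_map (dual N) (dual ?Q) f" "\<And>l. l \<in> dual ?Q \<Longrightarrow> f (coset_dual l) = l"
    using coset_dual_section by metis
  have coset_R: "coset_dual ` dual ?Q = ?R"
    using coset_dual_annihilator coset_dual_surj by blast
  show ?thesis
  proof (cases "\<forall>j\<in>{1..s}. (\<Prod>i=1..r. a i ^ p j i) = 0")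
    case True
    then have empty: "?T \<inter> ?R = {}" using TR by blast
    have cR: "c v = 0" if v: "v \<in> ?R" for v
    proof -
      obtain k where k: "v = (\<lambda>x. \<Sum>i\<in>J. k i * m i x)" using annihilator_combination[OF v] .
      have "c (m i) = 0" if "i \<in> J" for i
      proof (rule ccontr)
        assume "c (m i) \<noteq> 0"
        then have "m i \<in> ?T \<inter> ?R"
          using c_T[of "m i"] nat_combinations_gen[of i r m] that by (auto simp: J_eq S_def)
        then show False using empty by blast
      qed
      moreover have "J \<subseteq> {1..r}" by (auto simp: J_def)
      ultimately show ?thesis unfolding k by (simp add: c_comb)
    qed
    \<comment> \<open>The image of \<open>c\<close> under the retraction \<open>h\<close>. Pushing
      it forward again gives back \<open>c\<close>, because \<open>l\<close> and the inflation of
      its restriction differ by an element of the annihilator, where \<open>c\<close>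
      vanishes.\<close>
    define c' where "c' l = (if l \<in> dual ?L then c (inflate N h l) else 0)" for l
    have c': "c' \<in> lat_tensor ?L"
      unfolding c'_def
      by (rule lat_tensor_pullback[OF c, of h]) (use h add_mapD(1)[OF h(3)] in \<open>auto simp: inflate_def\<close>)
    have "c l = lat_pushforward ?L N (\<lambda>x. x) c' l" for l
    proof (cases "l \<in> dual N")
      case True
      have r: "restrict_dual l \<in> dual ?L" using add_mapD(1)[OF add_map_restrict True] .
      have i: "inflate N h (restrict_dual l) \<in> dual N" using add_mapD(1)[OF h(3) r] .
      have "c l = c ((l - inflate N h (restrict_dual l)) + inflate N h (restrict_dual l))" by simp
      also have "\<dots> = c (l - inflate N h (restrict_dual l)) + c (inflate N h (restrict_dual l))"
        using dual_diff[OF True i] i by (rule lat_tensor_add[OF c])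
      also have "\<dots> = c' (restrict_dual l)" using cR[OF inflate_restrict_h[OF True]] r by (simp add: c'_def)
      also have "\<dots> = lat_pushforward ?L N (\<lambda>x. x) c' l" using True by (simp add: lat_pushforward_def inflate_def)
      finally show ?thesis .
    next
      case False
      then show ?thesis using lat_tensor_outside[OF c] by (simp add: lat_pushforward_def)
    qed
    then have push: "c = lat_pushforward ?L N (\<lambda>x. x) c'" by blast
    have "group_functor_iso (stabilizer N c Y pt :: (('n \<Rightarrow> int) spoly, 'u) group_functor) (supertorus ?L c')"
      unfolding Y
      by (rule stabilizer_iso_supertorus[OF PA empty h(3) add_map_restrict restrict_inflate_h inflate_restrict_h restrict_R])
        (auto simp: c'_def)
    moreover have "orbit_iso N c Y pt (torus ?Q :: (('n set \<Rightarrow> int) spoly, 'u) group_functor)"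
      unfolding Y by (rule orbit_iso_torus[OF PA empty add_map_coset coset_R f cR])
    ultimately show ?thesis using True c' push unfolding N\<^sub>\<sigma>_def N\<^sub>q_def by auto
  next
    case False
    then have nonempty: "?T \<inter> ?R \<noteq> {}" using TR by blast
    have "group_functor_iso (stabilizer N c Y pt :: (('n \<Rightarrow> int) spoly, 'u) group_functor) (torus ?L)"
      unfolding Y
      by (rule stabilizer_iso_torus[OF PA nonempty h(3) add_map_restrict restrict_inflate_h inflate_restrict_h restrict_R])
    moreover have "orbit_iso N c Y pt
        (supertorus ?Q (lat_pushforward N ?Q (\<lambda>x. ?K #>\<^bsub>N\<^esub> x) c) :: (('n set \<Rightarrow> int) spoly, 'u) group_functor)"
      unfolding Y
      by (rule orbit_iso_supertorus[OF PA nonempty add_map_coset coset_R f])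
        (auto simp: lat_pushforward_def inflate_def)
    ultimately show ?thesis using False unfolding N\<^sub>\<sigma>_def N\<^sub>q_def by (simp only: if_False)
  qed
qed

end
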